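(* Let $r\ge 1$ and let $L=I\cdot\frac{\partial^2}{\partial x^2}+U(x)$ be the one-dimensional matrix Schrödinger operator, where $U(x)$ is a smooth $r\times r$ hermitian matrix function of one real variable $x$ and $I$ is the $r\times r$ identity matrix. For every integer $n\ge 1$, the polynomial $G_n[U]$ defining the matrix KdV hierarchy $\frac{\partial U}{\partial t}=\frac{\partial}{\partial x}G_n[U]$ is equal to $$G_n[U]=\frac{(2n)!}{2\cdot n!}\sum_{j=0}^n\binom{n+\frac12}{j+\frac12}\frac{(-1)^j(2j)!}{4^j\,j!\,(j+n)!}\sum_{p=1}^{j+n}\ \sum_{\substack{k_1,\dots,k_p\\ k_1+\cdots+k_p=2(n-p)}}C_{k_1,\dots,k_p}\,U_{k_1}\cdots U_{k_p},$$ where $k_1,\dots,k_p$ run over nonnegative integers and, for given $n$ and $j$, $$C_{k_1,\dots,k_p}=\sum_{\substack{0\le l_0\le l_1\le\cdots\le l_{p-1}\le j+n-p\\ 2l_i\ge k_1+\cdots+k_{i+1},\ i=0,\dots,p-1}}\binom{2l_0}{k_1}\binom{2l_1-k_1}{k_2}\cdots\binom{2l_{p-1}-k_1-\cdots-k_{p-1}}{k_p},$$ the sum being over integers $l_0,\dots,l_{p-1}$.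
   Context: Notation: $U_0=U$ and $U_i=\partial^iU/\partial x^i$ for $i\ge 1$; the $U_i$, $i\ge 0$, are also regarded as formal variables, which do not commute. An empty sum is zero (in particular the terms with $p>n$ vanish, since $k_1+\cdots+k_p=2(n-p)$ then has no solutions in nonnegative integers). Definition of $G_n[U]$: let $H(t,x,y)$ be the heat kernel of $L$, i.e. the fundamental solution of the heat equation $\left(\frac{\partial}{\partial t}-L\right)f=0$. On the diagonal it has the asymptotic representation as $t\to 0+$ $$H(t,x,x)\sim\frac{1}{\sqrt{4\pi t}}\sum_{n=0}^\infty h_n[U]\,t^n,$$ where the $h_n[U]$ are universal polynomials in the matrix $U(x)$ and its derivatives. For $n\in\mathbb{N}$ (i.e. $n\ge 1$), $$G_n[U]=G_n[U_0,U_1,U_2,\dots]=\frac{(2n)!}{2\cdot n!}h_n[U].$$ For example, $G_1[U]=U_0$, $G_2[U]=U_2+3U_0^2$. The binomial coefficients with half-integer entries are $$\binom{n+\frac12}{j+\frac12}=\frac{\Gamma(n+\frac32)}{(n-j)!\,\Gamma(j+\frac32)}.$$ *)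

theory Defs
  imports "HOL-Analysis.Analysis" "HOL-Library.Landau_Symbols"
begin

definition Dx :: "nat \<Rightarrow> (real \<Rightarrow> 'a::real_normed_vector) \<Rightarrow> real \<Rightarrow> 'a" where
  "Dx k U = ((\<lambda>f x. vector_derivative f (at x)) ^^ k) U"

definition smooth :: "(real \<Rightarrow> 'a::real_normed_vector) \<Rightarrow> bool" where
  "smooth U \<longleftrightarrow> (\<forall>k x. Dx k U differentiable (at x))"

definition hermitian :: "complex^'r^'r \<Rightarrow> bool" where
  "hermitian A \<longleftrightarrow> (\<forall>i j. A $ i $ j = cnj (A $ j $ i))"

text \<open>
  \<open>heat_kernel U H\<close>: \<open>H t x y\<close> is a fundamental solution of the heat equation of
  \<open>L = d\<^sup>2/dx\<^sup>2 + U\<close>, that is, for every pole \<open>y\<close> the function \<open>(t, x) \<mapsto> H t x y\<close> is a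
  classical solution (continuous first \<open>t\<close>- and second \<open>x\<close>-derivatives) for \<open>t > 0\<close> whose initial value is \<open>\<delta>(x - y) I\<close>, in the sense
  of weak convergence against continuous compactly supported functions. No growth
  conditions at infinity are imposed, so for unbounded \<open>U\<close> (or even \<open>U = 0\<close>) such an \<open>H\<close> need
  not be unique; its asymptotics on the diagonal as \<open>t\<close> tends to \<open>0\<close> are local in \<open>U\<close> and do
  not depend on the choice.
\<close>

definition heat_kernel ::
    "(real \<Rightarrow> complex^'r^'r) \<Rightarrow> (real \<Rightarrow> real \<Rightarrow> real \<Rightarrow> complex^'r^'r) \<Rightarrow> bool" where
  "heat_kernel U H \<longleftrightarrow>
    (\<forall>y. \<exists>Ht Hx Hxx.
       continuous_on ({0<..} \<times> UNIV) (\<lambda>(t, x). H t x y) \<and>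
       continuous_on ({0<..} \<times> UNIV) (\<lambda>(t, x). Ht t x) \<and>
       continuous_on ({0<..} \<times> UNIV) (\<lambda>(t, x). Hx t x) \<and>
       continuous_on ({0<..} \<times> UNIV) (\<lambda>(t, x). Hxx t x) \<and>
       (\<forall>t>0. \<forall>x.
          ((\<lambda>s. H s x y) has_vector_derivative Ht t x) (at t) \<and>
          ((\<lambda>z. H t z y) has_vector_derivative Hx t x) (at x) \<and>
          ((\<lambda>z. Hx t z) has_vector_derivative Hxx t x) (at x) \<and>
          Ht t x = Hxx t x + U x ** H t x y)) \<and>
    (\<forall>y (\<phi> :: real \<Rightarrow> real). continuous_on UNIV \<phi> \<and> bounded {x. \<phi> x \<noteq> 0} \<longrightarrow>
       ((\<lambda>t. integral UNIV (\<lambda>x. \<phi> x *\<^sub>R H t x y)) \<longlongrightarrow> \<phi> y *\<^sub>R mat 1) (at_right 0))"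

text \<open>
  The expansion \<open>H(t,x,x) \<sim> (4\<pi>t)\<^sup>-\<^sup>1\<^sup>/\<^sup>2 \<Sum>n. h n x t\<^sup>n\<close> as \<open>t\<close> tends to \<open>0\<close> from the right, in the
  sense of Poincare; it determines the coefficients \<open>h n x\<close> uniquely.
\<close>

definition heat_coefficients ::
    "(real \<Rightarrow> real \<Rightarrow> real \<Rightarrow> complex^'r^'r) \<Rightarrow> (nat \<Rightarrow> real \<Rightarrow> complex^'r^'r) \<Rightarrow> bool" where
  "heat_coefficients H h \<longleftrightarrow>
    (\<forall>x N. (\<lambda>t. norm (H t x x - (1 / sqrt (4 * pi * t)) *\<^sub>R (\<Sum>n\<le>N. t ^ n *\<^sub>R h n x)))
             \<in> o[at_right 0](\<lambda>t. t ^ N / sqrt t))"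

definition KdV_G :: "(nat \<Rightarrow> real \<Rightarrow> complex^'r^'r) \<Rightarrow> nat \<Rightarrow> real \<Rightarrow> complex^'r^'r" where
  "KdV_G h n x = (fact (2 * n) / (2 * fact n)) *\<^sub>R h n x"

definition half_binomial :: "nat \<Rightarrow> nat \<Rightarrow> real" where
  "half_binomial n j = Gamma (real n + 3/2) / (fact (n - j) * Gamma (real j + 3/2))"

definition U_monomial :: "(real \<Rightarrow> complex^'r^'r) \<Rightarrow> nat list \<Rightarrow> real \<Rightarrow> complex^'r^'r" where
  "U_monomial U ks x = foldr (\<lambda>k A. Dx k U x ** A) ks (mat 1)"

text \<open>
  Lists are indexed from \<open>0\<close>: \<open>ks ! i\<close> is \<open>k\<^sub>i\<^sub>+\<^sub>1\<close> and \<open>ls ! i\<close> is \<open>l\<^sub>i\<close>. In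
  \<open>C_coeff\<close>, where \<open>length ks \<le> j + n\<close>, and likewise in the binomial coefficients under the
  constraint on \<open>ls\<close>, the subtractions on \<open>nat\<close> do not truncate. In \<open>k_indices\<close> the
  condition \<open>k\<^sub>1 + \<dots> + k\<^sub>p = 2(n - p)\<close> is stated without subtraction, as \<open>p > n\<close> may occur.
\<close>

definition l_indices :: "nat \<Rightarrow> nat list \<Rightarrow> nat list set" where
  "l_indices m ks = {ls. length ls = length ks \<and> sorted ls \<and> set ls \<subseteq> {..m} \<and>
     (\<forall>i<length ks. sum_list (take (Suc i) ks) \<le> 2 * ls ! i)}"

definition C_coeff :: "nat \<Rightarrow> nat \<Rightarrow> nat list \<Rightarrow> nat" where
  "C_coeff n j ks = (\<Sum>ls\<in>l_indices (j + n - length ks) ks.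
     \<Prod>i<length ks. (2 * ls ! i - sum_list (take i ks)) choose (ks ! i))"

definition k_indices :: "nat \<Rightarrow> nat \<Rightarrow> nat list set" where
  "k_indices n p = {ks. length ks = p \<and> sum_list ks + 2 * p = 2 * n}"

end

theory Submission
  imports Defs "HOL-Probability.Distributions"
begin

text \<open>
  Fix the pole \<open>y\<close> and move it to \<open>0\<close>. Write \<open>G(\<tau>, x)\<close> for the Gaussian
  \<open>exp (-x\<^sup>2 / 4\<tau>) / sqrt (4\<pi>\<tau>)\<close> and \<open>u\<^sub>i\<close> for the Taylor coefficients of \<open>U\<close> at the pole. Requiring
  \<open>G \<Sum>k. \<tau>\<^sup>k a\<^sub>k(x)\<close> to be a formal solution of the adjoint equation \<open>E\<^sub>\<tau> = E\<^sub>x\<^sub>x + E U\<close> with initial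
  value \<open>\<delta>\<close> determines the formal power series \<open>a\<^sub>k\<close> recursively (\<open>heat_coeff\<close>). The theorem is the
  conjunction of an analytic fact, \<open>h\<^sub>n(y) = a\<^sub>n(0)\<close>, and an algebraic one, a closed formula for \<open>a\<^sub>n(0)\<close>.

  For the analytic fact, the heat kernel may grow arbitrarily at infinity, so only local information is
  available. Let \<open>v(t, \<sqdot>)\<close> be the heat kernel with pole \<open>0\<close>, and let \<open>E\<close> be the formal solution, truncated
  at high order and multiplied by a cutoff that vanishes at the end points of \<open>[-1, 1]\<close>. With
  integrals in \<open>x\<close> taken over this interval, Green's formula gives
  \<open>d/ds \<integral> E(T-s, x) v(s, x) dx = - \<integral> R(T-s, x) v(s, x) dx\<close>, where the residual
  \<open>R = E\<^sub>\<tau> - E\<^sub>x\<^sub>x - E U\<close> is uniformly of order \<open>\<tau>\<^sup>N\<close>. The integral \<open>\<integral> E(T-s, x) v(s, x) dx\<close> tends to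
  \<open>v(T, 0)\<close> as \<open>s\<close> tends to \<open>T\<close>, because \<open>E\<close> is an approximate identity there, and to \<open>E(T, 0)\<close> as \<open>s\<close>
  tends to \<open>0\<close>, because \<open>v\<close> has initial value \<open>\<delta>\<close>. Hence \<open>v(T, 0) - E(T, 0)\<close> is of order \<open>T\<^sup>N\<^sup>+\<^sup>1\<close>
  (\<open>duality_estimate\<close>, \<open>diagonal_expansion\<close>). The bound for \<open>\<integral> R v\<close> by \<open>sup \<bar>R\<bar>\<close>, uniformly in \<open>s\<close>, is
  the point where the weak form of the initial condition costs something: it is the principle of uniform
  boundedness (\<open>weakly_convergent_imp_weakly_bounded\<close>).

  For the algebraic fact, let \<open>L = d\<^sup>2/dx\<^sup>2 + U\<close> act on formal power series. Since \<open>G \<Sum>k. \<tau>\<^sup>k a\<^sub>k\<close>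
  represents the functional \<open>f \<mapsto> (exp (\<tau>L) f)(0)\<close>, comparing powers of \<open>\<tau>\<close> expresses \<open>(L\<^sup>m f)(0) / m!\<close> as
  a combination of Gaussian moments (\<open>schroedinger_power_eq_heat_pairing\<close>). For \<open>f = x\<^sup>2\<^sup>j\<close> and \<open>m = j + n\<close>
  this is a linear system for the numbers \<open>a\<^sub>n\<^sub>-\<^sub>i\<close> at order \<open>x\<^sup>2\<^sup>i\<close>, \<open>i \<le> n\<close>, with matrix
  \<open>(2(i+j))! / (i+j)!\<close>; up to the factors \<open>(-1)\<^sup>j / (4\<^sup>j j!)\<close>, the half-integer binomial coefficients are the
  row of the inverse matrix that extracts \<open>i = 0\<close> (\<open>half_binomial_moment_orthogonality\<close>). Finally, \<open>L\<^sup>j\<^sup>+\<^sup>n\<close> expands into words in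
  \<open>d\<^sup>2/dx\<^sup>2\<close> and \<open>U\<close>, and the Leibniz rule turns each word into products of binomial coefficients; the
  index \<open>l\<^sub>i\<close> counts the second derivatives to the left of the factor with index \<open>k\<^sub>i\<^sub>+\<^sub>1\<close>
  (\<open>schroedinger_power_word_expansion\<close>).
\<close>

section \<open>Matrix multiplication as a bounded bilinear map\<close>

lemma bounded_bilinear_matrix_mult:
  "bounded_bilinear ((**) :: complex^'n^'n \<Rightarrow> complex^'n^'n \<Rightarrow> complex^'n^'n)"
proof -
  have "bilinear ((**) :: complex^'n^'n \<Rightarrow> complex^'n^'n \<Rightarrow> complex^'n^'n)"
    unfolding bilinear_def
    by (auto intro!: linearI simp: matrix_add_ldistrib matrix_matrix_mult_def vec_eq_iff
        algebra_simps sum.distrib scaleR_sum_right)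
  then show ?thesis
    by (simp add: bilinear_conv_bounded_bilinear)
qed

interpretation matmul: bounded_bilinear "(**) :: complex^'n^'n \<Rightarrow> complex^'n^'n \<Rightarrow> complex^'n^'n"
  by (rule bounded_bilinear_matrix_mult)

section \<open>Heat coefficients and their Gaussian pairing\<close>

text \<open>
  The coefficient of \<open>\<tau>\<^sup>k x\<^sup>m\<close> in the formal factor \<open>\<Sum>k. \<tau>\<^sup>k a\<^sub>k(x)\<close> of the fundamental solution. Inserting
  \<open>G \<Sum>k. \<tau>\<^sup>k a\<^sub>k\<close> into \<open>E\<^sub>\<tau> = E\<^sub>x\<^sub>x + E U\<close> gives the transport equations
  \<open>(k + 1) a\<^sub>k\<^sub>+\<^sub>1 + x a\<^sub>k\<^sub>+\<^sub>1' = a\<^sub>k'' + a\<^sub>k U\<close>, whose Taylor coefficients are the recursion below. The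
  potential multiplies from the right because these series are paired with solutions standing on their
  right.
\<close>

fun heat_coeff :: "(nat \<Rightarrow> complex^'r^'r) \<Rightarrow> nat \<Rightarrow> nat \<Rightarrow> complex^'r^'r" where
  "heat_coeff u 0 m = (if m = 0 then mat 1 else 0)"
| "heat_coeff u (Suc k) m = (1 / real (Suc k + m)) *\<^sub>R
     (real ((m + 2) * (m + 1)) *\<^sub>R heat_coeff u k (m + 2) + (\<Sum>i\<le>m. heat_coeff u k i ** u (m - i)))"

lemma heat_coeff_recursion:
  "real (Suc k + m) *\<^sub>R heat_coeff u (Suc k) m =
     real ((m + 2) * (m + 1)) *\<^sub>R heat_coeff u k (m + 2) + (\<Sum>i\<le>m. heat_coeff u k i ** u (m - i))"
  by (simp del: of_nat_mult of_nat_add of_nat_Suc)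

declare heat_coeff.simps [simp del]

text \<open>
  The operator \<open>d\<^sup>2/dx\<^sup>2 + U\<close> acting on sequences of Taylor coefficients.
\<close>

definition taylor_schroedinger ::
    "(nat \<Rightarrow> complex^'r^'r) \<Rightarrow> (nat \<Rightarrow> complex^'r^'r) \<Rightarrow> nat \<Rightarrow> complex^'r^'r" where
  "taylor_schroedinger u f m =
     real ((m + 2) * (m + 1)) *\<^sub>R f (m + 2) + (\<Sum>i\<le>m. u i ** f (m - i))"

text \<open>
  The number \<open>\<integral> G(\<tau>, x) x\<^sup>2\<^sup>q dx = \<tau>\<^sup>q (2q)! / q!\<close> at \<open>\<tau> = 1\<close>.
\<close>

definition gauss_moment :: "nat \<Rightarrow> real" where
  "gauss_moment q = fact (2 * q) / fact q"

text \<open>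
  The coefficient of \<open>\<tau>\<^sup>N\<close> in \<open>\<integral> G(\<tau>, x) \<Sum>k. \<tau>\<^sup>k a\<^sub>k(x) f(x) dx\<close>, integrated termwise.
\<close>

definition heat_pairing :: "(nat \<Rightarrow> complex^'r^'r) \<Rightarrow> nat \<Rightarrow> (nat \<Rightarrow> complex^'r^'r) \<Rightarrow> complex^'r^'r" where
  "heat_pairing u N f = (\<Sum>k\<le>N. gauss_moment (N - k) *\<^sub>R
     (\<Sum>i\<le>2 * (N - k). heat_coeff u k i ** f (2 * (N - k) - i)))"

lemma gauss_moment_Suc: "gauss_moment (Suc q) = 2 * (2 * real q + 1) * gauss_moment q"
proof -
  have "fact (2 * Suc q) = (2 * real q + 2) * ((2 * real q + 1) * fact (2 * q))"
    by (simp add: mult.assoc add.commute)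
  moreover have "fact (Suc q) = (real q + 1) * fact q" by simp
  ultimately show ?thesis
    by (simp add: gauss_moment_def divide_simps del: fact_Suc) (simp add: algebra_simps)
qed

lemma sum_atMost_add2_eq:
  fixes g :: "nat \<Rightarrow> 'a::comm_monoid_add"
  assumes "g 0 = 0" "g 1 = 0"
  shows "(\<Sum>i\<le>s. g (i + 2)) = (\<Sum>i\<le>s + 2. g i)"
proof -
  have "(\<Sum>i\<le>Suc (Suc s). g i) = g 0 + (g (Suc 0) + (\<Sum>i\<le>s. g (Suc (Suc i))))"
    by (simp only: sum.atMost_Suc_shift)
  then show ?thesis using assms by (simp del: sum.atMost_Suc)
qed

text \<open>
  Second derivatives of a factor in a Cauchy product: the sum is reindexed to total degree \<open>s + 2\<close>, where
  the two new terms carry the factor \<open>l(l - 1) = 0\<close>.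
\<close>

lemma convolution_second_derivative_right:
  fixes a f :: "nat \<Rightarrow> complex^'r^'r"
  shows "(\<Sum>i\<le>s. a i ** (real ((s - i + 2) * (s - i + 1)) *\<^sub>R f (s - i + 2))) =
    (\<Sum>i\<le>s + 2. (real (s + 2 - i) * (real (s + 2 - i) - 1)) *\<^sub>R (a i ** f (s + 2 - i)))"
proof -
  have "(\<Sum>i\<le>s + 2. (real (s + 2 - i) * (real (s + 2 - i) - 1)) *\<^sub>R (a i ** f (s + 2 - i))) =
    (\<Sum>i\<le>s. (real (s + 2 - i) * (real (s + 2 - i) - 1)) *\<^sub>R (a i ** f (s + 2 - i)))"
    by simp
  also have "\<dots> = (\<Sum>i\<le>s. a i ** (real ((s - i + 2) * (s - i + 1)) *\<^sub>R f (s - i + 2)))"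
  proof (rule sum.cong[OF refl])
    fix i assume "i \<in> {..s}"
    then have e: "s + 2 - i = s - i + 2" by auto
    have c: "real (l + 2) * (real (l + 2) - 1) = real ((l + 2) * (l + 1))" for l
      by (simp add: algebra_simps)
    show "(real (s + 2 - i) * (real (s + 2 - i) - 1)) *\<^sub>R (a i ** f (s + 2 - i)) =
       a i ** (real ((s - i + 2) * (s - i + 1)) *\<^sub>R f (s - i + 2))"
      unfolding e matmul.scaleR_right c ..
  qed
  finally show ?thesis by simp
qed

lemma convolution_second_derivative_left:
  fixes a f :: "nat \<Rightarrow> complex^'r^'r"
  shows "(\<Sum>i\<le>s. (real ((i + 2) * (i + 1)) *\<^sub>R a (i + 2)) ** f (s - i)) =
    (\<Sum>i\<le>s + 2. (real i * (real i - 1)) *\<^sub>R (a i ** f (s + 2 - i)))"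
  by (subst sum_atMost_add2_eq[symmetric])
     (auto simp: matmul.scaleR_left ring_distribs intro!: sum.cong arg_cong[where f = "\<lambda>c. c *\<^sub>R _"])

lemma convolution_assoc:
  fixes a u f :: "nat \<Rightarrow> complex^'r^'r"
  shows "(\<Sum>i\<le>s. a i ** (\<Sum>p\<le>s - i. u p ** f (s - i - p))) =
    (\<Sum>m\<le>s. (\<Sum>i\<le>m. a i ** u (m - i)) ** f (s - m))"
  using fps_mult_assoc_lemma[of "\<lambda>i p q. a i ** u p ** f q" s s]
  by (simp add: matmul.sum_left matmul.sum_right matrix_mul_assoc atLeast0AtMost)

text \<open>
  This is \<open>d/d\<tau> \<integral> K f = \<integral> K (L f)\<close> for the formal kernel \<open>K = G \<Sum>k. \<tau>\<^sup>k a\<^sub>k\<close>, the algebraic form of an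
  integration by parts. The recursion for the coefficients removes the potential; what remains, for the
  terms \<open>a\<^sub>k\<close> at \<open>x\<^sup>i\<close> and \<open>f\<close> at \<open>x\<^sup>l\<close> with \<open>i + l = 2q\<close>, is the identity
  \<open>l(l - 1) - i(i - 1) = (l - i)(2q - 1)\<close> together with the recursion of the Gaussian moments.
\<close>

lemma heat_pairing_schroedinger:
  "heat_pairing u N (taylor_schroedinger u f) = real (Suc N) *\<^sub>R heat_pairing u (Suc N) f"
proof -
  let ?a = "heat_coeff u"
  define S where "S k = 2 * (Suc N - k)" for k
  define A where "A k = (\<Sum>i\<le>S k. (real (S k - i) * (real (S k - i) - 1) - real i * (real i - 1))
      *\<^sub>R (?a k i ** f (S k - i)))" for k
  define B where "B k = (\<Sum>i\<le>S k. real (k + i) *\<^sub>R (?a k i ** f (S k - i)))" for k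
  define C where "C k = (\<Sum>i\<le>S k. ?a k i ** f (S k - i))" for k
  \<comment> \<open>\<open>A k\<close> collects the second derivatives and \<open>B k\<close> the transport terms of \<open>a\<^sub>k\<close>.\<close>
  have term1: "(\<Sum>i\<le>2 * (N - k). ?a k i ** taylor_schroedinger u f (2 * (N - k) - i)) = A k + B (Suc k)"
    if "k \<le> N" for k
  proof -
    define s where "s = 2 * (N - k)"
    have S: "S k = s + 2" "S (Suc k) = s" using that by (auto simp: S_def s_def)
    have "(\<Sum>i\<le>s. ?a k i ** taylor_schroedinger u f (s - i)) =
       (\<Sum>i\<le>s. ?a k i ** (real ((s - i + 2) * (s - i + 1)) *\<^sub>R f (s - i + 2)))
      + (\<Sum>i\<le>s. ?a k i ** (\<Sum>p\<le>s - i. u p ** f (s - i - p)))"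
      by (simp add: taylor_schroedinger_def matmul.add_right sum.distrib)
    also have "(\<Sum>i\<le>s. ?a k i ** (\<Sum>p\<le>s - i. u p ** f (s - i - p))) =
       (\<Sum>m\<le>s. (real (Suc k + m) *\<^sub>R ?a (Suc k) m - real ((m + 2) * (m + 1)) *\<^sub>R ?a k (m + 2)) ** f (s - m))"
      unfolding convolution_assoc heat_coeff_recursion by simp
    also have "\<dots> = B (Suc k) - (\<Sum>i\<le>s. (real ((i + 2) * (i + 1)) *\<^sub>R ?a k (i + 2)) ** f (s - i))"
      by (simp add: B_def S matmul.diff_left sum_subtractf matmul.scaleR_left)
    finally show ?thesis
      unfolding convolution_second_derivative_left convolution_second_derivative_right s_def[symmetric]
      by (simp add: A_def S scaleR_left_diff_distrib sum_subtractf)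
  qed
  \<comment> \<open>The series \<open>a\<^sub>0\<close> is constant, so there is no transport term for \<open>k = 0\<close>.\<close>
  have B0: "B 0 = 0"
    unfolding B_def by (rule sum.neutral) (auto simp: heat_coeff.simps)
  have comb: "gauss_moment (N - k) *\<^sub>R A k + gauss_moment (Suc N - k) *\<^sub>R B k
      = real (Suc N) *\<^sub>R (gauss_moment (Suc N - k) *\<^sub>R C k)" if k: "k \<le> N" for k
  proof -
    define q where "q = N - k"
    have q: "Suc N - k = Suc q" "N = k + q" "S k = 2 * q + 2" using k by (auto simp: q_def S_def)
    have coeff: "gauss_moment q * (real (S k - i) * (real (S k - i) - 1) - real i * (real i - 1))
        + gauss_moment (Suc q) * real (k + i) = real (Suc N) * gauss_moment (Suc q)" if "i \<le> S k" for i
    proof -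
      have r: "real (S k - i) = 2 * real q + 2 - real i" using that by (simp add: q of_nat_diff)
      show ?thesis unfolding r gauss_moment_Suc by (simp add: q algebra_simps)
    qed
    show ?thesis
      unfolding A_def B_def C_def q(1) q_def[symmetric]
      unfolding scaleR_sum_right sum.distrib[symmetric] scaleR_scaleR scaleR_left_distrib[symmetric]
      by (intro sum.cong refl arg_cong[where f = "\<lambda>c. c *\<^sub>R _"] coeff) simp
  qed
  have "heat_pairing u N (taylor_schroedinger u f) =
      (\<Sum>k\<le>N. gauss_moment (N - k) *\<^sub>R A k) + (\<Sum>k\<le>N. gauss_moment (Suc N - Suc k) *\<^sub>R B (Suc k))"
    by (simp add: heat_pairing_def term1 scaleR_right_distrib sum.distrib)
  also have "(\<Sum>k\<le>N. gauss_moment (Suc N - Suc k) *\<^sub>R B (Suc k)) = (\<Sum>k\<le>Suc N. gauss_moment (Suc N - k) *\<^sub>R B k)"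
    unfolding sum.atMost_Suc_shift by (simp add: B0)
  also have "(\<Sum>k\<le>N. gauss_moment (N - k) *\<^sub>R A k) + \<dots> =
     (\<Sum>k\<le>N. gauss_moment (N - k) *\<^sub>R A k + gauss_moment (Suc N - k) *\<^sub>R B k) + gauss_moment 0 *\<^sub>R B (Suc N)"
    by (simp add: sum.distrib)
  also have "B (Suc N) = real (Suc N) *\<^sub>R C (Suc N)"
    by (simp add: B_def C_def S_def)
  also have "(\<Sum>k\<le>N. gauss_moment (N - k) *\<^sub>R A k + gauss_moment (Suc N - k) *\<^sub>R B k) =
     (\<Sum>k\<le>N. real (Suc N) *\<^sub>R (gauss_moment (Suc N - k) *\<^sub>R C k))"
    by (rule sum.cong[OF refl]) (simp only: comb atMost_iff)
  also have "\<dots> + gauss_moment 0 *\<^sub>R (real (Suc N) *\<^sub>R C (Suc N)) = real (Suc N) *\<^sub>R heat_pairing u (Suc N) f"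
    by (simp add: heat_pairing_def C_def S_def scaleR_sum_right scaleR_right_distrib)
  finally show ?thesis .
qed

text \<open>
  Iterating the previous identity down to \<open>N = 0\<close>, where the pairing is evaluation at \<open>0\<close>. It says that
  the formal kernel represents \<open>f \<mapsto> (exp (\<tau>L) f)(0)\<close>.
\<close>

lemma schroedinger_power_eq_heat_pairing:
  "(taylor_schroedinger u ^^ N) f 0 = fact N *\<^sub>R heat_pairing u N f"
proof -
  have "heat_pairing u M ((taylor_schroedinger u ^^ N) f) = (fact (M + N) / fact M) *\<^sub>R heat_pairing u (M + N) f" for M
  proof (induction N arbitrary: M)
    case (Suc N)
    then show ?case
      by (simp add: heat_pairing_schroedinger del: of_nat_Suc)
  qed simp
  from this[of 0] show ?thesis
    by (simp add: heat_pairing_def gauss_moment_def heat_coeff.simps)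
qed

lemma schroedinger_power_on_even_monomial:
  "(taylor_schroedinger u ^^ (j + n)) (\<lambda>i. if i = 2 * j then mat 1 else 0) 0 =
     fact (j + n) *\<^sub>R (\<Sum>i\<le>n. gauss_moment (i + j) *\<^sub>R heat_coeff u (n - i) (2 * i))"
proof -
  let ?d = "\<lambda>i::nat. if i = 2 * j then mat 1 else 0 :: complex^'n^'n"
  have inner: "(\<Sum>i\<le>2 * q. heat_coeff u k i ** ?d (2 * q - i)) =
     (if j \<le> q then heat_coeff u k (2 * (q - j)) else 0)" for q k
  proof -
    have "(\<Sum>i\<le>2 * q. heat_coeff u k i ** ?d (2 * q - i)) =
       (\<Sum>i\<le>2 * q. if i = 2 * (q - j) \<and> j \<le> q then heat_coeff u k i else 0)"
      by (rule sum.cong) auto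
    also have "\<dots> = (if j \<le> q then heat_coeff u k (2 * (q - j)) else 0)"
      by (cases "j \<le> q") simp_all
    finally show ?thesis .
  qed
  have "heat_pairing u (j + n) ?d =
     (\<Sum>k\<le>j + n. if k \<le> n then gauss_moment (j + n - k) *\<^sub>R heat_coeff u k (2 * (n - k)) else 0)"
    unfolding heat_pairing_def inner
    by (rule sum.cong) auto
  also have "\<dots> = (\<Sum>k\<le>n. gauss_moment (j + n - k) *\<^sub>R heat_coeff u k (2 * (n - k)))"
    by (rule sum.mono_neutral_cong_right) auto
  also have "\<dots> = (\<Sum>i\<le>n. gauss_moment (i + j) *\<^sub>R heat_coeff u (n - i) (2 * i))"
    by (subst sum.nat_diff_reindex[symmetric, of _ "Suc n", unfolded lessThan_Suc_atMost])
       (auto intro!: sum.cong simp: add.commute)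
  finally show ?thesis by (simp add: schroedinger_power_eq_heat_pairing)
qed

section \<open>Inverting the moment relations\<close>

text \<open>
  An alternating binomial sum is an iterated difference; one more difference is taken from Pascal's rule.
\<close>

lemma alternating_binomial_sum_Suc:
  fixes g :: "nat \<Rightarrow> real"
  shows "(\<Sum>j\<le>Suc n. (-1) ^ j * real (Suc n choose j) * g j) =
    (\<Sum>j\<le>n. (-1) ^ j * real (n choose j) * g j) - (\<Sum>j\<le>n. (-1) ^ j * real (n choose j) * g (Suc j))"
proof -
  have "(\<Sum>j\<le>Suc n. (-1) ^ j * real (Suc n choose j) * g j) =
     g 0 + (\<Sum>j\<le>n. (-1) ^ Suc j * real (Suc n choose Suc j) * g (Suc j))"
    unfolding sum.atMost_Suc_shift by simp
  also have "(\<Sum>j\<le>n. (-1) ^ Suc j * real (Suc n choose Suc j) * g (Suc j)) =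
     (\<Sum>j\<le>n. (-1) ^ Suc j * real (n choose Suc j) * g (Suc j)) - (\<Sum>j\<le>n. (-1) ^ j * real (n choose j) * g (Suc j))"
    unfolding sum_subtractf[symmetric] by (intro sum.cong refl) (simp add: algebra_simps)
  also have "g 0 + ((\<Sum>j\<le>n. (-1) ^ Suc j * real (n choose Suc j) * g (Suc j)) - (\<Sum>j\<le>n. (-1) ^ j * real (n choose j) * g (Suc j)))
    = (\<Sum>j\<le>Suc n. (-1) ^ j * real (n choose j) * g j) - (\<Sum>j\<le>n. (-1) ^ j * real (n choose j) * g (Suc j))"
    unfolding sum.atMost_Suc_shift by simp
  finally show ?thesis by simp
qed

text \<open>
  The \<open>n\<close>-th difference of a polynomial of degree \<open>m < n\<close> vanishes; in the rising factorial basis a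
  difference lowers the degree by one.
\<close>

lemma alternating_binomial_sum_pochhammer:
  "m < n \<Longrightarrow> (\<Sum>j\<le>n. (-1) ^ j * real (n choose j) * pochhammer (x + real j) m) = 0"
proof (induction n arbitrary: m x)
  case (Suc n)
  have "(\<Sum>j\<le>Suc n. (-1) ^ j * real (Suc n choose j) * pochhammer (x + real j) m) =
     (\<Sum>j\<le>n. (-1) ^ j * real (n choose j) * (pochhammer (x + real j) m - pochhammer (x + 1 + real j) m))"
    unfolding alternating_binomial_sum_Suc by (simp add: sum_subtractf[symmetric] algebra_simps)
  also have "\<dots> = 0"
  proof (cases m)
    case 0
    then show ?thesis by simp
  next
    case (Suc l)
    have "pochhammer z (Suc l) - pochhammer (z + 1) (Suc l) = - real (Suc l) * pochhammer (z + 1) l" for z :: real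
      unfolding pochhammer_rec[of z l] pochhammer_rec'[of "z + 1" l] by (simp add: algebra_simps)
    from this[of "x + real _"] have d: "pochhammer (x + real j) m - pochhammer (x + 1 + real j) m = - real m * pochhammer (x + 1 + real j) l" for j
      by (simp add: Suc add_ac)
    have "(\<Sum>j\<le>n. (-1) ^ j * real (n choose j) * (pochhammer (x + real j) m - pochhammer (x + 1 + real j) m))
       = - real m * (\<Sum>j\<le>n. (-1) ^ j * real (n choose j) * pochhammer (x + 1 + real j) l)"
      unfolding d sum_distrib_left by (intro sum.cong) auto
    then show ?thesis using Suc.IH[of l "x + 1"] Suc.prems Suc by simp
  qed
  finally show ?case .
qed simp

lemma alternating_binomial_sum_reciprocal:
  "x > 0 \<Longrightarrow> (\<Sum>j\<le>n. (-1) ^ j * real (n choose j) * (1 / (x + real j))) = fact n / pochhammer x (Suc n)"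
proof (induction n arbitrary: x)
  case (Suc n)
  have "(\<Sum>j\<le>Suc n. (-1) ^ j * real (Suc n choose j) * (1 / (x + real j))) =
     fact n / pochhammer x (Suc n) - fact n / pochhammer (x + 1) (Suc n)"
    unfolding alternating_binomial_sum_Suc using Suc.IH[of x] Suc.IH[of "x + 1"] Suc.prems
    by (simp add: add_ac)
  also have "\<dots> = fact (Suc n) / pochhammer x (Suc (Suc n))"
  proof -
    have p: "pochhammer (x + 1) n > 0" using Suc.prems by (intro pochhammer_pos) simp
    have e1: "pochhammer x (Suc n) = x * pochhammer (x + 1) n" by (rule pochhammer_rec)
    have e2: "pochhammer (x + 1) (Suc n) = (x + 1 + real n) * pochhammer (x + 1) n" by (rule pochhammer_rec')
    have e3: "pochhammer x (Suc (Suc n)) = x * ((x + 1 + real n) * pochhammer (x + 1) n)"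
      unfolding pochhammer_rec[of x "Suc n"] e2 ..
    have nz: "x \<noteq> 0" "x + 1 + real n \<noteq> 0" "pochhammer (x + 1) n \<noteq> 0" using Suc.prems p by auto
    show ?thesis unfolding e1 e2 e3 using nz
      by (simp add: divide_simps) (simp add: algebra_simps)
  qed
  finally show ?case .
qed simp

lemma gauss_moment_eq_pochhammer: "gauss_moment q = 4 ^ q * pochhammer (1/2) q"
proof (induction q)
  case (Suc q)
  then show ?case by (simp add: gauss_moment_Suc pochhammer_rec' algebra_simps)
qed (simp add: gauss_moment_def)

lemma half_binomial_eq_pochhammer:
  assumes "j \<le> n"
  shows "half_binomial n j = pochhammer (1/2) (Suc n) / (fact (n - j) * pochhammer (1/2) (Suc j))"
proof -
  have "pochhammer (1/2::real) (Suc j + (n - j)) = pochhammer (1/2) (Suc j) * pochhammer (1/2 + real (Suc j)) (n - j)"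
    by (rule pochhammer_product')
  moreover have "pochhammer (1/2 + real (Suc j)) (n - j) = Gamma (real n + 3/2) / Gamma (real j + 3/2)"
  proof -
    have "1/2 + real (Suc j) \<notin> \<int>\<^sub>\<le>\<^sub>0" by (auto elim!: nonpos_Ints_cases)
    from pochhammer_Gamma[OF this, of "n - j"] assms show ?thesis
      by (simp add: add_ac of_nat_diff)
  qed
  moreover have "pochhammer (1/2::real) (Suc j) > 0" by (intro pochhammer_pos) simp
  moreover have "Gamma (real j + 3/2) > 0" by (intro Gamma_real_pos) simp
  ultimately show ?thesis
    using assms by (simp add: half_binomial_def)
qed

text \<open>
  With \<open>(2q)! / q! = 4\<^sup>q (1/2)\<^sub>q\<close>, where \<open>(z)\<^sub>q\<close> is the rising factorial, the summand becomes an
  alternating binomial coefficient times \<open>(1/2)\<^sub>i\<^sub>+\<^sub>j / (1/2)\<^sub>j\<^sub>+\<^sub>1\<close>. For \<open>i > 0\<close> the quotient is a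
  polynomial in \<open>j\<close> of degree \<open>i - 1 < n\<close>, so its \<open>n\<close>-th difference vanishes; for \<open>i = 0\<close> it is
  \<open>1 / (j + 1/2)\<close>, whose difference is known in closed form.
\<close>

lemma half_binomial_moment_orthogonality:
  assumes "i \<le> n"
  shows "(\<Sum>j\<le>n. half_binomial n j * ((-1) ^ j / (4 ^ j * fact j)) * gauss_moment (i + j)) = (if i = 0 then 1 else 0)"
proof -
  define P where "P = pochhammer (1/2::real)"
  have Ppos: "P m > 0" for m unfolding P_def by (intro pochhammer_pos) simp
  have term1: "half_binomial n j * ((-1) ^ j / (4 ^ j * fact j)) * gauss_moment (i + j) =
     4 ^ i * P (Suc n) / fact n * ((-1) ^ j * real (n choose j) * (P (i + j) / P (Suc j)))" if "j \<le> n" for j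
    using that Ppos[of "Suc j"] unfolding half_binomial_eq_pochhammer[OF that] gauss_moment_eq_pochhammer P_def[symmetric]
    by (simp add: binomial_fact power_add field_simps)
  have "(\<Sum>j\<le>n. half_binomial n j * ((-1) ^ j / (4 ^ j * fact j)) * gauss_moment (i + j)) =
     4 ^ i * P (Suc n) / fact n * (\<Sum>j\<le>n. (-1) ^ j * real (n choose j) * (P (i + j) / P (Suc j)))"
    unfolding sum_distrib_left by (rule sum.cong) (auto simp only: term1 atMost_iff)
  also have "\<dots> = (if i = 0 then 1 else 0)"
  proof (cases i)
    case 0
    have "P (i + j) / P (Suc j) = 1 / (1/2 + real j)" for j
      using Ppos[of j] by (simp add: 0 P_def pochhammer_rec')
    then show ?thesis
      using alternating_binomial_sum_reciprocal[of "1/2" n] Ppos[of "Suc n"] 0 by (simp add: P_def)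
  next
    case (Suc l)
    have "P (i + j) / P (Suc j) = pochhammer (3/2 + real j) l" for j
      using Ppos[of "Suc j"] pochhammer_product'[of "1/2::real" "Suc j" l]
      by (simp add: Suc P_def add_ac)
    then show ?thesis
      using alternating_binomial_sum_pochhammer[of l n "3/2"] assms Suc by simp
  qed
  finally show ?thesis .
qed

lemma heat_coeff_diagonal_eq_schroedinger_powers:
  "heat_coeff u n 0 = (\<Sum>j\<le>n. (half_binomial n j * ((-1) ^ j / (4 ^ j * fact j * fact (j + n)))) *\<^sub>R
     (taylor_schroedinger u ^^ (j + n)) (\<lambda>i. if i = 2 * j then mat 1 else 0) 0)"
proof -
  define c where "c j = half_binomial n j * ((-1) ^ j / (4 ^ j * fact j))" for j
  have "(\<Sum>j\<le>n. (half_binomial n j * ((-1) ^ j / (4 ^ j * fact j * fact (j + n)))) *\<^sub>R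
     (taylor_schroedinger u ^^ (j + n)) (\<lambda>i. if i = 2 * j then mat 1 else 0) 0) =
     (\<Sum>j\<le>n. \<Sum>i\<le>n. (c j * gauss_moment (i + j)) *\<^sub>R heat_coeff u (n - i) (2 * i))"
    unfolding schroedinger_power_on_even_monomial
    by (simp add: c_def scaleR_sum_right mult_ac)
  also have "\<dots> = (\<Sum>i\<le>n. (\<Sum>j\<le>n. c j * gauss_moment (i + j)) *\<^sub>R heat_coeff u (n - i) (2 * i))"
    by (subst sum.swap) (simp add: scaleR_sum_left)
  also have "\<dots> = (\<Sum>i\<le>n. if i = 0 then heat_coeff u n 0 else 0)"
    by (rule sum.cong) (auto simp: c_def half_binomial_moment_orthogonality simp del: times_divide_eq_right)
  finally show ?thesis by simp
qed

section \<open>Powers of the Schroedinger operator as sums over words\<close>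

text \<open>
  Write \<open>D = d/dx\<close>. The number \<open>word_count d M ks\<close> counts how often \<open>U\<^bsub>k1\<^esub> U\<^bsub>k2\<^esub> \<dots>\<close> arises by the Leibniz rule
  from \<open>D\<^sup>d\<close> applied to words with one \<open>U\<close> for each entry of \<open>ks\<close> and \<open>M\<close> letters \<open>D\<^sup>2\<close>. The recursion
  inspects the leftmost letter: \<open>D\<^sup>2\<close> joins the waiting derivatives, while \<open>U\<close> absorbs \<open>k\<close> of them.
\<close>

fun word_count :: "nat \<Rightarrow> nat \<Rightarrow> nat list \<Rightarrow> nat" where
  "word_count d M [] = 1"
| "word_count d 0 (k # ks) = (d choose k) * word_count (d - k) 0 ks"
| "word_count d (Suc M) (k # ks) =
     word_count (d + 2) M (k # ks) + (d choose k) * word_count (d - k) (Suc M) ks"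

text \<open>
  The summation range of the \<open>C\<close>-coefficients when \<open>d\<close> further derivatives stand in front of the word;
  \<open>d = 0\<close> gives \<open>l_indices\<close>. The parameter is needed for the recursion over the leftmost letter.
\<close>

definition shifted_l_indices :: "nat \<Rightarrow> nat \<Rightarrow> nat list \<Rightarrow> nat list set" where
  "shifted_l_indices d m ks = {ls. length ls = length ks \<and> sorted ls \<and> set ls \<subseteq> {..m} \<and>
     (\<forall>i<length ks. sum_list (take (Suc i) ks) \<le> d + 2 * ls ! i)}"

lemma finite_shifted_l_indices: "finite (shifted_l_indices d m ks)"
  by (rule finite_subset[OF _ finite_lists_length_eq[of "{..m}" "length ks"]])
     (auto simp: shifted_l_indices_def)

definition binomial_chain :: "nat \<Rightarrow> nat list \<Rightarrow> nat list \<Rightarrow> nat" where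
  "binomial_chain d ks ls = (\<Prod>i<length ks. (d + 2 * ls ! i - sum_list (take i ks)) choose (ks ! i))"

lemma binomial_chain_Cons:
  assumes "k \<le> d + 2 * l"
  shows "binomial_chain d (k # ks) (l # ls) = (d + 2 * l choose k) *
    (\<Prod>i<length ks. (d + 2 * ls ! i - (k + sum_list (take i ks))) choose (ks ! i))"
  unfolding binomial_chain_def length_Cons prod.lessThan_Suc_shift by simp

lemma binomial_chain_Cons0:
  assumes "k \<le> d"
  shows "binomial_chain d (k # ks) (0 # ls) = (d choose k) * binomial_chain (d - k) ks ls"
  using assms by (subst binomial_chain_Cons) (auto simp: binomial_chain_def intro!: prod.cong)

lemma binomial_chain_Suc:
  assumes "length ls = length ks"
  shows "binomial_chain d ks (map Suc ls) = binomial_chain (d + 2) ks ls"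
  using assms unfolding binomial_chain_def by (intro prod.cong) auto

text \<open>
  If \<open>l\<^sub>0 = 0\<close>, the word begins with \<open>U\<close>, which takes \<open>k\<close> of the \<open>d\<close> waiting derivatives.
\<close>

lemma shifted_l_indices_head0:
  "{ls \<in> shifted_l_indices d m (k # ks). hd ls = 0} =
     (if k \<le> d then (#) 0 ` shifted_l_indices (d - k) m ks else {})"
proof (rule set_eqI)
  fix ls
  show "ls \<in> {ls \<in> shifted_l_indices d m (k # ks). hd ls = 0} \<longleftrightarrow>
     ls \<in> (if k \<le> d then (#) 0 ` shifted_l_indices (d - k) m ks else {})"
    by (cases ls) (auto simp: shifted_l_indices_def All_less_Suc2 image_iff le_diff_conv2 algebra_simps)
qed

text \<open>
  If \<open>l\<^sub>0 > 0\<close>, the word begins with \<open>D\<^sup>2\<close>; removing this letter lowers every \<open>l\<^sub>i\<close> by one.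
\<close>

lemma shifted_l_indices_head_pos:
  "{ls \<in> shifted_l_indices d (Suc m) (k # ks). hd ls \<noteq> 0} =
     map Suc ` shifted_l_indices (d + 2) m (k # ks)"
proof (intro equalityI subsetI)
  fix ls assume ls: "ls \<in> {ls \<in> shifted_l_indices d (Suc m) (k # ks). hd ls \<noteq> 0}"
  then have "\<forall>l\<in>set ls. l > 0"
    by (cases ls) (auto simp: shifted_l_indices_def)
  then have "ls = map Suc (map (\<lambda>l. l - 1) ls)"
    by (auto intro!: nth_equalityI)
  then obtain ls' where e: "ls = map Suc ls'" ..
  have "ls' \<in> shifted_l_indices (d + 2) m (k # ks)"
    using ls unfolding e by (auto simp: shifted_l_indices_def sorted_iff_nth_mono)
  with e show "ls \<in> map Suc ` shifted_l_indices (d + 2) m (k # ks)" by blast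
next
  fix ls assume "ls \<in> map Suc ` shifted_l_indices (d + 2) m (k # ks)"
  then obtain ls' where ls': "ls' \<in> shifted_l_indices (d + 2) m (k # ks)" and e: "ls = map Suc ls'" by blast
  then have "ls' \<noteq> []" by (auto simp: shifted_l_indices_def)
  with ls' show "ls \<in> {ls \<in> shifted_l_indices d (Suc m) (k # ks). hd ls \<noteq> 0}"
    unfolding e by (auto simp: shifted_l_indices_def hd_map sorted_iff_nth_mono)
qed

lemma word_count_eq_sum:
  "word_count d M ks = (\<Sum>ls\<in>shifted_l_indices d M ks. binomial_chain d ks ls)"
proof (induction d M ks rule: word_count.induct)
  case (1 d M)
  have "shifted_l_indices d M [] = {[]}" by (auto simp: shifted_l_indices_def)
  then show ?case by (simp add: binomial_chain_def)
next
  case (2 d k ks)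
  have "{ls \<in> shifted_l_indices d 0 (k # ks). hd ls = 0} = shifted_l_indices d 0 (k # ks)"
    by (auto simp: shifted_l_indices_def neq_Nil_conv length_Suc_conv)
  from shifted_l_indices_head0[of d 0 k ks, unfolded this] 2 show ?case
    by (auto simp: sum.reindex binomial_chain_Cons0 sum_distrib_left[symmetric])
next
  case (3 d M k ks)
  let ?S = "shifted_l_indices d (Suc M) (k # ks)"
  have "(\<Sum>ls\<in>?S. binomial_chain d (k # ks) ls) =
      (\<Sum>ls\<in>{ls \<in> ?S. hd ls \<noteq> 0}. binomial_chain d (k # ks) ls) +
      (\<Sum>ls\<in>{ls \<in> ?S. hd ls = 0}. binomial_chain d (k # ks) ls)"
    by (subst sum.union_disjoint[symmetric]) (auto simp: finite_shifted_l_indices intro!: sum.cong)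
  also have "(\<Sum>ls\<in>{ls \<in> ?S. hd ls = 0}. binomial_chain d (k # ks) ls) =
      (d choose k) * word_count (d - k) (Suc M) ks"
    unfolding shifted_l_indices_head0 using 3
    by (auto simp: sum.reindex binomial_chain_Cons0 sum_distrib_left[symmetric])
  also have "(\<Sum>ls\<in>{ls \<in> ?S. hd ls \<noteq> 0}. binomial_chain d (k # ks) ls) = word_count (d + 2) M (k # ks)"
    unfolding shifted_l_indices_head_pos using 3
    by (auto simp: sum.reindex binomial_chain_Suc shifted_l_indices_def inj_on_def intro!: sum.cong)
  finally show ?case by simp
qed

lemma C_coeff_eq_word_count: "C_coeff n j ks = word_count 0 (j + n - length ks) ks"
  unfolding word_count_eq_sum C_coeff_def
  by (simp add: l_indices_def shifted_l_indices_def binomial_chain_def)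

text \<open>
  The expansion of \<open>D\<^sup>d L\<^sup>m\<close> applied to \<open>x\<^sup>e\<close>, evaluated at \<open>0\<close>, by the number \<open>p\<close> of factors \<open>U\<close>. Only
  those terms survive in which exactly \<open>e\<close> derivatives are left for the monomial, which is the condition on
  \<open>sum_list ks\<close>. The induction splits off the outermost \<open>L\<close>, matching the recursion of \<open>word_count\<close>.
\<close>

lemma schroedinger_power_word_expansion:
  fixes W :: "nat \<Rightarrow> complex^'r^'r"
  defines "u \<equiv> \<lambda>i. (1 / fact i) *\<^sub>R W i"
  shows "fact d *\<^sub>R (taylor_schroedinger u ^^ m) (\<lambda>i. if i = e then mat 1 else 0) d =
    fact e *\<^sub>R (\<Sum>p\<le>m. \<Sum>ks | length ks = p \<and> sum_list ks + e + 2 * p = d + 2 * m.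
      real (word_count d (m - p) ks) *\<^sub>R foldr (\<lambda>k A. W k ** A) ks (mat 1))"
proof -
  define T where "T m = (taylor_schroedinger u ^^ m) (\<lambda>i. if i = e then mat 1 else 0)" for m
  define S where "S d m p = {ks :: nat list. length ks = p \<and> sum_list ks + e + 2 * p = d + 2 * m}" for d m p
  define word where "word ks = foldr (\<lambda>k A. W k ** A) ks (mat 1)" for ks
  define Z where "Z d m p = (\<Sum>ks\<in>S d m p. real (word_count d (m - p) ks) *\<^sub>R word ks)" for d m p
  have fin: "finite (S d m p)" for d m p
    by (rule finite_subset[OF _ finite_lists_length_eq[of "{..d + 2 * m}" p]])
       (auto simp: S_def dest: member_le_sum_list)
  have T_Suc: "fact d *\<^sub>R T (Suc m) d =
      fact (d + 2) *\<^sub>R T m (d + 2) + (\<Sum>k\<le>d. real (d choose k) *\<^sub>R (W k ** (fact (d - k) *\<^sub>R T m (d - k))))" for m d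
  proof -
    have f: "fact (d + 2) = fact d * real ((d + 2) * (d + 1))" by (simp add: algebra_simps)
    have leibniz: "fact d *\<^sub>R (u k ** X) = real (d choose k) *\<^sub>R (W k ** (fact (d - k) *\<^sub>R X))" if "k \<le> d"
      for k and X :: "complex^'r^'r"
      using that by (simp add: u_def matmul.scaleR_left matmul.scaleR_right binomial_fact)
    have "T (Suc m) d = real ((d + 2) * (d + 1)) *\<^sub>R T m (d + 2) + (\<Sum>k\<le>d. u k ** T m (d - k))"
      by (simp add: T_def taylor_schroedinger_def)
    then show ?thesis
      unfolding f by (simp add: scaleR_right_distrib scaleR_sum_right leibniz del: of_nat_mult)
  qed
  have Z0: "Z d (Suc m) 0 = Z (d + 2) m 0" for d m
    by (auto simp: Z_def S_def intro!: sum.cong)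
  have Z_Suc: "Z d (Suc m) (Suc p) = (if p < m then Z (d + 2) m (Suc p) else 0) +
      (\<Sum>k\<le>d. real (d choose k) *\<^sub>R (W k ** Z (d - k) m p))" if "p \<le> m" for d m p
  proof -
    let ?S = "S d (Suc m) (Suc p)"
    define g where "g ks = real (d choose hd ks) *\<^sub>R (W (hd ks) **
       (real (word_count (d - hd ks) (m - p) (tl ks)) *\<^sub>R word (tl ks)))" for ks
    have S_eq: "?S = S (d + 2) m (Suc p)" by (auto simp: S_def)
    have split: "real (word_count d (Suc m - Suc p) ks) *\<^sub>R word ks =
       (if p < m then real (word_count (d + 2) (m - Suc p) ks) *\<^sub>R word ks else 0) + g ks" if mem: "ks \<in> ?S" for ks
    proof -
      obtain k ks' where ks: "ks = k # ks'" using mem by (cases ks) (auto simp: S_def)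
      show ?thesis
      proof (cases "p < m")
        case True
        then obtain q where "m - p = Suc q" "m - Suc p = q" by (metis Suc_diff_Suc)
        then show ?thesis using True
          by (simp add: ks g_def word_def matmul.scaleR_right scaleR_left_distrib)
      next
        case False
        then have "m - p = 0" by simp
        then show ?thesis using False
          by (simp add: ks g_def word_def matmul.scaleR_right)
      qed
    qed
    have "Z d (Suc m) (Suc p) = (\<Sum>ks\<in>?S. (if p < m then real (word_count (d + 2) (m - Suc p) ks) *\<^sub>R word ks else 0) + g ks)"
      unfolding Z_def by (rule sum.cong[OF refl split])
    also have "\<dots> = (if p < m then Z (d + 2) m (Suc p) else 0) + (\<Sum>ks\<in>?S. g ks)"
      by (auto simp: sum.distrib Z_def S_eq)
    also have "(\<Sum>ks\<in>?S. g ks) = (\<Sum>ks\<in>{ks \<in> ?S. hd ks \<le> d}. g ks)"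
      by (rule sum.mono_neutral_right) (auto simp: fin g_def)
    also have "\<dots> = (\<Sum>(k, ks)\<in>Sigma {..d} (\<lambda>k. S (d - k) m p). g (k # ks))"
      by (rule sum.reindex_bij_witness[of _ "\<lambda>(k, ks). k # ks" "\<lambda>ks. (hd ks, tl ks)"])
         (auto simp: S_def length_Suc_conv)
    also have "\<dots> = (\<Sum>k\<le>d. real (d choose k) *\<^sub>R (W k ** Z (d - k) m p))"
      by (subst sum.Sigma[symmetric]) (auto simp: fin g_def Z_def matmul.sum_right scaleR_sum_right)
    finally show ?thesis .
  qed
  have "fact d *\<^sub>R T m d = fact e *\<^sub>R (\<Sum>p\<le>m. Z d m p)"
  proof (induction m arbitrary: d)
    case 0
    have "S d 0 0 = (if d = e then {[]} else {})" by (auto simp: S_def)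
    then show ?case by (simp add: T_def Z_def word_def)
  next
    case (Suc m)
    have "fact d *\<^sub>R T (Suc m) d = fact e *\<^sub>R ((\<Sum>p\<le>m. Z (d + 2) m p) +
        (\<Sum>p\<le>m. \<Sum>k\<le>d. real (d choose k) *\<^sub>R (W k ** Z (d - k) m p)))"
      unfolding T_Suc Suc.IH
      by (subst sum.swap)
         (simp add: matmul.scaleR_right matmul.sum_right scaleR_sum_right scaleR_right_distrib mult.commute)
    also have "(\<Sum>p\<le>m. Z (d + 2) m p) = Z d (Suc m) 0 + (\<Sum>p\<le>m. if p < m then Z (d + 2) m (Suc p) else 0)"
    proof -
      have "(\<Sum>p\<le>m. if p < m then Z (d + 2) m (Suc p) else 0) = (\<Sum>p<m. Z (d + 2) m (Suc p))"
        by (rule sum.mono_neutral_cong_right) auto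
      moreover have "(\<Sum>p\<le>m. Z (d + 2) m p) = Z (d + 2) m 0 + (\<Sum>p<m. Z (d + 2) m (Suc p))"
        by (metis lessThan_Suc_atMost sum.lessThan_Suc_shift)
      ultimately show ?thesis by (simp add: Z0)
    qed
    also have "Z d (Suc m) 0 + (\<Sum>p\<le>m. if p < m then Z (d + 2) m (Suc p) else 0) +
        (\<Sum>p\<le>m. \<Sum>k\<le>d. real (d choose k) *\<^sub>R (W k ** Z (d - k) m p)) = Z d (Suc m) 0 + (\<Sum>p\<le>m. Z d (Suc m) (Suc p))"
      by (simp add: Z_Suc sum.distrib add.assoc)
    also have "\<dots> = (\<Sum>p\<le>Suc m. Z d (Suc m) p)"
      by (simp only: sum.atMost_Suc_shift)
    finally show ?case .
  qed
  then show ?thesis by (simp only: T_def Z_def S_def word_def)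
qed

lemma heat_coeff_diagonal_formula:
  assumes "n \<ge> 1"
  shows "heat_coeff (\<lambda>i. (1 / fact i) *\<^sub>R Dx i U x) n 0 =
      (\<Sum>j=0..n. (half_binomial n j * ((-1) ^ j * fact (2 * j) / (4 ^ j * fact j * fact (j + n)))) *\<^sub>R
        (\<Sum>p=1..j + n. \<Sum>ks\<in>k_indices n p. real (C_coeff n j ks) *\<^sub>R U_monomial U ks x))"
proof -
  let ?u = "\<lambda>i. (1 / fact i) *\<^sub>R Dx i U x"
  have "(taylor_schroedinger ?u ^^ (j + n)) (\<lambda>i. if i = 2 * j then mat 1 else 0) 0 =
     fact (2 * j) *\<^sub>R (\<Sum>p=1..j + n. \<Sum>ks\<in>k_indices n p. real (C_coeff n j ks) *\<^sub>R U_monomial U ks x)" for j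
  proof -
    have k: "{ks. length ks = p \<and> sum_list ks + 2 * j + 2 * p = 0 + 2 * (j + n)} = k_indices n p" for p
      by (auto simp: k_indices_def)
    have "(taylor_schroedinger ?u ^^ (j + n)) (\<lambda>i. if i = 2 * j then mat 1 else 0) 0 =
      fact (2 * j) *\<^sub>R (\<Sum>p\<le>j + n. \<Sum>ks\<in>k_indices n p. real (word_count 0 (j + n - p) ks) *\<^sub>R U_monomial U ks x)"
      using schroedinger_power_word_expansion[where W = "\<lambda>i. Dx i U x" and d = 0 and m = "j + n" and e = "2 * j",
          unfolded k]
      by (simp add: U_monomial_def)
    also have "(\<Sum>p\<le>j + n. \<Sum>ks\<in>k_indices n p. real (word_count 0 (j + n - p) ks) *\<^sub>R U_monomial U ks x) =
       (\<Sum>p\<le>j + n. \<Sum>ks\<in>k_indices n p. real (C_coeff n j ks) *\<^sub>R U_monomial U ks x)"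
      by (intro sum.cong refl) (auto simp: C_coeff_eq_word_count k_indices_def)
    also have "\<dots> = (\<Sum>p=1..j + n. \<Sum>ks\<in>k_indices n p. real (C_coeff n j ks) *\<^sub>R U_monomial U ks x)"
    proof (rule sum.mono_neutral_right)
      have "k_indices n 0 = {}" using assms by (auto simp: k_indices_def)
      then show "\<forall>p\<in>{..j + n} - {1..j + n}. (\<Sum>ks\<in>k_indices n p. real (C_coeff n j ks) *\<^sub>R U_monomial U ks x) = 0"
        by (auto simp: not_less_eq_eq)
    qed auto
    finally show ?thesis .
  qed
  then show ?thesis
    by (subst heat_coeff_diagonal_eq_schroedinger_powers) (simp add: atLeast0AtMost mult.assoc)
qed

section \<open>Uniform boundedness and weakly convergent families\<close>

text \<open>
  The principle of uniform boundedness: by Baire's theorem one of the sets on which all operators are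
  bounded by \<open>m\<close> contains a ball, and a ball generates the space by translation and scaling.
\<close>

lemma uniform_boundedness:
  fixes F :: "'i \<Rightarrow> 'a::{real_normed_vector, complete_space} \<Rightarrow> 'b::real_normed_vector"
  assumes lin: "\<And>i. i \<in> I \<Longrightarrow> bounded_linear (F i)"
    and pointwise: "\<And>x. \<exists>B. \<forall>i\<in>I. norm (F i x) \<le> B"
  shows "\<exists>M\<ge>0. \<forall>i\<in>I. \<forall>x. norm (F i x) \<le> M * norm x"
proof -
  define A where "A m = {x. \<forall>i\<in>I. norm (F i x) \<le> real m}" for m
  have closedA: "closed (A m)" for m
  proof -
    have "A m = (\<Inter>i\<in>I. {x. norm (F i x) \<le> real m})" by (auto simp: A_def)
    moreover have "closed {x. norm (F i x) \<le> real m}" if "i \<in> I" for i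
      using lin[OF that] by (intro closed_Collect_le continuous_intros linear_continuous_on)
    ultimately show ?thesis by auto
  qed
  have cover: "(\<Union>m. A m) = UNIV"
  proof (rule set_eqI)
    fix x
    obtain B where "\<forall>i\<in>I. norm (F i x) \<le> B" using pointwise by blast
    then have "x \<in> A (nat \<lceil>B\<rceil>)" by (auto simp: A_def) (smt (verit) real_nat_ceiling_ge)
    then show "x \<in> (\<Union>m. A m) \<longleftrightarrow> x \<in> UNIV" by blast
  qed
  have "\<exists>m. interior (A m) \<noteq> {}"
  proof (rule ccontr)
    assume "\<not> ?thesis"
    then have "euclidean interior_of \<Union>(range A) = ({} :: 'a set)"
      by (intro Baire_category_alt disjI1 completely_metrizable_space_euclidean) (auto simp: closedA)
    then show False by (simp add: cover)
  qed
  then obtain m x0 where "x0 \<in> interior (A m)" by blast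
  then obtain e where e: "e > 0" "cball x0 e \<subseteq> A m" by (meson mem_interior_cball)
  have "norm (F i x) \<le> 2 * real m / e * norm x" if i: "i \<in> I" for i x
  proof (cases "x = 0")
    case True
    then show ?thesis using lin[OF i] by (simp add: linear_0 bounded_linear.linear)
  next
    case False
    interpret bounded_linear "F i" by (rule lin[OF i])
    define c where "c = e / norm x"
    have c: "c > 0" "c * norm x = e" using e False by (auto simp: c_def)
    have "x0 \<in> A m" "x0 + c *\<^sub>R x \<in> A m" using e c by (auto intro!: subsetD[OF e(2)] simp: dist_norm)
    then have "norm (F i x0) \<le> real m" "norm (F i (x0 + c *\<^sub>R x)) \<le> real m"
      using i by (auto simp: A_def)
    moreover have "F i (c *\<^sub>R x) = F i (x0 + c *\<^sub>R x) - F i x0" by (simp add: add)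
    ultimately have "norm (F i (c *\<^sub>R x)) \<le> 2 * real m"
      by (metis (no_types, opaque_lifting) add_mono mult_2 norm_triangle_ineq4 order_trans)
    then have "c * norm (F i x) \<le> 2 * real m" using c by (simp add: scaleR)
    then show ?thesis using c e False by (simp add: c_def field_simps)
  qed
  then show ?thesis using e by (intro exI[of _ "2 * real m / e"]) auto
qed

text \<open>
  The extension is \<open>g\<close> composed with the retraction of the line onto the interval.
\<close>

lemma continuous_on_zero_extension:
  fixes g :: "real \<Rightarrow> 'a::real_normed_vector"
  assumes "continuous_on {-1..1} g" "g (-1) = 0" "g 1 = 0"
  shows "continuous_on UNIV (\<lambda>x. if x \<in> {-1..1} then g x else 0)"
proof -
  have "continuous_on UNIV (\<lambda>x. g (max (-1) (min 1 x)))"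
    by (rule continuous_on_compose2[OF assms(1)]) (auto intro!: continuous_intros)
  moreover have "g (max (-1) (min 1 x)) = (if x \<in> {-1..1} then g x else 0)" for x
    using assms by (auto simp: max_def min_def)
  ultimately show ?thesis by simp
qed

text \<open>
  The functional given by integration against \<open>w\<close> over \<open>[-1, 1]\<close> has norm at most \<open>M\<close> on test
  functions that vanish at the end points.
\<close>

definition weakly_bounded :: "real \<Rightarrow> (real \<Rightarrow> 'a::real_normed_vector) \<Rightarrow> bool" where
  "weakly_bounded M w \<longleftrightarrow> (\<forall>g B. continuous_on {-1..1} g \<longrightarrow> g (-1) = 0 \<longrightarrow> g 1 = 0 \<longrightarrow>
     (\<forall>x\<in>{-1..1}. \<bar>g x\<bar> \<le> B) \<longrightarrow> norm (integral {-1..1} (\<lambda>x. g x *\<^sub>R w x)) \<le> M * B)"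

text \<open>
  For each test function the integrals converge as \<open>t\<close> tends to \<open>0\<close> and are continuous in \<open>t\<close> away from
  \<open>0\<close>, hence they are bounded; uniform boundedness on the Banach space of bounded continuous functions
  makes the bound uniform. Multiplication by a tent function, equal to \<open>1\<close> on \<open>[-1, 1]\<close>, turns bounded
  continuous functions into compactly supported test functions.
\<close>

lemma weakly_convergent_imp_weakly_bounded:
  fixes v :: "real \<Rightarrow> real \<Rightarrow> 'a::euclidean_space"
  assumes cont: "continuous_on ({0<..} \<times> UNIV) (\<lambda>(t, x). v t x)"
    and weak: "\<And>\<phi> :: real \<Rightarrow> real. continuous_on UNIV \<phi> \<Longrightarrow> bounded {x. \<phi> x \<noteq> 0} \<Longrightarrow>
      \<exists>l. ((\<lambda>t. integral UNIV (\<lambda>x. \<phi> x *\<^sub>R v t x)) \<longlongrightarrow> l) (at_right 0)"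
  shows "\<exists>M\<ge>0. \<forall>t\<in>{0<..1}. weakly_bounded M (v t)"
proof -
  define tent where "tent x = max 0 (min 1 (2 - \<bar>x\<bar>))" for x :: real
  have tent_cont: "continuous_on A tent" for A
    unfolding tent_def by (intro continuous_intros)
  have tent_range: "\<bar>tent x\<bar> \<le> 1" for x by (auto simp: tent_def)
  have tent_zero: "tent x = 0" if "x \<notin> {-2..2}" for x using that by (auto simp: tent_def)
  have tent_one: "tent x = 1" if "x \<in> {-1..1}" for x using that by (auto simp: tent_def)
  define F :: "real \<Rightarrow> (real \<Rightarrow>\<^sub>C real) \<Rightarrow> 'a"
    where "F t f = integral {-2..2} (\<lambda>x. (tent x * apply_bcontfun f x) *\<^sub>R v t x)" for t f
  have v_cont: "continuous_on A (v t)" if "t > 0" for t A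
  proof -
    have "continuous_on A (\<lambda>x. (\<lambda>(t, x). v t x) (t, x))"
      by (rule continuous_on_compose2[OF cont]) (use that in \<open>auto intro!: continuous_intros\<close>)
    then show ?thesis by simp
  qed
  note f_cont = continuous_on_apply_bcontfun
  have int: "(\<lambda>x. (tent x * apply_bcontfun f x) *\<^sub>R v t x) integrable_on {-2..2}" if "t > 0" for t and f :: "real \<Rightarrow>\<^sub>C real"
    using that by (intro integrable_continuous_real continuous_intros tent_cont v_cont f_cont)
  have lin: "bounded_linear (F t)" if t: "t > 0" for t
  proof (rule bounded_linear_intro[where K = "integral {-2..2} (\<lambda>x. norm (v t x))"])
    show "F t (f + g) = F t f + F t g" for f g
      using int[OF t] by (simp add: F_def integral_add[symmetric] scaleR_left_distrib ring_distribs)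
    show "F t (r *\<^sub>R f) = r *\<^sub>R F t f" for r f
      unfolding F_def by (subst integral_cmul[symmetric]) (simp add: mult_ac)
    show "norm (F t f) \<le> norm f * integral {-2..2} (\<lambda>x. norm (v t x))" for f
    proof -
      have "norm (F t f) \<le> integral {-2..2} (\<lambda>x. norm f * norm (v t x))"
        unfolding F_def
      proof (rule Henstock_Kurzweil_Integration.integral_norm_bound_integral[OF int[OF t]])
        show "(\<lambda>x. norm f * norm (v t x)) integrable_on {-2..2}"
          using t by (intro integrable_continuous_real continuous_intros v_cont)
        fix x
        have "\<bar>tent x\<bar> * \<bar>apply_bcontfun f x\<bar> \<le> 1 * norm f"
          using norm_bounded[of f x] tent_range[of x] by (intro mult_mono) auto
        then show "norm ((tent x * apply_bcontfun f x) *\<^sub>R v t x) \<le> norm f * norm (v t x)"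
          by (simp add: abs_mult mult_right_mono)
      qed
      then show ?thesis by simp
    qed
  qed
  have pointwise: "\<exists>B. \<forall>t\<in>{0<..1}. norm (F t f) \<le> B" for f
  proof -
    have "\<exists>l. ((\<lambda>t. integral UNIV (\<lambda>x. (tent x * apply_bcontfun f x) *\<^sub>R v t x)) \<longlongrightarrow> l) (at_right 0)"
    proof (rule weak)
      show "bounded {x. tent x * apply_bcontfun f x \<noteq> 0}"
        by (rule bounded_subset[of "{-2..2}"]) (use tent_zero in fastforce)+
    qed (intro continuous_intros tent_cont f_cont)
    then obtain l where l: "((\<lambda>t. integral UNIV (\<lambda>x. (tent x * apply_bcontfun f x) *\<^sub>R v t x)) \<longlongrightarrow> l) (at_right 0)"
      by blast
    have "integral UNIV (\<lambda>x. (tent x * apply_bcontfun f x) *\<^sub>R v t x) = F t f" for t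
      unfolding F_def by (subst integral_restrict_UNIV[symmetric]) (intro integral_cong, auto simp: tent_zero)
    with l have "((\<lambda>t. F t f) \<longlongrightarrow> l) (at_right 0)" by simp
    then have "eventually (\<lambda>t. dist (F t f) l < 1) (at_right 0)" by (rule tendstoD) simp
    then obtain d where d: "d > 0" "\<And>t. 0 < t \<Longrightarrow> t < d \<Longrightarrow> dist (F t f) l < 1"
      unfolding eventually_at_right_field by blast
    have "continuous_on {d..1} (\<lambda>t. integral (cbox (-2) 2) (\<lambda>x. (tent x * apply_bcontfun f x) *\<^sub>R v t x))"
    proof (rule integral_continuous_on_param)
      have "continuous_on ({d..1} \<times> cbox (-2) 2) (\<lambda>z. (tent (snd z) * apply_bcontfun f (snd z)) *\<^sub>R (case z of (t, x) \<Rightarrow> v t x))"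
      proof (intro continuous_intros)
        show "continuous_on ({d..1} \<times> cbox (-2) 2) (\<lambda>z. tent (snd z))"
          by (rule continuous_on_compose2[OF tent_cont[of UNIV]]) (auto intro!: continuous_intros)
        show "continuous_on ({d..1} \<times> cbox (-2) 2) (\<lambda>z. apply_bcontfun f (snd z))"
          by (rule continuous_on_compose2[OF f_cont[of UNIV]]) (auto intro!: continuous_intros)
        show "continuous_on ({d..1} \<times> cbox (-2) 2) (\<lambda>z. case z of (t, x) \<Rightarrow> v t x)"
          by (rule continuous_on_subset[OF cont]) (use d in auto)
      qed
      then show "continuous_on ({d..1} \<times> cbox (-2) 2) (\<lambda>(t, x). (tent x * apply_bcontfun f x) *\<^sub>R v t x)"
        by (simp add: case_prod_unfold)
    qed
    then have "continuous_on {d..1} (\<lambda>t. F t f)" by (simp add: F_def)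
    then have "bounded ((\<lambda>t. F t f) ` {d..1})"
      by (intro compact_imp_bounded compact_continuous_image) auto
    then obtain B where "\<forall>y\<in>(\<lambda>t. F t f) ` {d..1}. norm y \<le> B" unfolding bounded_iff by blast
    then have B: "\<And>t. t \<in> {d..1} \<Longrightarrow> norm (F t f) \<le> B" by blast
    have "norm (F t f) \<le> max B (norm l + 1)" if t: "t \<in> {0<..1}" for t
    proof (cases "t < d")
      case True
      have "norm (F t f) \<le> norm l + dist (F t f) l"
        by (metis dist_norm norm_triangle_sub)
      with d(2)[of t] True t show ?thesis by auto
    next
      case False
      with B[of t] t show ?thesis by auto
    qed
    then show ?thesis by blast
  qed
  obtain M where M: "M \<ge> 0" "\<And>t f. t \<in> {0<..1} \<Longrightarrow> norm (F t f) \<le> M * norm f"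
    using uniform_boundedness[of "{0<..1}" F] lin pointwise by (auto simp: greaterThanAtMost_iff)
  have "weakly_bounded M (v t)" if t: "t \<in> {0<..1}" for t
    unfolding weakly_bounded_def
  proof (intro allI impI)
    fix g :: "real \<Rightarrow> real" and B
    assume g: "continuous_on {-1..1} g" "g (-1) = 0" "g 1 = 0" and B: "\<forall>x\<in>{-1..1}. \<bar>g x\<bar> \<le> B"
    define g0 where "g0 x = (if x \<in> {-1..1} then g x else 0)" for x
    have "0 \<le> \<bar>g 0\<bar>" by simp
    also have "\<dots> \<le> B" using B by auto
    finally have g0_le: "\<bar>g0 x\<bar> \<le> B" for x using B by (auto simp: g0_def)
    have "g0 \<in> bcontfun"
      using continuous_on_zero_extension[OF g] g0_le
      by (intro bcontfun_normI[of _ B]) (auto simp: g0_def[abs_def])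
    then have ap: "apply_bcontfun (Bcontfun g0) = g0" by (rule Bcontfun_inverse)
    have "F t (Bcontfun g0) = integral {-1..1} (\<lambda>x. g x *\<^sub>R v t x)"
    proof -
      have "F t (Bcontfun g0) = integral UNIV (\<lambda>x. if x \<in> {-2..2} then (tent x * g0 x) *\<^sub>R v t x else 0)"
        by (simp only: F_def ap integral_restrict_UNIV)
      also have "\<dots> = integral UNIV (\<lambda>x. if x \<in> {-1..1} then g x *\<^sub>R v t x else 0)"
        by (intro integral_cong) (auto simp: g0_def tent_one)
      finally show ?thesis by (simp only: integral_restrict_UNIV)
    qed
    moreover have "norm (Bcontfun g0) \<le> B"
      by (rule norm_bound) (simp add: ap g0_le)
    ultimately show "norm (integral {-1..1} (\<lambda>x. g x *\<^sub>R v t x)) \<le> M * B"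
      using M(2)[OF t, of "Bcontfun g0"] M(1) by (metis mult_left_mono order_trans)
  qed
  with M(1) show ?thesis by blast
qed

text \<open>
  Matrix-valued test functions are reduced to real-valued ones by expanding in a real basis.
\<close>

lemma matrix_eq_sum_Basis_mult:
  fixes A B :: "complex^'n^'n"
  shows "A ** B = (\<Sum>b\<in>Basis. b ** ((A \<bullet> b) *\<^sub>R B))"
proof -
  have "A ** B = (\<Sum>b\<in>Basis. (A \<bullet> b) *\<^sub>R b) ** B" by (simp add: euclidean_representation)
  then show ?thesis by (simp add: matmul.sum_left matmul.scaleR_left matmul.scaleR_right)
qed

lemma integral_matrix_mult_eq_sum_Basis:
  fixes g w :: "real \<Rightarrow> complex^'n^'n"
  assumes "continuous_on {a..b} g" "continuous_on {a..b} w"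
  shows "integral {a..b} (\<lambda>x. g x ** w x) = (\<Sum>e\<in>Basis. e ** integral {a..b} (\<lambda>x. (g x \<bullet> e) *\<^sub>R w x))"
proof -
  have int: "(\<lambda>x. (g x \<bullet> e) *\<^sub>R w x) integrable_on {a..b}" for e
    by (intro integrable_continuous_real continuous_intros assms)
  have "e ** integral {a..b} (\<lambda>x. (g x \<bullet> e) *\<^sub>R w x) = integral {a..b} (\<lambda>x. e ** ((g x \<bullet> e) *\<^sub>R w x))" for e
    using integral_linear[OF int matmul.bounded_linear_right, of e e] by (simp add: o_def)
  moreover have "integral {a..b} (\<lambda>x. g x ** w x) = integral {a..b} (\<lambda>x. \<Sum>e\<in>Basis. e ** ((g x \<bullet> e) *\<^sub>R w x))"
    by (subst matrix_eq_sum_Basis_mult) (rule refl)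
  moreover have "\<dots> = (\<Sum>e\<in>Basis. integral {a..b} (\<lambda>x. e ** ((g x \<bullet> e) *\<^sub>R w x)))"
    by (intro integral_sum finite_Basis integrable_continuous_real continuous_intros assms matmul.continuous_on)
  ultimately show ?thesis by simp
qed

definition matrix_weakly_bounded :: "real \<Rightarrow> (real \<Rightarrow> complex^'n^'n) \<Rightarrow> bool" where
  "matrix_weakly_bounded M w \<longleftrightarrow> (\<forall>(g :: real \<Rightarrow> complex^'n^'n) B. continuous_on {-1..1} g \<longrightarrow> g (-1) = 0 \<longrightarrow> g 1 = 0 \<longrightarrow>
     (\<forall>x\<in>{-1..1}. norm (g x) \<le> B) \<longrightarrow> norm (integral {-1..1} (\<lambda>x. g x ** w x)) \<le> M * B)"

lemma weakly_bounded_imp_matrix_weakly_bounded: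
  shows "\<exists>C\<ge>0. \<forall>M w. continuous_on {-1..1} w \<longrightarrow> weakly_bounded M (w :: real \<Rightarrow> complex^'n^'n) \<longrightarrow>
    matrix_weakly_bounded (C * M) w"
proof -
  have "\<exists>K>0. \<forall>(A :: complex^'n^'n) (B :: complex^'n^'n). norm (A ** B) \<le> norm A * norm B * K"
    by (rule matmul.pos_bounded)
  then obtain K where "K > 0" and "\<forall>(A :: complex^'n^'n) (B :: complex^'n^'n). norm (A ** B) \<le> norm A * norm B * K"
    by (elim exE conjE)
  then have K: "K > 0" "\<And>(A :: complex^'n^'n) (B :: complex^'n^'n). norm (A ** B) \<le> norm A * norm B * K" by auto
  define C where "C = (\<Sum>b\<in>(Basis :: (complex^'n^'n) set). norm b * K)"
  have "C \<ge> 0" using K by (auto simp: C_def intro!: sum_nonneg)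
  moreover have "matrix_weakly_bounded (C * M) w"
    if w: "continuous_on {-1..1} w" and M: "weakly_bounded M w" for M and w :: "real \<Rightarrow> complex^'n^'n"
    unfolding matrix_weakly_bounded_def
  proof (intro allI impI)
    fix g :: "real \<Rightarrow> complex^'n^'n" and B
    assume g: "continuous_on {-1..1} g" "g (-1) = 0" "g 1 = 0" "\<forall>x\<in>{-1..1}. norm (g x) \<le> B"
    have "norm (e ** integral {-1..1} (\<lambda>x. (g x \<bullet> e) *\<^sub>R w x)) \<le> norm e * K * (M * B)" if e: "e \<in> Basis" for e
    proof -
      have "\<forall>x\<in>{-1..1}. \<bar>g x \<bullet> e\<bar> \<le> B"
        using g(4) Basis_le_norm[OF e] order_trans by blast
      then have "norm (integral {-1..1} (\<lambda>x. (g x \<bullet> e) *\<^sub>R w x)) \<le> M * B"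
        using M[unfolded weakly_bounded_def, rule_format, of "\<lambda>x. g x \<bullet> e" B] g(2,3)
          continuous_on_inner[OF g(1) continuous_on_const[of _ e]] by simp
      then have "norm e * norm (integral {-1..1} (\<lambda>x. (g x \<bullet> e) *\<^sub>R w x)) * K \<le> norm e * (M * B) * K"
        using K by (intro mult_right_mono mult_left_mono) auto
      with K(2)[of e "integral {-1..1} (\<lambda>x. (g x \<bullet> e) *\<^sub>R w x)"] show ?thesis by (simp add: mult_ac)
    qed
    then have "norm (integral {-1..1} (\<lambda>x. g x ** w x)) \<le> (\<Sum>e\<in>(Basis :: (complex^'n^'n) set). norm e * K * (M * B))"
      unfolding integral_matrix_mult_eq_sum_Basis[OF g(1) w] by (intro sum_norm_le)
    then show "norm (integral {-1..1} (\<lambda>x. g x ** w x)) \<le> C * M * B"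
      by (simp add: C_def sum_distrib_right mult.assoc)
  qed
  ultimately show ?thesis by blast
qed

section \<open>The Gaussian\<close>

definition gauss :: "real \<Rightarrow> real \<Rightarrow> real" where
  "gauss \<tau> x = exp (- (x\<^sup>2 / (4 * \<tau>))) / sqrt (4 * pi * \<tau>)"

lemma gauss_pos: "\<tau> > 0 \<Longrightarrow> gauss \<tau> x > 0"
  by (simp add: gauss_def)

lemma gauss_derivative_space:
  assumes "\<tau> > 0"
  shows "(gauss \<tau> has_real_derivative (- x / (2 * \<tau>)) * gauss \<tau> x) (at x within S)"
  unfolding gauss_def[abs_def] using assms
  by (auto intro!: derivative_eq_intros simp: field_simps)

lemma gauss_derivative_time:
  assumes "\<tau> > 0"
  shows "((\<lambda>\<tau>. gauss \<tau> x) has_real_derivative (x\<^sup>2 / (4 * \<tau>\<^sup>2) - 1 / (2 * \<tau>)) * gauss \<tau> x) (at \<tau> within S)"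
proof -
  define S where "S = sqrt (4 * pi * \<tau>)"
  have S: "S > 0" "S * S = 4 * pi * \<tau>" using assms by (auto simp: S_def)
  have d1: "((\<lambda>\<tau>. exp (- (x\<^sup>2 / (4 * \<tau>)))) has_real_derivative exp (- (x\<^sup>2 / (4 * \<tau>))) * (x\<^sup>2 / (4 * \<tau>\<^sup>2))) (at \<tau> within A)" for A
    using assms by (auto intro!: derivative_eq_intros simp: power2_eq_square)
  have d2: "((\<lambda>\<tau>. sqrt (4 * pi * \<tau>)) has_real_derivative 2 * pi / S) (at \<tau> within A)" for A
    using assms S by (auto intro!: derivative_eq_intros simp: S_def divide_simps mult_less_0_iff)
  have "2 * pi = S * S / (2 * \<tau>)" using S assms by simp
  then have e: "(e * y * S - e * (2 * pi / S)) / (S * S) = (y - 1 / (2 * \<tau>)) * (e / S)" for e y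
    using S(1) assms by (simp add: divide_simps) (simp add: algebra_simps)
  show ?thesis
    unfolding gauss_def using DERIV_divide[OF d1 d2] S(1) by (simp only: S_def[symmetric] e)
qed

lemma continuous_on_gauss [continuous_intros]:
  assumes "continuous_on A f" "continuous_on A g" "\<And>z. z \<in> A \<Longrightarrow> f z > 0"
  shows "continuous_on A (\<lambda>z. gauss (f z) (g z))"
  unfolding gauss_def using assms by (auto intro!: continuous_intros) (use assms(3) in force)+

text \<open>
  A single term of the exponential series is at most its sum.
\<close>

lemma power_mult_exp_minus_le:
  fixes z :: real
  assumes "z \<ge> 0"
  shows "z ^ q * exp (- z) \<le> fact q"
proof -
  have "z ^ q /\<^sub>R fact q \<le> exp z"
    using sum_le_suminf[OF summable_exp[of z], of "{q}"] assms by (simp add: exp_def)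
  then show ?thesis by (simp add: exp_minus field_simps)
qed

text \<open>
  Parabolic scaling: against the Gaussian, \<open>x\<^sup>2\<close> counts as \<open>\<tau>\<close>. The factor \<open>1 / sqrt (4\<pi>\<tau>)\<close> is estimated
  by \<open>1 / \<tau>\<close>, which avoids half-integer powers.
\<close>

lemma gauss_power_bound:
  assumes "0 < \<tau>" "\<tau> \<le> 1"
  shows "gauss \<tau> x * x ^ (2 * q) \<le> fact q * 4 ^ q * (\<tau> ^ q / \<tau>)"
proof -
  define z where "z = x\<^sup>2 / (4 * \<tau>)"
  have x: "x ^ (2 * q) = 4 ^ q * \<tau> ^ q * z ^ q"
    using assms by (simp add: z_def power_mult power_divide power_mult_distrib)
  have "\<tau> \<le> sqrt \<tau>" using assms by (simp add: real_le_rsqrt power2_eq_square mult_left_le)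
  also have "\<dots> \<le> sqrt (4 * pi * \<tau>)" using assms pi_gt3 by simp
  finally have s: "\<tau> \<le> sqrt (4 * pi * \<tau>)" .
  have "gauss \<tau> x * x ^ (2 * q) = 4 ^ q * \<tau> ^ q * (z ^ q * exp (- z)) / sqrt (4 * pi * \<tau>)"
    unfolding x by (simp add: gauss_def z_def)
  also have "\<dots> \<le> 4 ^ q * \<tau> ^ q * fact q / \<tau>"
    using assms power_mult_exp_minus_le[of z q] s
    by (intro frac_le mult_left_mono) (auto simp: z_def)
  finally show ?thesis by (simp add: mult_ac)
qed

lemma gauss_eq_normal_density: "\<tau> > 0 \<Longrightarrow> gauss \<tau> x = normal_density 0 (sqrt (2 * \<tau>)) x"
  by (simp add: gauss_def normal_density_def mult_ac)

text \<open>
  Chebyshev's inequality for the normal distribution of variance \<open>2\<tau>\<close>.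
\<close>

lemma gauss_mass_near_origin:
  assumes "\<tau> > 0"
  shows "integral {-1..1} (gauss \<tau>) \<le> 1" "1 - 2 * \<tau> \<le> integral {-1..1} (gauss \<tau>)"
proof -
  let ?n = "normal_density 0 (sqrt (2 * \<tau>))"
  have s: "sqrt (2 * \<tau>) > 0" using assms by simp
  have g: "gauss \<tau> = ?n" using gauss_eq_normal_density[OF assms] by auto
  have int: "integrable lborel ?n" using s by simp
  have tot: "(\<integral>x. ?n x \<partial>lborel) = 1" using s by simp
  have si: "set_integrable lborel {-1..1} ?n"
    unfolding set_integrable_def using int by (intro integrable_mult_indicator) auto
  have eq: "integral {-1..1} (gauss \<tau>) = (\<integral>x. indicator {-1..1} x * ?n x \<partial>lborel)"
    using set_borel_integral_eq_integral(2)[OF si] by (simp add: g set_lebesgue_integral_def)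
  have int': "integrable lborel (\<lambda>x. indicator {-1..1} x * ?n x)"
    using si by (simp add: set_integrable_def)
  have "(\<integral>x. indicator {-1..1} x * ?n x \<partial>lborel) \<le> (\<integral>x. ?n x \<partial>lborel)"
    using int int' by (intro integral_mono) (auto simp: indicator_def)
  then show "integral {-1..1} (gauss \<tau>) \<le> 1" by (simp only: eq tot)
  have var: "has_bochner_integral lborel (\<lambda>x. ?n x * x\<^sup>2) (2 * \<tau>)"
  proof -
    have "fact (2 * 1) / ((2 / (sqrt (2 * \<tau>))\<^sup>2) ^ 1 * fact 1) = 2 * \<tau>" using assms by simp
    with normal_moment_even[OF s, of 0 1] show ?thesis by (simp only: mult_1_right diff_0_right)
  qed
  have "(\<integral>x. ?n x - ?n x * x\<^sup>2 \<partial>lborel) = 1 - 2 * \<tau>"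
    using var int tot by (simp add: has_bochner_integral_iff)
  moreover have "(\<integral>x. ?n x - ?n x * x\<^sup>2 \<partial>lborel) \<le> (\<integral>x. indicator {-1..1} x * ?n x \<partial>lborel)"
  proof (intro integral_mono int')
    show "integrable lborel (\<lambda>x. ?n x - ?n x * x\<^sup>2)" using var int by (simp add: has_bochner_integral_iff)
    fix x :: real
    have "1 - x\<^sup>2 \<le> indicator {-1..1} x"
      using one_le_power[of "\<bar>x\<bar>" 2] by (auto simp: indicator_def abs_le_iff)
    then show "?n x - ?n x * x\<^sup>2 \<le> indicator {-1..1} x * ?n x"
      using mult_right_mono[of "1 - x\<^sup>2" "indicator {-1..1} x" "?n x"] by (simp add: algebra_simps)
  qed
  ultimately show "1 - 2 * \<tau> \<le> integral {-1..1} (gauss \<tau>)" by (simp add: eq)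
qed

text \<open>
  Away from the origin \<open>f \<tau> x - f 0 0\<close> is dominated by a multiple of \<open>x\<^sup>4\<close>, and \<open>G(\<tau>, x) x\<^sup>4\<close> is
  uniformly of order \<open>\<tau>\<close>.
\<close>

lemma gauss_approximate_identity:
  fixes f :: "real \<Rightarrow> real \<Rightarrow> 'a::euclidean_space"
  assumes d: "0 < d" "d \<le> 1" and cont: "continuous_on ({0..d} \<times> {-1..1}) (\<lambda>(\<tau>, x). f \<tau> x)"
  shows "((\<lambda>\<tau>. integral {-1..1} (\<lambda>x. gauss \<tau> x *\<^sub>R f \<tau> x)) \<longlongrightarrow> f 0 0) (at_right 0)"
proof -
  let ?K = "{0..d} \<times> {-1..1::real}"
  let ?F = "\<lambda>(\<tau>, x). f \<tau> x"
  have "compact ?K" by (intro compact_Times) auto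
  then have "bounded (?F ` ?K)" by (intro compact_imp_bounded compact_continuous_image cont)
  then obtain C where "\<forall>y\<in>?F ` ?K. norm y \<le> C" unfolding bounded_iff by blast
  then have C: "norm (f \<tau> x) \<le> C" if "\<tau> \<in> {0..d}" "x \<in> {-1..1}" for \<tau> x using that by force
  have C0: "C \<ge> 0" using order_trans[OF norm_ge_zero C[of 0 0]] d by simp
  have cont_x: "continuous_on {-1..1} (f \<tau>)" if "\<tau> \<in> {0..d}" for \<tau>
  proof -
    have "continuous_on {-1..1} (\<lambda>x. ?F (\<tau>, x))"
      by (rule continuous_on_compose2[OF cont]) (use that in \<open>auto intro!: continuous_intros\<close>)
    then show ?thesis by simp
  qed
  have g_int: "(\<lambda>x. gauss \<tau> x * c) integrable_on {-1..1}" "gauss \<tau> integrable_on {-1..1}" if "\<tau> > 0" for \<tau> c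
    using that by (intro integrable_continuous_real continuous_intros; simp)+
  have "((\<lambda>\<tau>. integral {-1..1} (gauss \<tau>)) \<longlongrightarrow> 1) (at_right 0)"
  proof (rule real_tendsto_sandwich[where f = "\<lambda>\<tau>. 1 - 2 * \<tau>" and h = "\<lambda>_. 1"])
    show "((\<lambda>\<tau>::real. 1 - 2 * \<tau>) \<longlongrightarrow> 1) (at_right 0)"
      by (auto intro!: tendsto_eq_intros)
  qed (auto simp: eventually_at_filter gauss_mass_near_origin)
  then have mass: "((\<lambda>\<tau>. integral {-1..1} (gauss \<tau>) *\<^sub>R f 0 0) \<longlongrightarrow> 1 *\<^sub>R f 0 0) (at_right 0)"
    by (intro tendsto_intros)
  have "((\<lambda>\<tau>. integral {-1..1} (\<lambda>x. gauss \<tau> x *\<^sub>R (f \<tau> x - f 0 0))) \<longlongrightarrow> 0) (at_right 0)"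
  proof (rule tendstoI)
    fix e :: real assume e: "e > 0"
    have "(0, 0) \<in> ?K" using d by simp
    with cont[unfolded continuous_on_iff] e
    obtain r where r: "r > 0" "\<And>z. z \<in> ?K \<Longrightarrow> dist z (0, 0) < r \<Longrightarrow> dist (?F z) (?F (0, 0)) < e / 4"
      by (metis zero_less_divide_iff zero_less_numeral)
    define \<rho> where "\<rho> = r / 2"
    define D where "D = 2 * C / \<rho> ^ 4 * 32"
    have \<rho>: "\<rho> > 0" using r by (simp add: \<rho>_def)
    have D0: "D \<ge> 0" using C0 \<rho> by (simp add: D_def)
    have near: "norm (f \<tau> x - f 0 0) \<le> e / 4" if "\<tau> \<in> {0..d}" "x \<in> {-1..1}" "\<tau> < \<rho>" "\<bar>x\<bar> < \<rho>" for \<tau> x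
    proof -
      have "dist (\<tau>, x) (0, 0) \<le> \<bar>\<tau>\<bar> + \<bar>x\<bar>"
        unfolding dist_norm using norm_Pair_le[of \<tau> x] by simp
      also have "\<dots> < r" using that by (simp add: \<rho>_def)
      finally have "dist (f \<tau> x) (f 0 0) < e / 4" using r(2)[of "(\<tau>, x)"] that by simp
      then show ?thesis by (simp add: dist_norm)
    qed
    have pointwise: "norm (f \<tau> x - f 0 0) \<le> e / 4 + 2 * C / \<rho> ^ 4 * x ^ 4"
      if "\<tau> \<in> {0..d}" "x \<in> {-1..1}" "\<tau> < \<rho>" for \<tau> x
    proof (cases "\<bar>x\<bar> < \<rho>")
      case True
      with near[OF that True] C0 \<rho> show ?thesis by (simp add: add_increasing2)
    next
      case False
      then have "\<rho> ^ 4 \<le> x ^ 4"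
        using power_mono[of \<rho> "\<bar>x\<bar>" 4] \<rho> by (simp add: power_even_abs)
      then have "2 * C * 1 \<le> 2 * C * (x ^ 4 / \<rho> ^ 4)" using C0 \<rho> by (intro mult_left_mono) auto
      moreover have "norm (f \<tau> x - f 0 0) \<le> C + C"
        using C[OF that(1,2)] C[of 0 0] d by (intro norm_triangle_le_diff add_mono) auto
      ultimately show ?thesis using e by simp
    qed
    have bound: "norm (integral {-1..1} (\<lambda>x. gauss \<tau> x *\<^sub>R (f \<tau> x - f 0 0))) \<le> e / 4 + 2 * D * \<tau>"
      if \<tau>: "0 < \<tau>" "\<tau> < d" "\<tau> < \<rho>" for \<tau>
    proof -
      have "norm (integral {-1..1} (\<lambda>x. gauss \<tau> x *\<^sub>R (f \<tau> x - f 0 0))) \<le> integral {-1..1} (\<lambda>x. gauss \<tau> x * (e / 4) + D * \<tau>)"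
      proof (rule Henstock_Kurzweil_Integration.integral_norm_bound_integral)
        show "(\<lambda>x. gauss \<tau> x *\<^sub>R (f \<tau> x - f 0 0)) integrable_on {-1..1}"
          using \<tau> by (intro integrable_continuous_real continuous_intros cont_x) auto
        show "(\<lambda>x. gauss \<tau> x * (e / 4) + D * \<tau>) integrable_on {-1..1}"
          using \<tau> by (intro integrable_continuous_real continuous_intros) auto
        fix x :: real assume x: "x \<in> {-1..1}"
        have "norm (gauss \<tau> x *\<^sub>R (f \<tau> x - f 0 0)) \<le> gauss \<tau> x * (e / 4 + 2 * C / \<rho> ^ 4 * x ^ 4)"
          using pointwise[of \<tau> x] \<tau> x gauss_pos[of \<tau> x] by (simp add: mult_left_mono)
        also have "\<dots> = gauss \<tau> x * (e / 4) + 2 * C / \<rho> ^ 4 * (gauss \<tau> x * x ^ 4)"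
          by (simp add: algebra_simps)
        also have "gauss \<tau> x * x ^ 4 \<le> 32 * \<tau>"
          using gauss_power_bound[of \<tau> x 2] \<tau> d by (simp add: power2_eq_square fact_numeral)
        then have "2 * C / \<rho> ^ 4 * (gauss \<tau> x * x ^ 4) \<le> 2 * C / \<rho> ^ 4 * (32 * \<tau>)"
          using C0 \<rho> by (intro mult_left_mono) auto
        then have "gauss \<tau> x * (e / 4) + 2 * C / \<rho> ^ 4 * (gauss \<tau> x * x ^ 4) \<le> gauss \<tau> x * (e / 4) + D * \<tau>"
          by (simp add: D_def)
        finally show "norm (gauss \<tau> x *\<^sub>R (f \<tau> x - f 0 0)) \<le> gauss \<tau> x * (e / 4) + D * \<tau>" .
      qed
      also have "\<dots> = integral {-1..1} (gauss \<tau>) * (e / 4) + 2 * D * \<tau>"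
        using g_int[OF \<tau>(1)] by (subst Henstock_Kurzweil_Integration.integral_add) auto
      also have "\<dots> \<le> 1 * (e / 4) + 2 * D * \<tau>"
        using gauss_mass_near_origin(1)[OF \<tau>(1)] e by (intro add_right_mono mult_right_mono) auto
      finally show ?thesis by simp
    qed
    define \<delta> where "\<delta> = min (min d \<rho>) (e / (4 * D + 1))"
    have \<delta>: "\<delta> > 0" using d \<rho> e D0 by (simp add: \<delta>_def)
    show "\<forall>\<^sub>F \<tau> in at_right 0. dist (integral {-1..1} (\<lambda>x. gauss \<tau> x *\<^sub>R (f \<tau> x - f 0 0))) 0 < e"
      unfolding eventually_at_right_field
    proof (intro exI[of _ \<delta>] conjI allI impI \<delta>)
      fix \<tau> :: real assume \<tau>: "0 < \<tau>" "\<tau> < \<delta>"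
      have "\<tau> * (4 * D + 1) < e" using \<tau> D0 by (simp add: \<delta>_def less_divide_eq)
      then have "2 * D * \<tau> < e / 2" using \<tau> by (simp add: algebra_simps)
      with bound[of \<tau>] \<tau> e show "dist (integral {-1..1} (\<lambda>x. gauss \<tau> x *\<^sub>R (f \<tau> x - f 0 0))) 0 < e"
        by (simp add: \<delta>_def)
    qed
  qed
  from tendsto_add[OF this mass]
  have lim: "((\<lambda>\<tau>. integral {-1..1} (\<lambda>x. gauss \<tau> x *\<^sub>R (f \<tau> x - f 0 0)) + integral {-1..1} (gauss \<tau>) *\<^sub>R f 0 0)
      \<longlongrightarrow> f 0 0) (at_right 0)" by simp
  have "\<forall>\<^sub>F \<tau> in at_right 0. integral {-1..1} (\<lambda>x. gauss \<tau> x *\<^sub>R (f \<tau> x - f 0 0)) + integral {-1..1} (gauss \<tau>) *\<^sub>R f 0 0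
      = integral {-1..1} (\<lambda>x. gauss \<tau> x *\<^sub>R f \<tau> x)"
    unfolding eventually_at_right_field
  proof (intro exI[of _ d] conjI allI impI d)
    fix \<tau> :: real assume \<tau>: "0 < \<tau>" "\<tau> < d"
    have i1: "(\<lambda>x. gauss \<tau> x *\<^sub>R f \<tau> x) integrable_on {-1..1}" "(\<lambda>x. gauss \<tau> x *\<^sub>R f 0 0) integrable_on {-1..1}"
      using \<tau> by (auto intro!: integrable_continuous_real continuous_intros cont_x)
    have "integral {-1..1} (\<lambda>x. gauss \<tau> x *\<^sub>R f 0 0) = integral {-1..1} (gauss \<tau>) *\<^sub>R f 0 0"
      using integral_linear[OF g_int(2)[OF \<tau>(1)] bounded_linear_scaleR_left, of "f 0 0"] by (simp add: o_def)
    then show "integral {-1..1} (\<lambda>x. gauss \<tau> x *\<^sub>R (f \<tau> x - f 0 0)) + integral {-1..1} (gauss \<tau>) *\<^sub>R f 0 0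
      = integral {-1..1} (\<lambda>x. gauss \<tau> x *\<^sub>R f \<tau> x)"
      using Henstock_Kurzweil_Integration.integral_diff[OF i1] by (simp add: scaleR_diff_right)
  qed
  with lim show ?thesis by (rule Lim_transform_eventually)
qed

section \<open>Duality with an approximate backward solution\<close>

text \<open>
  A heat kernel with its pole moved to the origin, with the second variable suppressed.
\<close>

locale delta_solution =
  fixes V :: "real \<Rightarrow> complex^'r^'r" and v vt vx vxx :: "real \<Rightarrow> real \<Rightarrow> complex^'r^'r"
  assumes cont_V: "continuous_on UNIV V"
    and cont_v: "continuous_on ({0<..} \<times> UNIV) (\<lambda>(t, x). v t x)"
    and cont_vt: "continuous_on ({0<..} \<times> UNIV) (\<lambda>(t, x). vt t x)"
    and cont_vxx: "continuous_on ({0<..} \<times> UNIV) (\<lambda>(t, x). vxx t x)"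
    and deriv_t: "\<And>t x. t > 0 \<Longrightarrow> ((\<lambda>s. v s x) has_vector_derivative vt t x) (at t)"
    and deriv_x: "\<And>t x. t > 0 \<Longrightarrow> (v t has_vector_derivative vx t x) (at x)"
    and deriv_xx: "\<And>t x. t > 0 \<Longrightarrow> (vx t has_vector_derivative vxx t x) (at x)"
    and heat_equation: "\<And>t x. t > 0 \<Longrightarrow> vt t x = vxx t x + V x ** v t x"
    and initial: "\<And>\<phi> :: real \<Rightarrow> real. continuous_on UNIV \<phi> \<Longrightarrow> bounded {x. \<phi> x \<noteq> 0} \<Longrightarrow>
      ((\<lambda>t. integral UNIV (\<lambda>x. \<phi> x *\<^sub>R v t x)) \<longlongrightarrow> \<phi> 0 *\<^sub>R mat 1) (at_right 0)"
begin

lemma continuous_slice: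
  assumes "t > 0"
  shows "continuous_on A (v t)"
proof -
  have "continuous_on A (\<lambda>x. (\<lambda>(t, x). v t x) (t, x))"
    by (rule continuous_on_compose2[OF cont_v]) (use assms in \<open>auto intro!: continuous_intros\<close>)
  then show ?thesis by simp
qed

lemma mass_bounded: "\<exists>M\<ge>0. \<forall>t\<in>{0<..1}. matrix_weakly_bounded M (v t)"
proof -
  obtain M where M: "M \<ge> 0" "\<forall>t\<in>{0<..1}. weakly_bounded M (v t)"
    using weakly_convergent_imp_weakly_bounded[OF cont_v] initial by blast
  obtain C where C: "C \<ge> 0" "\<forall>M w. continuous_on {-1..1} w \<longrightarrow> weakly_bounded M (w :: real \<Rightarrow> complex^'r^'r) \<longrightarrow>
      matrix_weakly_bounded (C * M) w"
    using weakly_bounded_imp_matrix_weakly_bounded by blast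
  have "\<forall>t\<in>{0<..1}. matrix_weakly_bounded (C * M) (v t)"
    using M C continuous_slice by auto
  with C M show ?thesis by (intro exI[of _ "C * M"]) auto
qed

lemma initial_matrix:
  fixes g :: "real \<Rightarrow> complex^'r^'r"
  assumes g: "continuous_on {-1..1} g" "g (-1) = 0" "g 1 = 0"
  shows "((\<lambda>t. integral {-1..1} (\<lambda>x. g x ** v t x)) \<longlongrightarrow> g 0) (at_right 0)"
proof -
  have scalar: "((\<lambda>t. integral {-1..1} (\<lambda>x. (g x \<bullet> e) *\<^sub>R v t x)) \<longlongrightarrow> (g 0 \<bullet> e) *\<^sub>R mat 1) (at_right 0)" for e
  proof -
    define \<phi> where "\<phi> x = (if x \<in> {-1..1} then g x \<bullet> e else 0)" for x
    have "continuous_on UNIV \<phi>"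
      unfolding \<phi>_def using g by (intro continuous_on_zero_extension continuous_intros) auto
    moreover have "bounded {x. \<phi> x \<noteq> 0}"
      by (rule bounded_subset[of "{-1..1}"]) (auto simp: \<phi>_def split: if_splits)
    ultimately have "((\<lambda>t. integral UNIV (\<lambda>x. \<phi> x *\<^sub>R v t x)) \<longlongrightarrow> \<phi> 0 *\<^sub>R mat 1) (at_right 0)"
      by (rule initial)
    moreover have "integral UNIV (\<lambda>x. \<phi> x *\<^sub>R v t x) = integral {-1..1} (\<lambda>x. (g x \<bullet> e) *\<^sub>R v t x)" for t
      by (subst (2) integral_restrict_UNIV[symmetric]) (intro integral_cong, auto simp: \<phi>_def)
    ultimately show ?thesis by (simp add: \<phi>_def)
  qed
  have "((\<lambda>t. \<Sum>e\<in>Basis. e ** integral {-1..1} (\<lambda>x. (g x \<bullet> e) *\<^sub>R v t x)) \<longlongrightarrow>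
      (\<Sum>e\<in>Basis. e ** ((g 0 \<bullet> e) *\<^sub>R mat 1))) (at_right 0)"
    by (intro tendsto_sum matmul.tendsto tendsto_const scalar)
  also have "(\<Sum>e\<in>Basis. e ** ((g 0 \<bullet> e) *\<^sub>R mat 1)) = g 0"
    using matrix_eq_sum_Basis_mult[of "g 0" "mat 1"] by simp
  finally show ?thesis
    by (rule Lim_transform_eventually)
       (auto simp: eventually_at_filter integral_matrix_mult_eq_sum_Basis[OF g(1) continuous_slice])
qed

text \<open>
  Here \<open>E\<close> is an approximate fundamental solution of the adjoint equation and \<open>I s = \<integral> E(T-s) v(s)\<close>. Green's
  formula on \<open>[-1, 1]\<close>, whose boundary terms vanish, shows that \<open>I'\<close> is minus the integral of the
  residual against \<open>v\<close>. The two limits of \<open>I\<close> at the ends of \<open>(0, T)\<close> are the two quantities compared.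
\<close>

lemma duality_estimate:
  fixes E Et Ex Exx :: "real \<Rightarrow> real \<Rightarrow> complex^'r^'r"
  assumes T: "0 < T" "T \<le> 1"
    and M: "M \<ge> 0" "\<And>t. t \<in> {0<..1} \<Longrightarrow> matrix_weakly_bounded M (v t)"
    and E_t: "\<And>\<tau> x. \<tau> > 0 \<Longrightarrow> ((\<lambda>\<tau>. E \<tau> x) has_vector_derivative Et \<tau> x) (at \<tau>)"
    and E_x: "\<And>\<tau> x. \<tau> > 0 \<Longrightarrow> (E \<tau> has_vector_derivative Ex \<tau> x) (at x)"
    and E_xx: "\<And>\<tau> x. \<tau> > 0 \<Longrightarrow> (Ex \<tau> has_vector_derivative Exx \<tau> x) (at x)"
    and cont_E: "continuous_on ({0<..} \<times> {-1..1}) (\<lambda>(\<tau>, x). E \<tau> x)"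
    and cont_Et: "continuous_on ({0<..} \<times> {-1..1}) (\<lambda>(\<tau>, x). Et \<tau> x)"
    and cont_Exx: "continuous_on ({0<..} \<times> {-1..1}) (\<lambda>(\<tau>, x). Exx \<tau> x)"
    and boundary: "\<And>\<tau> x. \<tau> > 0 \<Longrightarrow> x \<in> {-1, 1} \<Longrightarrow> E \<tau> x = 0 \<and> Et \<tau> x = 0 \<and> Ex \<tau> x = 0 \<and> Exx \<tau> x = 0"
    and residual: "\<And>\<tau> x. 0 < \<tau> \<Longrightarrow> \<tau> \<le> T \<Longrightarrow> x \<in> {-1..1} \<Longrightarrow>
      norm (Et \<tau> x - Exx \<tau> x - E \<tau> x ** V x) \<le> B"
    and reproduces: "((\<lambda>s. integral {-1..1} (\<lambda>x. E (T - s) x ** v s x)) \<longlongrightarrow> v T 0) (at_left T)"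
  shows "norm (v T 0 - E T 0) \<le> M * B * T"
proof -
  define I where "I s = integral {-1..1} (\<lambda>x. E (T - s) x ** v s x)" for s
  define R where "R \<tau> x = Et \<tau> x - Exx \<tau> x - E \<tau> x ** V x" for \<tau> x
  define J where "J s x = E (T - s) x ** vt s x - Et (T - s) x ** v s x" for s x
  let ?U = "{0<..<T}"
  have B0: "B \<ge> 0" using order_trans[OF norm_ge_zero residual[of T 0]] T by simp
  have cx: "continuous_on {-1..1} (f \<tau>)" if "continuous_on ({0<..} \<times> {-1..1}) (\<lambda>(\<tau>, x). f \<tau> x)" "\<tau> > 0"
    for f :: "real \<Rightarrow> real \<Rightarrow> complex^'r^'r" and \<tau>
  proof -
    have "continuous_on {-1..1} (\<lambda>x. (\<lambda>(\<tau>, x). f \<tau> x) (\<tau>, x))"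
      by (rule continuous_on_compose2[OF that(1)]) (use that in \<open>auto intro!: continuous_intros\<close>)
    then show ?thesis by simp
  qed
  have rev: "continuous_on (?U \<times> {-1..1}) (\<lambda>z. f (T - fst z) (snd z))"
    if "continuous_on ({0<..} \<times> {-1..1}) (\<lambda>(\<tau>, x). f \<tau> x)" for f :: "real \<Rightarrow> real \<Rightarrow> complex^'r^'r"
  proof -
    have "continuous_on (?U \<times> {-1..1}) (\<lambda>z. (\<lambda>(\<tau>, x). f \<tau> x) (T - fst z, snd z))"
      by (rule continuous_on_compose2[OF that]) (auto intro!: continuous_intros)
    then show ?thesis by simp
  qed
  have fwd: "continuous_on (?U \<times> {-1..1}) (\<lambda>z. f (fst z) (snd z))"
    if "continuous_on ({0<..} \<times> UNIV) (\<lambda>(\<tau>, x). f \<tau> x)" for f :: "real \<Rightarrow> real \<Rightarrow> complex^'r^'r"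
    using continuous_on_subset[OF that, of "?U \<times> {-1..1}"] by (force simp: case_prod_unfold)
  have vt_slice: "continuous_on {-1..1} (vt s)" and vxx_slice: "continuous_on {-1..1} (vxx s)" if "s > 0" for s
    using cx[OF continuous_on_subset[OF cont_vt] that] cx[OF continuous_on_subset[OF cont_vxx] that] by auto
  have contR: "continuous_on {-1..1} (R \<tau>)" if "\<tau> > 0" for \<tau>
    unfolding R_def using that
    by (intro continuous_on_diff matmul.continuous_on cx cont_E cont_Et cont_Exx continuous_on_subset[OF cont_V]) auto
  have deriv: "(I has_vector_derivative integral {-1..1} (J s)) (at s within ?U)" if s: "s \<in> ?U" for s
  proof -
    have "((\<lambda>s. integral (cbox (-1) 1) (\<lambda>x. E (T - s) x ** v s x)) has_vector_derivative integral (cbox (-1) 1) (J s)) (at s within ?U)"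
    proof (rule leibniz_rule_vector_derivative[OF _ _ _ s])
      show "convex ?U" by simp
      show "(\<lambda>x. E (T - s) x ** v s x) integrable_on cbox (-1) 1" if "s \<in> ?U" for s
        using that unfolding box_real
        by (intro integrable_continuous_real matmul.continuous_on cx cont_E continuous_slice) auto
      show "continuous_on (?U \<times> cbox (-1) 1) (\<lambda>(s, x). J s x)"
        unfolding J_def case_prod_unfold box_real
        by (intro continuous_on_diff matmul.continuous_on rev fwd cont_E cont_Et cont_v cont_vt)
      fix s x assume s: "s \<in> ?U"
      have "((\<lambda>s. T - s) has_vector_derivative - 1) (at s)"
        by (auto intro!: derivative_eq_intros simp: has_real_derivative_iff_has_vector_derivative[symmetric])
      then have "((\<lambda>s. E (T - s) x) has_vector_derivative (-1) *\<^sub>R Et (T - s) x) (at s)"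
        using vector_diff_chain_at[of "\<lambda>s. T - s" "-1" s "\<lambda>\<tau>. E \<tau> x" "Et (T - s) x"] s E_t[of "T - s" x]
        by (auto simp: o_def)
      then have "((\<lambda>s. E (T - s) x ** v s x) has_vector_derivative (E (T - s) x ** vt s x + (- Et (T - s) x) ** v s x)) (at s)"
        using deriv_t[of s x] s by (intro matmul.has_vector_derivative) auto
      then show "((\<lambda>s. E (T - s) x ** v s x) has_vector_derivative J s x) (at s within ?U)"
        by (simp add: J_def matmul.minus_left has_vector_derivative_at_within)
    qed
    then show ?thesis by (simp add: I_def[abs_def])
  qed
  have J_int: "integral {-1..1} (J s) = - integral {-1..1} (\<lambda>x. R (T - s) x ** v s x)" if s: "s \<in> ?U" for s
  proof -
    let ?\<tau> = "T - s"
    have pos: "s > 0" "?\<tau> > 0" using s by auto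
    have "((\<lambda>x. E ?\<tau> x ** vxx s x - Exx ?\<tau> x ** v s x) has_integral
        ((E ?\<tau> 1 ** vx s 1 - Ex ?\<tau> 1 ** v s 1) - (E ?\<tau> (-1) ** vx s (-1) - Ex ?\<tau> (-1) ** v s (-1)))) {-1..1}"
    proof (rule fundamental_theorem_of_calculus)
      fix x :: real
      have "((\<lambda>x. E ?\<tau> x ** vx s x - Ex ?\<tau> x ** v s x) has_vector_derivative
         ((E ?\<tau> x ** vxx s x + Ex ?\<tau> x ** vx s x) - (Ex ?\<tau> x ** vx s x + Exx ?\<tau> x ** v s x))) (at x)"
        using pos by (intro has_vector_derivative_diff matmul.has_vector_derivative E_x E_xx deriv_x deriv_xx)
      then show "((\<lambda>x. E ?\<tau> x ** vx s x - Ex ?\<tau> x ** v s x) has_vector_derivative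
         (E ?\<tau> x ** vxx s x - Exx ?\<tau> x ** v s x)) (at x within {-1..1})"
        by (simp add: has_vector_derivative_at_within)
    qed simp
    then have green: "((\<lambda>x. E ?\<tau> x ** vxx s x - Exx ?\<tau> x ** v s x) has_integral 0) {-1..1}"
      using boundary[of ?\<tau> 1] boundary[of ?\<tau> "-1"] pos by (simp add: matmul.zero_left)
    have "(\<lambda>x. R ?\<tau> x ** v s x) integrable_on {-1..1}"
      using pos by (intro integrable_continuous_real matmul.continuous_on contR continuous_slice)
    then have "((\<lambda>x. - (R ?\<tau> x ** v s x)) has_integral - integral {-1..1} (\<lambda>x. R ?\<tau> x ** v s x)) {-1..1}"
      by (intro has_integral_neg integrable_integral)
    from has_integral_add[OF green this]
    have "((\<lambda>x. E ?\<tau> x ** vxx s x - Exx ?\<tau> x ** v s x + - (R ?\<tau> x ** v s x)) has_integral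
        - integral {-1..1} (\<lambda>x. R ?\<tau> x ** v s x)) {-1..1}" by simp
    moreover have "E ?\<tau> x ** vxx s x - Exx ?\<tau> x ** v s x + - (R ?\<tau> x ** v s x) = J s x" for x
      unfolding J_def R_def heat_equation[OF pos(1)]
      by (simp add: matmul.diff_left matmul.add_right matrix_mul_assoc)
    ultimately show ?thesis by (simp add: integral_unique)
  qed
  have J_bound: "norm (integral {-1..1} (J s)) \<le> M * B" if s: "s \<in> ?U" for s
  proof -
    have "matrix_weakly_bounded M (v s)" using s T by (intro M) auto
    moreover have "R (T - s) (-1) = 0" "R (T - s) 1 = 0"
      using s boundary[of "T - s" 1] boundary[of "T - s" "-1"] by (auto simp: R_def matmul.zero_left)
    moreover have "\<forall>x\<in>{-1..1}. norm (R (T - s) x) \<le> B"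
      using s residual[of "T - s"] by (auto simp: R_def)
    ultimately show ?thesis
      using s contR[of "T - s"] unfolding J_int[OF s] matrix_weakly_bounded_def by simp
  qed
  have diff: "norm (I s - I r) \<le> M * B * T" if "s \<in> ?U" "r \<in> ?U" for s r
  proof -
    have "norm (I s - I r) \<le> M * B * norm (s - r)"
    proof (rule differentiable_bound[of ?U I "\<lambda>s h. h *\<^sub>R integral {-1..1} (J s)"])
      fix s assume s: "s \<in> ?U"
      show "(I has_derivative (\<lambda>h. h *\<^sub>R integral {-1..1} (J s))) (at s within ?U)"
        using deriv[OF s] by (simp add: has_vector_derivative_def)
      show "onorm (\<lambda>h. h *\<^sub>R integral {-1..1} (J s)) \<le> M * B"
        using J_bound[OF s] by (intro onorm_le) (simp add: mult.commute mult_left_mono)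
    qed (use that in auto)
    also have "\<dots> \<le> M * B * T" using that M B0 by (intro mult_left_mono) auto
    finally show ?thesis .
  qed
  have right_end: "norm (v T 0 - I r) \<le> M * B * T" if r: "r \<in> ?U" for r
  proof (rule Lim_norm_ubound)
    show "((\<lambda>s. I s - I r) \<longlongrightarrow> v T 0 - I r) (at_left T)"
      using reproduces by (intro tendsto_intros) (simp add: I_def[abs_def])
    show "\<forall>\<^sub>F s in at_left T. norm (I s - I r) \<le> M * B * T"
      using eventually_at_left_real[of 0 T] T by (auto elim!: eventually_mono intro!: diff r)
  qed simp
  \<comment> \<open>The test function \<open>E (T - s)\<close> moves with \<open>s\<close>; uniform continuity replaces it by \<open>E T\<close>, and the
    difference is controlled by the uniform bound \<open>M\<close>.\<close>
  have left_end: "(I \<longlongrightarrow> E T 0) (at_right 0)"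
  proof -
    have "((\<lambda>s. integral {-1..1} (\<lambda>x. E T x ** v s x)) \<longlongrightarrow> E T 0) (at_right 0)"
      using T boundary[of T] by (intro initial_matrix cx cont_E) auto
    moreover have "((\<lambda>s. integral {-1..1} (\<lambda>x. (E (T - s) x - E T x) ** v s x)) \<longlongrightarrow> 0) (at_right 0)"
    proof (rule tendstoI)
      fix e :: real assume e: "e > 0"
      let ?K = "{T/2..T} \<times> {-1..1::real}"
      have "uniformly_continuous_on ?K (\<lambda>(\<tau>, x). E \<tau> x)"
        by (intro compact_uniformly_continuous compact_Times continuous_on_subset[OF cont_E]) (use T in auto)
      moreover have "e / (M + 1) > 0" using e M by simp
      ultimately obtain d where d: "d > 0" "\<And>z z'. z \<in> ?K \<Longrightarrow> z' \<in> ?K \<Longrightarrow> dist z' z < d \<Longrightarrow>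
          dist ((\<lambda>(\<tau>, x). E \<tau> x) z') ((\<lambda>(\<tau>, x). E \<tau> x) z) < e / (M + 1)"
        unfolding uniformly_continuous_on_def by blast
      show "\<forall>\<^sub>F s in at_right 0. dist (integral {-1..1} (\<lambda>x. (E (T - s) x - E T x) ** v s x)) 0 < e"
        unfolding eventually_at_right_field
      proof (intro exI[of _ "min d (T/2)"] conjI allI impI)
        show "min d (T/2) > 0" using d T by simp
        fix s assume s: "0 < s" "s < min d (T/2)"
        have "norm (E (T - s) x - E T x) \<le> e / (M + 1)" if "x \<in> {-1..1}" for x
          using d(2)[of "(T, x)" "(T - s, x)"] s T that by (auto simp: dist_norm norm_Pair)
        moreover have "continuous_on {-1..1} (\<lambda>x. E (T - s) x - E T x)"
          using s T by (intro continuous_on_diff cx cont_E) auto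
        ultimately have "norm (integral {-1..1} (\<lambda>x. (E (T - s) x - E T x) ** v s x)) \<le> M * (e / (M + 1))"
          using M(2)[of s, unfolded matrix_weakly_bounded_def, rule_format, of "\<lambda>x. E (T - s) x - E T x" "e / (M + 1)"]
            s T boundary[of T] boundary[of "T - s"] by simp
        also have "\<dots> < e" using e M by (simp add: divide_simps)
        finally show "dist (integral {-1..1} (\<lambda>x. (E (T - s) x - E T x) ** v s x)) 0 < e" by simp
      qed
    qed
    ultimately have lim: "((\<lambda>s. integral {-1..1} (\<lambda>x. E T x ** v s x) + integral {-1..1} (\<lambda>x. (E (T - s) x - E T x) ** v s x))
        \<longlongrightarrow> E T 0 + 0) (at_right 0)" by (rule tendsto_add)
    have "\<forall>\<^sub>F s in at_right 0. integral {-1..1} (\<lambda>x. E T x ** v s x) + integral {-1..1} (\<lambda>x. (E (T - s) x - E T x) ** v s x) = I s"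
      unfolding eventually_at_right_field
    proof (intro exI[of _ T] conjI allI impI T)
      fix s assume s: "0 < s" "s < T"
      have "(\<lambda>x. E T x ** v s x) integrable_on {-1..1}" "(\<lambda>x. (E (T - s) x - E T x) ** v s x) integrable_on {-1..1}"
        using s T cx[OF cont_E, of T] cx[OF cont_E, of "T - s"]
        by (auto intro!: integrable_continuous_real matmul.continuous_on continuous_on_diff continuous_slice)
      from Henstock_Kurzweil_Integration.integral_add[OF this, symmetric]
      show "integral {-1..1} (\<lambda>x. E T x ** v s x) + integral {-1..1} (\<lambda>x. (E (T - s) x - E T x) ** v s x) = I s"
        by (simp add: I_def matmul.diff_left)
    qed
    with lim show ?thesis by (auto intro: Lim_transform_eventually)
  qed
  show ?thesis
  proof (rule Lim_norm_ubound)
    show "((\<lambda>r. v T 0 - I r) \<longlongrightarrow> v T 0 - E T 0) (at_right 0)"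
      by (intro tendsto_intros left_end)
    show "\<forall>\<^sub>F r in at_right 0. norm (v T 0 - I r) \<le> M * B * T"
      using eventually_at_right_real[of 0 T] T by (auto elim!: eventually_mono intro!: right_end)
  qed simp
qed

end

section \<open>The truncated heat series\<close>

text \<open>
  The region of summation \<open>2k + i \<le> 2K + 1\<close> is a parabolic ball: it respects the weights \<open>2\<close> of \<open>\<tau>\<close> and
  \<open>1\<close> of \<open>x\<close>, so that the heat operator maps the truncation of a formal solution to a truncation.
\<close>

definition truncated_series :: "nat \<Rightarrow> (nat \<Rightarrow> nat \<Rightarrow> real) \<Rightarrow> (nat \<Rightarrow> nat \<Rightarrow> complex^'r^'r) \<Rightarrow> complex^'r^'r" where
  "truncated_series K c a = (\<Sum>k\<le>K. \<Sum>i\<le>2 * K + 1 - 2 * k. c k i *\<^sub>R a k i)"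

lemma truncated_series_has_vector_derivative:
  assumes "\<And>k i. ((\<lambda>s. c s k i) has_real_derivative c' k i) (at s within S)"
  shows "((\<lambda>s. truncated_series K (c s) a) has_vector_derivative truncated_series K c' a) (at s within S)"
proof -
  have "((\<lambda>s. c s k i *\<^sub>R a k i) has_vector_derivative c' k i *\<^sub>R a k i) (at s within S)" for k i
    using has_vector_derivative_scaleR[OF assms has_vector_derivative_const] by simp
  then show ?thesis
    unfolding truncated_series_def by (intro has_vector_derivative_sum)
qed

lemma continuous_on_truncated_series:
  assumes "\<And>k i. continuous_on A (\<lambda>z. c z k i)"
  shows "continuous_on A (\<lambda>z. truncated_series K (c z) a)"
  unfolding truncated_series_def by (intro continuous_intros assms)

lemma norm_truncated_series_le:
  assumes "\<And>k i. \<bar>c k i\<bar> \<le> b k i"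
  shows "norm (truncated_series K c a) \<le> (\<Sum>k\<le>K. \<Sum>i\<le>2 * K + 1 - 2 * k. b k i * norm (a k i))"
  unfolding truncated_series_def
  by (intro sum_norm_le) (simp add: assms mult_right_mono)

text \<open>
  After division by the Gaussian the heat operator becomes \<open>\<partial>\<^sub>\<tau> + (x/\<tau>) \<partial>\<^sub>x - \<partial>\<^sub>x\<^sup>2\<close>. On the truncated
  series it leaves exactly the potential terms of weight at most \<open>2K - 1\<close>, by the recursion for the
  coefficients.
\<close>

lemma truncated_series_heat_operator:
  fixes u :: "nat \<Rightarrow> complex^'r^'r"
  assumes "\<tau> \<noteq> 0"
  shows "truncated_series K (\<lambda>k i. real k * \<tau> ^ (k - 1) * x ^ i) (heat_coeff u)
      + (x / \<tau>) *\<^sub>R truncated_series K (\<lambda>k i. \<tau> ^ k * (real i * x ^ (i - 1))) (heat_coeff u)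
      - truncated_series K (\<lambda>k i. \<tau> ^ k * (real i * (real (i - 1) * x ^ (i - 1 - 1)))) (heat_coeff u)
    = (\<Sum>k<K. \<Sum>m<2 * (K - k). (\<tau> ^ k * x ^ m) *\<^sub>R (\<Sum>i\<le>m. heat_coeff u k i ** u (m - i)))"
proof -
  let ?a = "heat_coeff u"
  have idx: "{..2 * K + 1 - 2 * Suc k} = {..<2 * (K - k)}" if "k < K" for k using that by auto
  have first: "truncated_series K (\<lambda>k i. real k * \<tau> ^ (k - 1) * x ^ i) ?a
      + (x / \<tau>) *\<^sub>R truncated_series K (\<lambda>k i. \<tau> ^ k * (real i * x ^ (i - 1))) ?a
    = (\<Sum>k<K. \<Sum>m<2 * (K - k). (\<tau> ^ k * x ^ m) *\<^sub>R (real (Suc k + m) *\<^sub>R ?a (Suc k) m))"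
  proof -
    have c: "real k * \<tau> ^ (k - 1) * x ^ i + x / \<tau> * (\<tau> ^ k * (real i * x ^ (i - 1))) = real (k + i) * (\<tau> ^ k / \<tau>) * x ^ i" for k i
      using assms by (cases k; cases i) (auto simp: field_simps)
    have "truncated_series K (\<lambda>k i. real k * \<tau> ^ (k - 1) * x ^ i) ?a
      + (x / \<tau>) *\<^sub>R truncated_series K (\<lambda>k i. \<tau> ^ k * (real i * x ^ (i - 1))) ?a =
      (\<Sum>k\<le>K. \<Sum>i\<le>2 * K + 1 - 2 * k. (real (k + i) * (\<tau> ^ k / \<tau>) * x ^ i) *\<^sub>R ?a k i)"
      unfolding truncated_series_def scaleR_sum_right sum.distrib[symmetric] scaleR_scaleR scaleR_left_distrib[symmetric] c ..
    also have "\<dots> = (\<Sum>i\<le>2 * K + 1. (real i / \<tau> * x ^ i) *\<^sub>R ?a 0 i) +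
       (\<Sum>k<K. \<Sum>i\<le>2 * K + 1 - 2 * Suc k. (real (Suc k + i) * (\<tau> ^ Suc k / \<tau>) * x ^ i) *\<^sub>R ?a (Suc k) i)"
      unfolding sum.atMost_shift by simp
    also have "(\<Sum>i\<le>2 * K + 1. (real i / \<tau> * x ^ i) *\<^sub>R ?a 0 i) = 0"
      by (rule sum.neutral) (auto simp: heat_coeff.simps)
    also have "(\<Sum>k<K. \<Sum>i\<le>2 * K + 1 - 2 * Suc k. (real (Suc k + i) * (\<tau> ^ Suc k / \<tau>) * x ^ i) *\<^sub>R ?a (Suc k) i)
      = (\<Sum>k<K. \<Sum>m<2 * (K - k). (\<tau> ^ k * x ^ m) *\<^sub>R (real (Suc k + m) *\<^sub>R ?a (Suc k) m))"
      using assms by (intro sum.cong idx) (auto simp: mult_ac)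
    finally show ?thesis by simp
  qed
  have second: "truncated_series K (\<lambda>k i. \<tau> ^ k * (real i * (real (i - 1) * x ^ (i - 1 - 1)))) ?a
    = (\<Sum>k<K. \<Sum>m<2 * (K - k). (\<tau> ^ k * x ^ m) *\<^sub>R (real ((m + 2) * (m + 1)) *\<^sub>R ?a k (m + 2)))"
  proof -
    define g where "g k i = (\<tau> ^ k * (real i * (real (i - 1) * x ^ (i - 1 - 1)))) *\<^sub>R ?a k i" for k i
    have "truncated_series K (\<lambda>k i. \<tau> ^ k * (real i * (real (i - 1) * x ^ (i - 1 - 1)))) ?a
       = (\<Sum>k<K. \<Sum>i\<le>2 * K + 1 - 2 * k. g k i) + (\<Sum>i\<le>1. g K i)"
      unfolding truncated_series_def g_def[symmetric] by (simp flip: lessThan_Suc_atMost)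
    also have "(\<Sum>i\<le>1. g K i) = 0" by (simp add: g_def)
    also have "(\<Sum>k<K. \<Sum>i\<le>2 * K + 1 - 2 * k. g k i) = (\<Sum>k<K. \<Sum>m<2 * (K - k). g k (m + 2))"
    proof (rule sum.cong[OF refl])
      fix k assume "k \<in> {..<K}"
      then have k: "k < K" by simp
      then have "2 * K + 1 - 2 * k = (2 * K + 1 - 2 * Suc k) + 2" by simp
      then show "(\<Sum>i\<le>2 * K + 1 - 2 * k. g k i) = (\<Sum>m<2 * (K - k). g k (m + 2))"
        using sum_atMost_add2_eq[of "g k" "2 * K + 1 - 2 * Suc k"] idx[OF k] by (simp only:) (simp add: g_def)
    qed
    also have "\<dots> = (\<Sum>k<K. \<Sum>m<2 * (K - k). (\<tau> ^ k * x ^ m) *\<^sub>R (real ((m + 2) * (m + 1)) *\<^sub>R ?a k (m + 2)))"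
      by (intro sum.cong refl) (auto simp: g_def algebra_simps)
    finally show ?thesis by simp
  qed
  show ?thesis
    unfolding first second sum_subtractf[symmetric] scaleR_diff_right[symmetric] heat_coeff_recursion by simp
qed

text \<open>
  The only error is the Taylor remainder of the potential, taken for each coefficient at the order that
  completes the weight \<open>2K\<close>. The natural-number subtraction in \<open>2 * (K - k) - i\<close> truncates only
  when no potential term is left, in which case the remainder is \<open>W\<close> itself.
\<close>

lemma truncated_series_residual:
  fixes u :: "nat \<Rightarrow> complex^'r^'r"
  assumes "\<tau> \<noteq> 0"
  shows "truncated_series K (\<lambda>k i. real k * \<tau> ^ (k - 1) * x ^ i) (heat_coeff u)
      + (x / \<tau>) *\<^sub>R truncated_series K (\<lambda>k i. \<tau> ^ k * (real i * x ^ (i - 1))) (heat_coeff u)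
      - truncated_series K (\<lambda>k i. \<tau> ^ k * (real i * (real (i - 1) * x ^ (i - 1 - 1)))) (heat_coeff u)
      - truncated_series K (\<lambda>k i. \<tau> ^ k * x ^ i) (heat_coeff u) ** W
    = - truncated_series K (\<lambda>k i. \<tau> ^ k * x ^ i)
          (\<lambda>k i. heat_coeff u k i ** (W - (\<Sum>l<2 * (K - k) - i. x ^ l *\<^sub>R u l)))"
proof -
  let ?a = "heat_coeff u"
  have conv: "(\<Sum>i\<le>n + 1. x ^ i *\<^sub>R (?a k i ** (\<Sum>l<n - i. x ^ l *\<^sub>R u l))) =
     (\<Sum>m<n. x ^ m *\<^sub>R (\<Sum>i\<le>m. ?a k i ** u (m - i)))" for n k
  proof -
    have "(\<Sum>i\<le>n + 1. x ^ i *\<^sub>R (?a k i ** (\<Sum>l<n - i. x ^ l *\<^sub>R u l))) =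
       (\<Sum>i<n. \<Sum>l<n - i. x ^ (i + l) *\<^sub>R (?a k i ** u l))"
      by (rule sum.mono_neutral_cong_right)
         (auto simp: matmul.sum_right matmul.scaleR_right matmul.zero_right scaleR_sum_right power_add)
    also have "\<dots> = (\<Sum>(i, l)\<in>{(i, l). i + l < n}. x ^ (i + l) *\<^sub>R (?a k i ** u l))"
      by (subst sum.Sigma) (auto intro!: sum.cong)
    also have "\<dots> = (\<Sum>m<n. \<Sum>i\<le>m. x ^ (i + (m - i)) *\<^sub>R (?a k i ** u (m - i)))"
      by (rule sum.triangle_reindex)
    finally show ?thesis by (simp add: scaleR_sum_right)
  qed
  have "truncated_series K (\<lambda>k i. \<tau> ^ k * x ^ i) (\<lambda>k i. ?a k i ** (\<Sum>l<2 * (K - k) - i. x ^ l *\<^sub>R u l))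
     = (\<Sum>k\<le>K. \<tau> ^ k *\<^sub>R (\<Sum>m<2 * (K - k). x ^ m *\<^sub>R (\<Sum>i\<le>m. ?a k i ** u (m - i))))"
    unfolding truncated_series_def conv[symmetric]
  proof (intro sum.cong refl)
    fix k assume "k \<in> {..K}"
    then have "2 * K + 1 - 2 * k = 2 * (K - k) + 1" by auto
    then show "(\<Sum>i\<le>2 * K + 1 - 2 * k. (\<tau> ^ k * x ^ i) *\<^sub>R (?a k i ** (\<Sum>l<2 * (K - k) - i. x ^ l *\<^sub>R u l))) =
         \<tau> ^ k *\<^sub>R (\<Sum>i\<le>2 * (K - k) + 1. x ^ i *\<^sub>R (?a k i ** (\<Sum>l<2 * (K - k) - i. x ^ l *\<^sub>R u l)))"
      by (simp add: scaleR_sum_right)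
  qed
  also have "\<dots> = (\<Sum>k<K. \<Sum>m<2 * (K - k). (\<tau> ^ k * x ^ m) *\<^sub>R (\<Sum>i\<le>m. ?a k i ** u (m - i)))"
    by (simp add: scaleR_sum_right flip: lessThan_Suc_atMost)
  finally show ?thesis
    unfolding truncated_series_heat_operator[OF assms]
    by (simp add: truncated_series_def matmul.diff_right scaleR_diff_right sum_subtractf matmul.sum_left matmul.scaleR_left)
qed

section \<open>Orders of smallness against the Gaussian\<close>

text \<open>
  The product of the Gaussian with \<open>R\<close> is \<open>O(\<tau>\<^sup>N)\<close> uniformly on \<open>[-1, 1]\<close>.
\<close>

definition heat_small :: "nat \<Rightarrow> (real \<Rightarrow> real \<Rightarrow> 'a::real_normed_vector) \<Rightarrow> bool" where
  "heat_small N R \<longleftrightarrow> (\<exists>C. \<forall>\<tau>\<in>{0<..1}. \<forall>x\<in>{-1..1}. gauss \<tau> x * norm (R \<tau> x) \<le> C * \<tau> ^ N)"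

lemma heat_small_mono:
  assumes "heat_small N S" "\<And>\<tau> x. \<tau> \<in> {0<..1} \<Longrightarrow> x \<in> {-1..1} \<Longrightarrow> norm (R \<tau> x) \<le> C * norm (S \<tau> x)" "C \<ge> 0"
  shows "heat_small N R"
proof -
  obtain D where D: "\<And>\<tau> x. \<tau> \<in> {0<..1} \<Longrightarrow> x \<in> {-1..1} \<Longrightarrow> gauss \<tau> x * norm (S \<tau> x) \<le> D * \<tau> ^ N"
    using assms(1) unfolding heat_small_def by blast
  have "gauss \<tau> x * norm (R \<tau> x) \<le> C * D * \<tau> ^ N" if "\<tau> \<in> {0<..1}" "x \<in> {-1..1}" for \<tau> x
  proof -
    have "gauss \<tau> x * norm (R \<tau> x) \<le> gauss \<tau> x * (C * norm (S \<tau> x))"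
      using assms(2)[OF that] gauss_pos[of \<tau> x] that by (intro mult_left_mono) auto
    also have "\<dots> \<le> C * (D * \<tau> ^ N)"
      using mult_left_mono[OF D[OF that] assms(3)] by (simp add: mult_ac)
    finally show ?thesis by (simp add: mult_ac)
  qed
  then show ?thesis unfolding heat_small_def by blast
qed

lemma heat_small_add:
  assumes "heat_small N R" "heat_small N S"
  shows "heat_small N (\<lambda>\<tau> x. R \<tau> x + S \<tau> x)"
proof -
  obtain C D where C: "\<And>\<tau> x. \<tau> \<in> {0<..1} \<Longrightarrow> x \<in> {-1..1} \<Longrightarrow> gauss \<tau> x * norm (R \<tau> x) \<le> C * \<tau> ^ N"
    and D: "\<And>\<tau> x. \<tau> \<in> {0<..1} \<Longrightarrow> x \<in> {-1..1} \<Longrightarrow> gauss \<tau> x * norm (S \<tau> x) \<le> D * \<tau> ^ N"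
    using assms unfolding heat_small_def by metis
  have "gauss \<tau> x * norm (R \<tau> x + S \<tau> x) \<le> (C + D) * \<tau> ^ N" if "\<tau> \<in> {0<..1}" "x \<in> {-1..1}" for \<tau> x
  proof -
    have "gauss \<tau> x * norm (R \<tau> x + S \<tau> x) \<le> gauss \<tau> x * (norm (R \<tau> x) + norm (S \<tau> x))"
      using gauss_pos[of \<tau> x] that by (intro mult_left_mono norm_triangle_ineq) auto
    also have "\<dots> \<le> (C + D) * \<tau> ^ N"
      using C[OF that] D[OF that] by (simp add: algebra_simps)
    finally show ?thesis .
  qed
  then show ?thesis unfolding heat_small_def by blast
qed

lemma heat_small_sum:
  assumes "finite I" "\<And>i. i \<in> I \<Longrightarrow> heat_small N (R i)"
  shows "heat_small N (\<lambda>\<tau> x. \<Sum>i\<in>I. R i \<tau> x)"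
  using assms
proof (induction I rule: finite_induct)
  case empty
  then show ?case unfolding heat_small_def by (auto intro!: exI[of _ 0])
next
  case (insert i I)
  then show ?case using heat_small_add[of N "R i"] by simp
qed

lemma heat_small_power:
  assumes "k + q = Suc N"
  shows "heat_small N (\<lambda>\<tau> x. \<tau> ^ k * x ^ (2 * q))"
proof -
  have "gauss \<tau> x * norm (\<tau> ^ k * x ^ (2 * q)) \<le> (fact q * 4 ^ q) * \<tau> ^ N" if "\<tau> \<in> {0<..1}" for \<tau> x :: real
  proof -
    have e: "\<tau> ^ k * (\<tau> ^ q / \<tau>) = \<tau> ^ N"
      using that assms by (simp add: power_add[symmetric])
    have "gauss \<tau> x * norm (\<tau> ^ k * x ^ (2 * q)) = \<tau> ^ k * (gauss \<tau> x * x ^ (2 * q))"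
      using that by (simp add: abs_mult power_even_abs)
    also have "\<dots> \<le> \<tau> ^ k * (fact q * 4 ^ q * (\<tau> ^ q / \<tau>))"
      using that by (intro mult_left_mono gauss_power_bound) auto
    also have "\<dots> = (fact q * 4 ^ q) * \<tau> ^ N" unfolding e[symmetric] by simp
    finally show ?thesis .
  qed
  then show ?thesis unfolding heat_small_def by blast
qed

text \<open>
  The commutator of the cutoff with \<open>(x/\<tau>) \<partial>\<^sub>x\<close> carries a factor \<open>1 / \<tau>\<close>, which costs one more power of
  \<open>x\<^sup>2\<close>.
\<close>

lemma heat_small_power_over_time: "heat_small N (\<lambda>\<tau> x. x ^ (2 * (N + 2)) / \<tau>)"
proof -
  have "gauss \<tau> x * norm (x ^ (2 * (N + 2)) / \<tau>) \<le> (fact (N + 2) * 4 ^ (N + 2)) * \<tau> ^ N" if "\<tau> \<in> {0<..1}" for \<tau> x :: real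
  proof -
    have e: "\<tau> ^ (N + 2) / \<tau> / \<tau> = \<tau> ^ N" using that by simp
    have "\<bar>x ^ (2 * (N + 2))\<bar> = x ^ (2 * (N + 2))" by (rule abs_of_nonneg, rule zero_le_even_power) simp
    then have "gauss \<tau> x * norm (x ^ (2 * (N + 2)) / \<tau>) = gauss \<tau> x * x ^ (2 * (N + 2)) / \<tau>"
      using that by (simp only: real_norm_def abs_divide) simp
    also have "\<dots> \<le> fact (N + 2) * 4 ^ (N + 2) * (\<tau> ^ (N + 2) / \<tau>) / \<tau>"
      using that by (intro divide_right_mono gauss_power_bound) auto
    also have "\<dots> = (fact (N + 2) * 4 ^ (N + 2)) * \<tau> ^ N" unfolding e[symmetric] by simp
    finally show ?thesis .
  qed
  then show ?thesis unfolding heat_small_def by blast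
qed

section \<open>Taylor remainders and the cutoff\<close>

text \<open>
  The remainder of order \<open>L + 1\<close> of \<open>D k\<close> is an antiderivative of the remainder of order \<open>L\<close> of
  \<open>D (k + 1)\<close> that vanishes at \<open>0\<close>. Stating the bound for all derivatives at once makes the induction go
  through without an explicit remainder formula.
\<close>

lemma taylor_remainder_bound:
  fixes D :: "nat \<Rightarrow> real \<Rightarrow> 'a::real_normed_vector"
  assumes "\<And>k x. (D k has_vector_derivative D (Suc k) x) (at x)"
  shows "\<exists>B\<ge>0. \<forall>x\<in>{-1..1}. norm (D k x - (\<Sum>l<L. (x ^ l / fact l) *\<^sub>R D (k + l) 0)) \<le> B * \<bar>x\<bar> ^ L"
proof (induction L arbitrary: k)
  case 0
  have "continuous_on {-1..1} (D k)"
    using assms by (meson has_vector_derivative_continuous continuous_at_imp_continuous_on)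
  then have "bounded (D k ` {-1..1})" by (intro compact_imp_bounded compact_continuous_image) auto
  then obtain B where "\<forall>y\<in>D k ` {-1..1}. norm y \<le> B" unfolding bounded_iff by blast
  then have "\<forall>x\<in>{-1..1}. norm (D k x) \<le> max 0 B" by (auto simp: le_max_iff_disj)
  then show ?case by (intro exI[of _ "max 0 B"]) auto
next
  case (Suc L)
  from Suc.IH[of "Suc k"] obtain B where B: "B \<ge> 0"
    "\<And>x. x \<in> {-1..1} \<Longrightarrow> norm (D (Suc k) x - (\<Sum>l<L. (x ^ l / fact l) *\<^sub>R D (Suc k + l) 0)) \<le> B * \<bar>x\<bar> ^ L" by blast
  define R where "R x = D k x - (\<Sum>l<Suc L. (x ^ l / fact l) *\<^sub>R D (k + l) 0)" for x
  define R' where "R' x = D (Suc k) x - (\<Sum>l<L. (x ^ l / fact l) *\<^sub>R D (Suc k + l) 0)" for x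
  have "(R has_vector_derivative R' x) (at x)" for x
  proof -
    have "((\<lambda>x. (x ^ Suc l / fact (Suc l)) *\<^sub>R D (k + Suc l) 0) has_vector_derivative (x ^ l / fact l) *\<^sub>R D (Suc k + l) 0) (at x)" for l
    proof -
      have "((\<lambda>x::real. x ^ Suc l / fact (Suc l)) has_real_derivative x ^ l / fact l) (at x)"
        using DERIV_cdivide[OF DERIV_pow[of "Suc l" x], of "fact (Suc l)"] by (simp add: divide_simps)
      from has_vector_derivative_scaleR[OF this has_vector_derivative_const] show ?thesis by simp
    qed
    then have "((\<lambda>x. D k x - (D k 0 + (\<Sum>l<L. (x ^ Suc l / fact (Suc l)) *\<^sub>R D (k + Suc l) 0))) has_vector_derivative
      D (Suc k) x - (0 + (\<Sum>l<L. (x ^ l / fact l) *\<^sub>R D (Suc k + l) 0))) (at x)"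
      by (intro has_vector_derivative_diff has_vector_derivative_add has_vector_derivative_sum
          has_vector_derivative_const assms)
    then show ?thesis by (simp add: R_def[abs_def] R'_def sum.lessThan_Suc_shift del: sum.lessThan_Suc)
  qed
  note R_deriv = this
  have "norm (R x) \<le> B * \<bar>x\<bar> ^ Suc L" if x: "x \<in> {-1..1}" for x
  proof -
    have sub: "\<bar>z\<bar> \<le> \<bar>x\<bar>" if "z \<in> closed_segment 0 x" for z
      using that by (auto simp: closed_segment_eq_real_ivl split: if_splits)
    have "norm (R x - R 0) \<le> B * \<bar>x\<bar> ^ L * norm (x - 0)"
    proof (rule differentiable_bound[of "closed_segment 0 x" R "\<lambda>z h. h *\<^sub>R R' z"])
      fix z assume z: "z \<in> closed_segment 0 x"
      show "(R has_derivative (\<lambda>h. h *\<^sub>R R' z)) (at z within closed_segment 0 x)"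
        using has_vector_derivative_at_within[OF R_deriv] by (simp add: has_vector_derivative_def)
      have "norm (R' z) \<le> B * \<bar>z\<bar> ^ L" using sub[OF z] x unfolding R'_def by (intro B(2)) auto
      also have "\<dots> \<le> B * \<bar>x\<bar> ^ L" using sub[OF z] B(1) by (intro mult_left_mono power_mono) auto
      finally show "onorm (\<lambda>h. h *\<^sub>R R' z) \<le> B * \<bar>x\<bar> ^ L"
        by (intro onorm_le) (simp add: mult.commute mult_left_mono)
    qed auto
    moreover have "R 0 = 0" unfolding R_def sum.lessThan_Suc_shift by simp
    ultimately show ?thesis by (simp add: mult_ac)
  qed
  with B(1) show ?case unfolding R_def by blast
qed

context
  fixes K :: nat
begin

text \<open>
  Instead of being constant near \<open>0\<close>, the cutoff is flat there to order \<open>2K + 2\<close>, so its derivatives are as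
  small against the Gaussian as the other errors; at the end points of \<open>[-1, 1]\<close> it vanishes to third
  order, so that it and its first two derivatives vanish there. Being a polynomial, it needs no case
  distinction.
\<close>

definition cutoff :: "real \<Rightarrow> real" where
  "cutoff x = (1 - x ^ (2 * K + 2)) ^ 3"

definition cutoff_deriv :: "real \<Rightarrow> real" where
  "cutoff_deriv x = - (3 * real (2 * K + 2) * x ^ (2 * K + 1) * (1 - x ^ (2 * K + 2)) ^ 2)"

definition cutoff_deriv2 :: "real \<Rightarrow> real" where
  "cutoff_deriv2 x = 6 * (real (2 * K + 2))\<^sup>2 * (x ^ (2 * K + 1))\<^sup>2 * (1 - x ^ (2 * K + 2))
     - 3 * real (2 * K + 2) * (real (2 * K + 1) * x ^ (2 * K)) * (1 - x ^ (2 * K + 2)) ^ 2"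

lemma cutoff_has_derivative: "(cutoff has_real_derivative cutoff_deriv x) (at x within S)"
  unfolding cutoff_def[abs_def] cutoff_deriv_def
  by (rule derivative_eq_intros refl | simp add: algebra_simps)+

lemma cutoff_deriv_has_derivative: "(cutoff_deriv has_real_derivative cutoff_deriv2 x) (at x within S)"
proof -
  have p: "((\<lambda>x. x ^ (2 * K + 1)) has_real_derivative real (2 * K + 1) * x ^ (2 * K)) (at x within S)"
    using DERIV_pow[of "2 * K + 1" x S] by simp
  have q: "((\<lambda>x. 1 - x ^ (2 * K + 2)) has_real_derivative - (real (2 * K + 2) * x ^ (2 * K + 1))) (at x within S)"
    using DERIV_diff[OF DERIV_const DERIV_pow[of "2 * K + 2" x S]] by simp
  show ?thesis
    unfolding cutoff_deriv_def[abs_def] cutoff_deriv2_def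
    by (rule derivative_eq_intros p q refl)+ (simp add: algebra_simps power2_eq_square)
qed

lemma cutoff_boundary:
  assumes "x \<in> {-1, 1}"
  shows "cutoff x = 0" "cutoff_deriv x = 0" "cutoff_deriv2 x = 0"
proof -
  have "x ^ (2 * K + 2) = 1" using assms by auto
  then show "cutoff x = 0" "cutoff_deriv x = 0" "cutoff_deriv2 x = 0"
    unfolding cutoff_def cutoff_deriv_def cutoff_deriv2_def by simp_all
qed

lemma cutoff_0: "cutoff 0 = 1"
  by (simp add: cutoff_def)

lemma cutoff_bounds:
  assumes "x \<in> {-1..1}"
  shows "\<bar>cutoff x\<bar> \<le> 1"
    and "\<bar>cutoff_deriv x\<bar> \<le> 3 * real (2 * K + 2) * \<bar>x\<bar> ^ (2 * K + 1)"
    and "\<bar>cutoff_deriv2 x\<bar> \<le> 9 * (real (2 * K + 2))\<^sup>2 * x ^ (2 * K)"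
proof -
  define c where "c = real (2 * K + 2)"
  define w where "w = 1 - x ^ (2 * K + 2)"
  have ax: "\<bar>x\<bar> \<le> 1" using assms by auto
  have "x ^ (2 * K + 2) \<ge> 0" by (rule zero_le_even_power) simp
  moreover have "x ^ (2 * K + 2) \<le> 1"
    using power_le_one[of "\<bar>x\<bar>" "2 * K + 2"] ax by (simp add: power_even_abs)
  ultimately have w: "0 \<le> w" "w \<le> 1" by (auto simp: w_def)
  have xK: "x ^ (2 * K) \<ge> 0" by (rule zero_le_even_power) simp
  show "\<bar>cutoff x\<bar> \<le> 1" using w by (simp only: cutoff_def w_def[symmetric]) (simp add: power_le_one)
  have "\<bar>cutoff_deriv x\<bar> = 3 * c * \<bar>x\<bar> ^ (2 * K + 1) * w\<^sup>2"
    by (simp only: cutoff_deriv_def w_def[symmetric] c_def[symmetric])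
       (simp add: abs_mult power_abs c_def)
  also have "\<dots> \<le> 3 * c * \<bar>x\<bar> ^ (2 * K + 1) * 1"
    using w by (intro mult_left_mono power_le_one) (auto simp: c_def)
  finally show "\<bar>cutoff_deriv x\<bar> \<le> 3 * real (2 * K + 2) * \<bar>x\<bar> ^ (2 * K + 1)" by (simp add: c_def)
  have sq: "(x ^ (2 * K + 1))\<^sup>2 \<le> x ^ (2 * K)"
  proof -
    have "(x ^ (2 * K + 1))\<^sup>2 = \<bar>x\<bar> ^ (4 * K + 2)"
      by (simp add: power_mult[symmetric] power_even_abs algebra_simps flip: power_mult power_add)
    also have "\<dots> \<le> \<bar>x\<bar> ^ (2 * K)" using ax by (intro power_decreasing) auto
    finally show ?thesis by (simp add: power_even_abs)
  qed
  have "\<bar>6 * c\<^sup>2 * (x ^ (2 * K + 1))\<^sup>2 * w\<bar> \<le> 6 * c\<^sup>2 * x ^ (2 * K)"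
  proof -
    have "\<bar>6 * c\<^sup>2 * (x ^ (2 * K + 1))\<^sup>2 * w\<bar> = 6 * c\<^sup>2 * ((x ^ (2 * K + 1))\<^sup>2 * w)"
      using w by (simp add: abs_mult)
    also have "\<dots> \<le> 6 * c\<^sup>2 * (x ^ (2 * K) * 1)"
      using w sq xK by (intro mult_left_mono mult_mono) auto
    finally show ?thesis by simp
  qed
  moreover have "\<bar>3 * c * (real (2 * K + 1) * x ^ (2 * K)) * w\<^sup>2\<bar> \<le> 3 * c\<^sup>2 * x ^ (2 * K)"
  proof -
    have "\<bar>3 * c * (real (2 * K + 1) * x ^ (2 * K)) * w\<^sup>2\<bar> = 3 * c * ((real (2 * K + 1) * x ^ (2 * K)) * w\<^sup>2)"
      using xK by (simp add: abs_mult c_def)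
    also have "\<dots> \<le> 3 * c * ((c * x ^ (2 * K)) * 1)"
      using w xK by (intro mult_left_mono mult_mono power_le_one) (auto simp: c_def)
    finally show ?thesis by (simp add: power2_eq_square mult_ac)
  qed
  ultimately have "\<bar>6 * c\<^sup>2 * (x ^ (2 * K + 1))\<^sup>2 * w - 3 * c * (real (2 * K + 1) * x ^ (2 * K)) * w\<^sup>2\<bar> \<le> 9 * c\<^sup>2 * x ^ (2 * K)"
    by linarith
  then show "\<bar>cutoff_deriv2 x\<bar> \<le> 9 * (real (2 * K + 2))\<^sup>2 * x ^ (2 * K)"
    by (simp only: cutoff_deriv2_def w_def c_def)
qed

end

section \<open>The expansion on the diagonal\<close>

lemma gauss_times_derivatives:
  fixes Q Qt Qx Qxx :: "real \<Rightarrow> real \<Rightarrow> 'a::real_normed_vector"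
  assumes "\<tau> > 0"
  shows "((\<lambda>\<tau>. Q \<tau> x) has_vector_derivative Qt \<tau> x) (at \<tau>) \<Longrightarrow>
      ((\<lambda>\<tau>. gauss \<tau> x *\<^sub>R Q \<tau> x) has_vector_derivative
        gauss \<tau> x *\<^sub>R (Qt \<tau> x + (x\<^sup>2 / (4 * \<tau>\<^sup>2) - 1 / (2 * \<tau>)) *\<^sub>R Q \<tau> x)) (at \<tau>)"
    and "(Q \<tau> has_vector_derivative Qx \<tau> x) (at x) \<Longrightarrow>
      ((\<lambda>x. gauss \<tau> x *\<^sub>R Q \<tau> x) has_vector_derivative
        gauss \<tau> x *\<^sub>R (Qx \<tau> x - (x / (2 * \<tau>)) *\<^sub>R Q \<tau> x)) (at x)"
    and "(Q \<tau> has_vector_derivative Qx \<tau> x) (at x) \<Longrightarrow> (Qx \<tau> has_vector_derivative Qxx \<tau> x) (at x) \<Longrightarrow>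
      ((\<lambda>x. gauss \<tau> x *\<^sub>R (Qx \<tau> x - (x / (2 * \<tau>)) *\<^sub>R Q \<tau> x)) has_vector_derivative
        gauss \<tau> x *\<^sub>R (Qxx \<tau> x - (x / \<tau>) *\<^sub>R Qx \<tau> x + (x\<^sup>2 / (4 * \<tau>\<^sup>2) - 1 / (2 * \<tau>)) *\<^sub>R Q \<tau> x)) (at x)"
proof -
  assume Qt: "((\<lambda>\<tau>. Q \<tau> x) has_vector_derivative Qt \<tau> x) (at \<tau>)"
  from has_vector_derivative_scaleR[OF gauss_derivative_time[OF assms] Qt]
  show "((\<lambda>\<tau>. gauss \<tau> x *\<^sub>R Q \<tau> x) has_vector_derivative
        gauss \<tau> x *\<^sub>R (Qt \<tau> x + (x\<^sup>2 / (4 * \<tau>\<^sup>2) - 1 / (2 * \<tau>)) *\<^sub>R Q \<tau> x)) (at \<tau>)"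
    by (simp add: scaleR_right_distrib mult.commute)
next
  assume Qx: "(Q \<tau> has_vector_derivative Qx \<tau> x) (at x)"
  from has_vector_derivative_scaleR[OF gauss_derivative_space[OF assms] Qx]
  show "((\<lambda>x. gauss \<tau> x *\<^sub>R Q \<tau> x) has_vector_derivative
        gauss \<tau> x *\<^sub>R (Qx \<tau> x - (x / (2 * \<tau>)) *\<^sub>R Q \<tau> x)) (at x)"
    by (simp add: scaleR_diff_right mult.commute)
next
  assume Qx: "(Q \<tau> has_vector_derivative Qx \<tau> x) (at x)" and Qxx: "(Qx \<tau> has_vector_derivative Qxx \<tau> x) (at x)"
  have "((\<lambda>x. x / (2 * \<tau>)) has_real_derivative 1 / (2 * \<tau>)) (at x)"
    using assms by (auto intro!: derivative_eq_intros)
  from has_vector_derivative_scaleR[OF gauss_derivative_space[OF assms]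
      has_vector_derivative_diff[OF Qxx has_vector_derivative_scaleR[OF this Qx]]]
  have "((\<lambda>x. gauss \<tau> x *\<^sub>R (Qx \<tau> x - (x / (2 * \<tau>)) *\<^sub>R Q \<tau> x)) has_vector_derivative
      gauss \<tau> x *\<^sub>R (Qxx \<tau> x - ((x / (2 * \<tau>)) *\<^sub>R Qx \<tau> x + (1 / (2 * \<tau>)) *\<^sub>R Q \<tau> x)) +
      (- x / (2 * \<tau>) * gauss \<tau> x) *\<^sub>R (Qx \<tau> x - (x / (2 * \<tau>)) *\<^sub>R Q \<tau> x)) (at x)" .
  moreover have "gauss \<tau> x *\<^sub>R (Qxx \<tau> x - ((x / (2 * \<tau>)) *\<^sub>R Qx \<tau> x + (1 / (2 * \<tau>)) *\<^sub>R Q \<tau> x)) +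
      (- x / (2 * \<tau>) * gauss \<tau> x) *\<^sub>R (Qx \<tau> x - (x / (2 * \<tau>)) *\<^sub>R Q \<tau> x)
    = gauss \<tau> x *\<^sub>R (Qxx \<tau> x - (x / \<tau>) *\<^sub>R Qx \<tau> x + (x\<^sup>2 / (4 * \<tau>\<^sup>2) - 1 / (2 * \<tau>)) *\<^sub>R Q \<tau> x)"
  proof -
    have r: "g *\<^sub>R (C - (h *\<^sub>R B + d *\<^sub>R A)) + (- h * g) *\<^sub>R (B - h *\<^sub>R A) = g *\<^sub>R (C - (2 * h) *\<^sub>R B + (h * h - d) *\<^sub>R A)"
      for g h d :: real and A B C :: 'a
    proof -
      have two: "(2 * h) *\<^sub>R B = h *\<^sub>R B + h *\<^sub>R B" by (simp only: mult_2 scaleR_left_distrib)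
      show ?thesis unfolding two by (simp add: algebra_simps)
    qed
    have h: "2 * (x / (2 * \<tau>)) = x / \<tau>" "x / (2 * \<tau>) * (x / (2 * \<tau>)) = x\<^sup>2 / (4 * \<tau>\<^sup>2)"
      by (auto simp: power2_eq_square)
    show ?thesis using r[of "gauss \<tau> x" "Qxx \<tau> x" "x / (2 * \<tau>)" "Qx \<tau> x" "1 / (2 * \<tau>)" "Q \<tau> x"] unfolding h
      by (simp only: minus_divide_left)
  qed
  ultimately show "((\<lambda>x. gauss \<tau> x *\<^sub>R (Qx \<tau> x - (x / (2 * \<tau>)) *\<^sub>R Q \<tau> x)) has_vector_derivative
        gauss \<tau> x *\<^sub>R (Qxx \<tau> x - (x / \<tau>) *\<^sub>R Qx \<tau> x + (x\<^sup>2 / (4 * \<tau>\<^sup>2) - 1 / (2 * \<tau>)) *\<^sub>R Q \<tau> x)) (at x)"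
    by simp
qed

text \<open>
  Each term \<open>\<tau>\<^sup>k x\<^sup>i\<close> times a remainder of order \<open>2(K - k) - i\<close> has parabolic weight at least \<open>2K\<close>.
\<close>

lemma parametrix_residual_small:
  fixes u :: "nat \<Rightarrow> complex^'r^'r" and V :: "real \<Rightarrow> complex^'r^'r" and N :: nat
  assumes rem: "\<And>L. \<exists>B\<ge>0. \<forall>x\<in>{-1..1}. norm (V x - (\<Sum>l<L. x ^ l *\<^sub>R u l)) \<le> B * \<bar>x\<bar> ^ L"
  defines "K \<equiv> Suc N"
  shows "heat_small N (\<lambda>\<tau> x. truncated_series K (\<lambda>k i. \<tau> ^ k * x ^ i)
          (\<lambda>k i. heat_coeff u k i ** (V x - (\<Sum>l<2 * (K - k) - i. x ^ l *\<^sub>R u l))))"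
  unfolding truncated_series_def
proof (intro heat_small_sum finite_atMost)
  fix k i assume k: "k \<in> {..K}"
  obtain B where B: "B \<ge> 0" "\<And>x. x \<in> {-1..1} \<Longrightarrow>
      norm (V x - (\<Sum>l<2 * (K - k) - i. x ^ l *\<^sub>R u l)) \<le> B * \<bar>x\<bar> ^ (2 * (K - k) - i)"
    using rem by blast
  have "\<exists>c>0. \<forall>(A :: complex^'r^'r) (B :: complex^'r^'r). norm (A ** B) \<le> norm A * norm B * c"
    by (rule matmul.pos_bounded)
  then obtain c where "c > 0" and "\<forall>(A :: complex^'r^'r) (B :: complex^'r^'r). norm (A ** B) \<le> norm A * norm B * c"
    by (elim exE conjE)
  then have c: "c > 0" "\<And>(A :: complex^'r^'r) (B :: complex^'r^'r). norm (A ** B) \<le> norm A * norm B * c" by auto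
  let ?a = "heat_coeff u k i"
  have bound: "norm ((\<tau> ^ k * x ^ i) *\<^sub>R (?a ** (V x - (\<Sum>l<2 * (K - k) - i. x ^ l *\<^sub>R u l))))
      \<le> (norm ?a * B * c) * norm (\<tau> ^ k * x ^ (2 * (K - k)))"
    if \<tau>: "\<tau> \<in> {0<..1}" and x: "x \<in> {-1..1}" for \<tau> x :: real
  proof -
    have "norm (?a ** (V x - (\<Sum>l<2 * (K - k) - i. x ^ l *\<^sub>R u l))) \<le> norm ?a * (B * \<bar>x\<bar> ^ (2 * (K - k) - i)) * c"
      by (rule order_trans[OF c(2)]) (use B c x in \<open>auto intro!: mult_left_mono mult_right_mono\<close>)
    then have "norm ((\<tau> ^ k * x ^ i) *\<^sub>R (?a ** (V x - (\<Sum>l<2 * (K - k) - i. x ^ l *\<^sub>R u l))))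
        \<le> (\<tau> ^ k * \<bar>x\<bar> ^ i) * (norm ?a * (B * \<bar>x\<bar> ^ (2 * (K - k) - i)) * c)"
      using \<tau> by (simp add: abs_mult power_abs mult_left_mono)
    also have "\<dots> = (norm ?a * B * c * \<tau> ^ k) * \<bar>x\<bar> ^ (i + (2 * (K - k) - i))"
      by (simp add: power_add mult_ac)
    also have "\<dots> \<le> (norm ?a * B * c * \<tau> ^ k) * \<bar>x\<bar> ^ (2 * (K - k))"
      using x \<tau> B c by (intro mult_left_mono power_decreasing) auto
    also have "\<dots> = (norm ?a * B * c) * norm (\<tau> ^ k * x ^ (2 * (K - k)))"
      using \<tau> by (simp add: abs_mult power_abs mult_ac)
    finally show ?thesis .
  qed
  show "heat_small N (\<lambda>\<tau> x. (\<tau> ^ k * x ^ i) *\<^sub>R (?a ** (V x - (\<Sum>l<2 * (K - k) - i. x ^ l *\<^sub>R u l))))"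
    by (rule heat_small_mono[OF heat_small_power[of k "K - k"] bound]) (use k B c in \<open>auto simp: K_def\<close>)
qed

text \<open>
  The duality estimate for \<open>E = G \<sqdot> cutoff \<sqdot> truncated series\<close> with \<open>K = N + 1\<close>. The residual splits into
  the Taylor remainder of the potential and the commutator of the heat operator with the cutoff; both are
  of order \<open>\<tau>\<^sup>N\<close>, and integration over time gains one more power of \<open>T\<close>.
\<close>

lemma (in delta_solution) diagonal_expansion:
  assumes rem: "\<And>L. \<exists>B\<ge>0. \<forall>x\<in>{-1..1}. norm (V x - (\<Sum>l<L. x ^ l *\<^sub>R u l)) \<le> B * \<bar>x\<bar> ^ L"
  shows "\<exists>C. \<forall>T\<in>{0<..1}. norm (v T 0 - (1 / sqrt (4 * pi * T)) *\<^sub>R (\<Sum>k\<le>Suc N. T ^ k *\<^sub>R heat_coeff u k 0)) \<le> C * T ^ Suc N"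
proof -
  define K where "K = Suc N"
  let ?a = "heat_coeff u"
  define P where "P \<tau> x = truncated_series K (\<lambda>k i. \<tau> ^ k * x ^ i) ?a" for \<tau> x
  define Pt where "Pt \<tau> x = truncated_series K (\<lambda>k i. real k * \<tau> ^ (k - 1) * x ^ i) ?a" for \<tau> x
  define Px where "Px \<tau> x = truncated_series K (\<lambda>k i. \<tau> ^ k * (real i * x ^ (i - 1))) ?a" for \<tau> x
  define Pxx where "Pxx \<tau> x = truncated_series K (\<lambda>k i. \<tau> ^ k * (real i * (real (i - 1) * x ^ (i - 1 - 1)))) ?a" for \<tau> x
  define c where "c = cutoff K"
  define c1 where "c1 = cutoff_deriv K"
  define c2 where "c2 = cutoff_deriv2 K"
  define Q where "Q \<tau> x = c x *\<^sub>R P \<tau> x" for \<tau> x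
  define Qt where "Qt \<tau> x = c x *\<^sub>R Pt \<tau> x" for \<tau> x
  define Qx where "Qx \<tau> x = c x *\<^sub>R Px \<tau> x + c1 x *\<^sub>R P \<tau> x" for \<tau> x
  define Qxx where "Qxx \<tau> x = (c x *\<^sub>R Pxx \<tau> x + c1 x *\<^sub>R Px \<tau> x) + (c1 x *\<^sub>R Px \<tau> x + c2 x *\<^sub>R P \<tau> x)" for \<tau> x
  define E where "E \<tau> x = gauss \<tau> x *\<^sub>R Q \<tau> x" for \<tau> x
  define Et where "Et \<tau> x = gauss \<tau> x *\<^sub>R (Qt \<tau> x + (x\<^sup>2 / (4 * \<tau>\<^sup>2) - 1 / (2 * \<tau>)) *\<^sub>R Q \<tau> x)" for \<tau> x
  define Ex where "Ex \<tau> x = gauss \<tau> x *\<^sub>R (Qx \<tau> x - (x / (2 * \<tau>)) *\<^sub>R Q \<tau> x)" for \<tau> x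
  define Exx where "Exx \<tau> x = gauss \<tau> x *\<^sub>R (Qxx \<tau> x - (x / \<tau>) *\<^sub>R Qx \<tau> x + (x\<^sup>2 / (4 * \<tau>\<^sup>2) - 1 / (2 * \<tau>)) *\<^sub>R Q \<tau> x)" for \<tau> x
  define R where "R \<tau> x = c x *\<^sub>R (Pt \<tau> x + (x / \<tau>) *\<^sub>R Px \<tau> x - Pxx \<tau> x - P \<tau> x ** V x)
     + ((x / \<tau> * c1 x) *\<^sub>R P \<tau> x + ((- c2 x) *\<^sub>R P \<tau> x + (- 2 * c1 x) *\<^sub>R Px \<tau> x))" for \<tau> x
  have cd: "(c has_real_derivative c1 x) (at x within S)" "(c1 has_real_derivative c2 x) (at x within S)" for x S
    unfolding c_def c1_def c2_def by (rule cutoff_has_derivative cutoff_deriv_has_derivative)+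
  have P_t: "((\<lambda>\<tau>. P \<tau> x) has_vector_derivative Pt \<tau> x) (at \<tau>)" for \<tau> x
    unfolding P_def Pt_def
    by (rule truncated_series_has_vector_derivative) (auto intro!: derivative_eq_intros)
  have P_x: "(P \<tau> has_vector_derivative Px \<tau> x) (at x)" for \<tau> x
    unfolding P_def[abs_def] Px_def
    by (rule truncated_series_has_vector_derivative) (auto intro!: derivative_eq_intros)
  have P_xx: "(Px \<tau> has_vector_derivative Pxx \<tau> x) (at x)" for \<tau> x
    unfolding Px_def[abs_def] Pxx_def
    by (rule truncated_series_has_vector_derivative) (auto intro!: derivative_eq_intros)
  have Q_t: "((\<lambda>\<tau>. Q \<tau> x) has_vector_derivative Qt \<tau> x) (at \<tau>)" for \<tau> x
    using has_vector_derivative_scaleR[OF DERIV_const P_t] by (simp add: Q_def Qt_def)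
  have Q_x: "(Q \<tau> has_vector_derivative Qx \<tau> x) (at x)" for \<tau> x
    using has_vector_derivative_scaleR[OF cd(1) P_x] by (simp add: Q_def[abs_def] Qx_def)
  have Q_xx: "(Qx \<tau> has_vector_derivative Qxx \<tau> x) (at x)" for \<tau> x
    unfolding Qx_def[abs_def] Qxx_def
    by (intro has_vector_derivative_add has_vector_derivative_scaleR cd P_x P_xx)
  have cont_c: "continuous_on A (\<lambda>z. c (snd z))" "continuous_on A (\<lambda>z. c1 (snd z))" "continuous_on A (\<lambda>z. c2 (snd z))"
    for A :: "(real \<times> real) set"
    unfolding c_def c1_def c2_def cutoff_def cutoff_deriv_def cutoff_deriv2_def by (intro continuous_intros)+
  have cont_P: "continuous_on A (\<lambda>z. P (fst z) (snd z))" "continuous_on A (\<lambda>z. Pt (fst z) (snd z))"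
    "continuous_on A (\<lambda>z. Px (fst z) (snd z))" "continuous_on A (\<lambda>z. Pxx (fst z) (snd z))" for A :: "(real \<times> real) set"
    unfolding P_def Pt_def Px_def Pxx_def by (intro continuous_on_truncated_series continuous_intros)+
  have cont_E: "continuous_on ({0<..} \<times> {-1..1}) (\<lambda>(\<tau>, x). E \<tau> x)"
    "continuous_on ({0<..} \<times> {-1..1}) (\<lambda>(\<tau>, x). Et \<tau> x)"
    "continuous_on ({0<..} \<times> {-1..1}) (\<lambda>(\<tau>, x). Exx \<tau> x)"
    unfolding E_def Et_def Exx_def Q_def Qt_def Qx_def Qxx_def case_prod_unfold
    by (intro continuous_intros cont_c cont_P; auto)+
  have res_eq: "Et \<tau> x - Exx \<tau> x - E \<tau> x ** V x = gauss \<tau> x *\<^sub>R R \<tau> x" if "\<tau> > 0" for \<tau> x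
  proof -
    have "Et \<tau> x - Exx \<tau> x - E \<tau> x ** V x = gauss \<tau> x *\<^sub>R (Qt \<tau> x - Qxx \<tau> x + (x / \<tau>) *\<^sub>R Qx \<tau> x - Q \<tau> x ** V x)"
      by (simp add: Et_def Exx_def E_def matmul.scaleR_left scaleR_diff_right scaleR_right_distrib)
    also have "Qt \<tau> x - Qxx \<tau> x + (x / \<tau>) *\<^sub>R Qx \<tau> x - Q \<tau> x ** V x = R \<tau> x"
    proof -
      have two: "(- 2 * d) *\<^sub>R X = - (d *\<^sub>R X) + - (d *\<^sub>R X)" for d :: real and X :: "complex^'r^'r"
      proof -
        have "- 2 * d = - d + - d" by simp
        then show ?thesis by (simp only: scaleR_left_distrib scaleR_minus_left)
      qed
      have expand: "d *\<^sub>R A - ((d *\<^sub>R D + e *\<^sub>R C) + (e *\<^sub>R C + f *\<^sub>R B)) + y *\<^sub>R (d *\<^sub>R C + e *\<^sub>R B) - d *\<^sub>R W =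
         d *\<^sub>R (A + y *\<^sub>R C - D - W) + ((y * e) *\<^sub>R B + ((- f) *\<^sub>R B + (- 2 * e) *\<^sub>R C))"
        for d e f y :: real and A B C D W :: "complex^'r^'r"
        unfolding two by (simp add: scaleR_diff_right scaleR_right_distrib mult.commute)
      show ?thesis
        unfolding Qt_def Qxx_def Qx_def Q_def R_def matmul.scaleR_left by (rule expand)
    qed
    finally show ?thesis .
  qed
  define BP where "BP = (\<Sum>k\<le>K. \<Sum>i\<le>2 * K + 1 - 2 * k. 1 * norm (?a k i))"
  define BPx where "BPx = (\<Sum>k\<le>K. \<Sum>i\<le>2 * K + 1 - 2 * k. real i * norm (?a k i))"
  have BP0: "BP \<ge> 0" "BPx \<ge> 0" unfolding BP_def BPx_def by (auto intro!: sum_nonneg)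
  have P_bound: "norm (P \<tau> x) \<le> BP" "norm (Px \<tau> x) \<le> BPx" if "\<tau> \<in> {0<..1}" "x \<in> {-1..1}" for \<tau> x
  proof -
    have p: "\<bar>\<tau> ^ k\<bar> \<le> 1" "\<bar>x ^ i\<bar> \<le> 1" for k i
      using that by (auto simp: power_abs intro!: power_le_one)
    show "norm (P \<tau> x) \<le> BP" unfolding P_def BP_def
      by (rule norm_truncated_series_le) (use p in \<open>auto simp: abs_mult intro!: mult_le_one\<close>)
    have "\<bar>\<tau> ^ k * (real i * x ^ (i - 1))\<bar> \<le> real i" for k i
    proof -
      have "\<bar>\<tau> ^ k * (real i * x ^ (i - 1))\<bar> = real i * (\<bar>\<tau> ^ k\<bar> * \<bar>x ^ (i - 1)\<bar>)" by (simp add: abs_mult)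
      also have "\<dots> \<le> real i * 1" by (intro mult_left_mono mult_le_one p) auto
      finally show ?thesis by simp
    qed
    then show "norm (Px \<tau> x) \<le> BPx" unfolding Px_def BPx_def by (rule norm_truncated_series_le)
  qed
  note cb = cutoff_bounds[of _ K, folded c_def c1_def c2_def]
  have xpow: "\<bar>x\<bar> ^ (2 * K + 1) \<le> norm (\<tau> ^ 0 * x ^ (2 * K))" if "x \<in> {-1..1}" for \<tau> x :: real
    using power_decreasing[of "2 * K" "2 * K + 1" "\<bar>x\<bar>"] that by (auto simp: power_abs)
  have small: "heat_small N R"
    unfolding R_def
  proof (intro heat_small_add)
    show "heat_small N (\<lambda>\<tau> x. c x *\<^sub>R (Pt \<tau> x + (x / \<tau>) *\<^sub>R Px \<tau> x - Pxx \<tau> x - P \<tau> x ** V x))"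
    proof (rule heat_small_mono[OF parametrix_residual_small[OF rem, of N, folded K_def], where C = 1])
      fix \<tau> x :: real assume \<tau>: "\<tau> \<in> {0<..1}" and x: "x \<in> {-1..1}"
      have "Pt \<tau> x + (x / \<tau>) *\<^sub>R Px \<tau> x - Pxx \<tau> x - P \<tau> x ** V x = - truncated_series K (\<lambda>k i. \<tau> ^ k * x ^ i)
          (\<lambda>k i. ?a k i ** (V x - (\<Sum>l<2 * (K - k) - i. x ^ l *\<^sub>R u l)))" (is "?l = - ?r")
        unfolding P_def Pt_def Px_def Pxx_def using \<tau> by (intro truncated_series_residual) simp
      then show "norm (c x *\<^sub>R ?l) \<le> 1 * norm ?r"
        using cb(1)[OF x] by (simp add: mult_left_le_one_le)
    qed simp
    show "heat_small N (\<lambda>\<tau> x. (x / \<tau> * c1 x) *\<^sub>R P \<tau> x)"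
    proof (rule heat_small_mono[OF heat_small_power_over_time, where C = "3 * real (2 * K + 2) * BP"])
      fix \<tau> x :: real assume \<tau>: "\<tau> \<in> {0<..1}" and x: "x \<in> {-1..1}"
      have "norm ((x / \<tau> * c1 x) *\<^sub>R P \<tau> x) = \<bar>x\<bar> / \<tau> * (\<bar>c1 x\<bar> * norm (P \<tau> x))"
        using \<tau> by (simp add: abs_mult)
      also have "\<dots> \<le> \<bar>x\<bar> / \<tau> * ((3 * real (2 * K + 2) * \<bar>x\<bar> ^ (2 * K + 1)) * BP)"
        using \<tau> cb(2)[OF x] P_bound(1)[OF \<tau> x] by (intro mult_left_mono mult_mono) auto
      also have "\<dots> = 3 * real (2 * K + 2) * BP * (\<bar>x\<bar> ^ (2 * (N + 2)) / \<tau>)"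
        by (simp add: K_def mult_ac)
      also have "\<bar>x\<bar> ^ (2 * (N + 2)) / \<tau> = norm (x ^ (2 * (N + 2)) / \<tau>)"
        using \<tau> by (simp only: real_norm_def abs_divide power_abs) simp
      finally show "norm ((x / \<tau> * c1 x) *\<^sub>R P \<tau> x) \<le> 3 * real (2 * K + 2) * BP * norm (x ^ (2 * (N + 2)) / \<tau>)" .
    qed (use BP0 in simp)
    show "heat_small N (\<lambda>\<tau> x. (- c2 x) *\<^sub>R P \<tau> x)"
    proof (rule heat_small_mono[OF heat_small_power[of 0 K], where C = "9 * (real (2 * K + 2))\<^sup>2 * BP"])
      fix \<tau> x :: real assume \<tau>: "\<tau> \<in> {0<..1}" and x: "x \<in> {-1..1}"
      have "norm ((- c2 x) *\<^sub>R P \<tau> x) = \<bar>c2 x\<bar> * norm (P \<tau> x)" by simp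
      also have "\<dots> \<le> (9 * (real (2 * K + 2))\<^sup>2 * x ^ (2 * K)) * BP"
        using order_trans[OF abs_ge_zero cb(3)[OF x]] by (intro mult_mono cb x P_bound \<tau>) auto
      also have "x ^ (2 * K) = norm (\<tau> ^ 0 * x ^ (2 * K))" by (simp add: power_even_abs power_abs)
      finally show "norm ((- c2 x) *\<^sub>R P \<tau> x) \<le> 9 * (real (2 * K + 2))\<^sup>2 * BP * norm (\<tau> ^ 0 * x ^ (2 * K))"
        by (simp add: mult_ac)
    qed (use BP0 in \<open>auto simp: K_def\<close>)
    show "heat_small N (\<lambda>\<tau> x. (- 2 * c1 x) *\<^sub>R Px \<tau> x)"
    proof (rule heat_small_mono[OF heat_small_power[of 0 K], where C = "6 * real (2 * K + 2) * BPx"])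
      fix \<tau> x :: real assume \<tau>: "\<tau> \<in> {0<..1}" and x: "x \<in> {-1..1}"
      have "norm ((- 2 * c1 x) *\<^sub>R Px \<tau> x) = 2 * (\<bar>c1 x\<bar> * norm (Px \<tau> x))" by (simp add: abs_mult)
      also have "\<dots> \<le> 2 * ((3 * real (2 * K + 2) * \<bar>x\<bar> ^ (2 * K + 1)) * BPx)"
        by (intro mult_left_mono mult_mono cb x P_bound \<tau>) auto
      also have "\<dots> = 6 * real (2 * K + 2) * BPx * \<bar>x\<bar> ^ (2 * K + 1)" by (simp add: mult_ac)
      also have "\<dots> \<le> 6 * real (2 * K + 2) * BPx * norm (\<tau> ^ 0 * x ^ (2 * K))"
        using BP0 xpow[OF x] by (intro mult_left_mono) auto
      finally show "norm ((- 2 * c1 x) *\<^sub>R Px \<tau> x) \<le> 6 * real (2 * K + 2) * BPx * norm (\<tau> ^ 0 * x ^ (2 * K))" .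
    qed (use BP0 in \<open>auto simp: K_def\<close>)
  qed
  then obtain C where C: "\<And>\<tau> x. \<tau> \<in> {0<..1} \<Longrightarrow> x \<in> {-1..1} \<Longrightarrow> gauss \<tau> x * norm (R \<tau> x) \<le> C * \<tau> ^ N"
    unfolding heat_small_def by blast
  have C0: "C \<ge> 0"
    using order_trans[OF mult_nonneg_nonneg[OF less_imp_le[OF gauss_pos] norm_ge_zero] C[of 1 0]] by simp
  obtain M where M: "M \<ge> 0" "\<And>t. t \<in> {0<..1} \<Longrightarrow> matrix_weakly_bounded M (v t)"
    using mass_bounded by blast
  have Q00: "Q 0 0 = mat 1"
  proof -
    have "P 0 0 = (\<Sum>k\<le>K. if k = 0 then ?a 0 0 else 0)"
      unfolding P_def truncated_series_def
    proof (rule sum.cong[OF refl])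
      fix k
      show "(\<Sum>i\<le>2 * K + 1 - 2 * k. (0 ^ k * 0 ^ i) *\<^sub>R ?a k i) = (if k = 0 then ?a 0 0 else 0)"
        by (cases k) (auto simp: power_0_left if_distrib[of "\<lambda>c. c *\<^sub>R _"] cong: if_cong)
    qed
    then show ?thesis by (simp add: Q_def c_def cutoff_0 heat_coeff.simps)
  qed
  have E_T: "E T 0 = (1 / sqrt (4 * pi * T)) *\<^sub>R (\<Sum>k\<le>Suc N. T ^ k *\<^sub>R ?a k 0)" for T
  proof -
    have "P T 0 = (\<Sum>k\<le>K. T ^ k *\<^sub>R ?a k 0)"
      unfolding P_def truncated_series_def
      by (rule sum.cong) (auto simp: power_0_left if_distrib[of "\<lambda>c. _ * c"] if_distrib[of "\<lambda>c. c *\<^sub>R _"] cong: if_cong)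
    then show ?thesis by (simp add: E_def Q_def c_def cutoff_0 K_def gauss_def)
  qed
  have "norm (v T 0 - E T 0) \<le> M * (C * T ^ N) * T" if T: "T \<in> {0<..1}" for T
  proof (rule duality_estimate[where Et = Et and Ex = Ex and Exx = Exx])
    show "0 < T" "T \<le> 1" using T by auto
    show "M \<ge> 0" by (rule M)
    show "matrix_weakly_bounded M (v t)" if "t \<in> {0<..1}" for t using that by (rule M)
    show "((\<lambda>\<tau>. E \<tau> x) has_vector_derivative Et \<tau> x) (at \<tau>)" if "\<tau> > 0" for \<tau> x
      unfolding E_def Et_def by (rule gauss_times_derivatives(1)[where Q = Q and Qt = Qt, OF that Q_t])
    show "(E \<tau> has_vector_derivative Ex \<tau> x) (at x)" if "\<tau> > 0" for \<tau> x
      unfolding E_def[abs_def] Ex_def by (rule gauss_times_derivatives(2)[where Q = Q and Qx = Qx, OF that Q_x])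
    show "(Ex \<tau> has_vector_derivative Exx \<tau> x) (at x)" if "\<tau> > 0" for \<tau> x
      unfolding Ex_def[abs_def] Exx_def by (rule gauss_times_derivatives(3)[where Q = Q and Qx = Qx and Qxx = Qxx, OF that Q_x Q_xx])
    show "E \<tau> x = 0 \<and> Et \<tau> x = 0 \<and> Ex \<tau> x = 0 \<and> Exx \<tau> x = 0" if "x \<in> {-1, 1}" for \<tau> x
      using cutoff_boundary[OF that, of K]
      by (simp add: E_def Et_def Ex_def Exx_def Q_def Qt_def Qx_def Qxx_def c_def c1_def c2_def)
    show "norm (Et \<tau> x - Exx \<tau> x - E \<tau> x ** V x) \<le> C * T ^ N" if "0 < \<tau>" "\<tau> \<le> T" "x \<in> {-1..1}" for \<tau> x
    proof -
      have "norm (Et \<tau> x - Exx \<tau> x - E \<tau> x ** V x) = gauss \<tau> x * norm (R \<tau> x)"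
        unfolding res_eq[OF that(1)] using gauss_pos[OF that(1), of x] by simp
      also have "\<dots> \<le> C * \<tau> ^ N" using that T by (intro C) auto
      also have "\<dots> \<le> C * T ^ N" using that C0 by (intro mult_left_mono power_mono) auto
      finally show ?thesis .
    qed
    show "((\<lambda>s. integral {-1..1} (\<lambda>x. E (T - s) x ** v s x)) \<longlongrightarrow> v T 0) (at_left T)"
    proof -
      have "((\<lambda>\<tau>. integral {-1..1} (\<lambda>x. gauss \<tau> x *\<^sub>R (Q \<tau> x ** v (T - \<tau>) x))) \<longlongrightarrow> Q 0 0 ** v (T - 0) 0) (at_right 0)"
      proof (rule gauss_approximate_identity[of "T / 2"])
        show "0 < T / 2" "T / 2 \<le> 1" using T by auto
        have "continuous_on ({0..T/2} \<times> {-1..1}) (\<lambda>z. (\<lambda>(t, x). v t x) (T - fst z, snd z))"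
          by (rule continuous_on_compose2[OF cont_v]) (use T in \<open>auto intro!: continuous_intros\<close>)
        then have cv: "continuous_on ({0..T/2} \<times> {-1..1}) (\<lambda>z. v (T - fst z) (snd z))" by simp
        show "continuous_on ({0..T/2} \<times> {-1..1}) (\<lambda>(\<tau>, x). Q \<tau> x ** v (T - \<tau>) x)"
          unfolding case_prod_unfold Q_def
          by (intro matmul.continuous_on continuous_on_scaleR cont_c cont_P cv)
      qed
      then have "((\<lambda>\<tau>. integral {-1..1} (\<lambda>x. E \<tau> x ** v (T - \<tau>) x)) \<longlongrightarrow> v T 0) (at_right 0)"
        by (simp add: E_def matmul.scaleR_left Q00)
      moreover have "filterlim (\<lambda>s. T - s) (at_right 0) (at_left T)"
        unfolding filterlim_at
        by (auto intro!: tendsto_eq_intros simp: eventually_at_filter)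
      ultimately have "((\<lambda>s. integral {-1..1} (\<lambda>x. E (T - s) x ** v (T - (T - s)) x)) \<longlongrightarrow> v T 0) (at_left T)"
        by (rule filterlim_compose)
      then show ?thesis by simp
    qed
  qed (rule cont_E)+
  then have "\<forall>T\<in>{0<..1}. norm (v T 0 - (1 / sqrt (4 * pi * T)) *\<^sub>R (\<Sum>k\<le>Suc N. T ^ k *\<^sub>R ?a k 0)) \<le> (M * C) * T ^ Suc N"
    unfolding E_T by (simp add: mult_ac)
  then show ?thesis by blast
qed

section \<open>From the heat kernel to the KdV polynomials\<close>

text \<open>
  Translation by the pole. The test functions have bounded support, so the translation of their integrals
  takes place on compact intervals.
\<close>

lemma heat_kernel_imp_delta_solution:
  assumes "heat_kernel U H" "continuous_on UNIV U"
  shows "\<exists>vt vx vxx. delta_solution (\<lambda>x. U (x + y)) (\<lambda>t x. H t (x + y) y) vt vx vxx"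
proof -
  have "\<exists>Ht Hx Hxx.
       continuous_on ({0<..} \<times> UNIV) (\<lambda>(t, x). H t x y) \<and>
       continuous_on ({0<..} \<times> UNIV) (\<lambda>(t, x). Ht t x) \<and>
       continuous_on ({0<..} \<times> UNIV) (\<lambda>(t, x). Hx t x) \<and>
       continuous_on ({0<..} \<times> UNIV) (\<lambda>(t, x). Hxx t x) \<and>
       (\<forall>t>0. \<forall>x.
          ((\<lambda>s. H s x y) has_vector_derivative Ht t x) (at t) \<and>
          ((\<lambda>z. H t z y) has_vector_derivative Hx t x) (at x) \<and>
          ((\<lambda>z. Hx t z) has_vector_derivative Hxx t x) (at x) \<and>
          Ht t x = Hxx t x + U x ** H t x y)"
    using assms(1)[unfolded heat_kernel_def, THEN conjunct1, THEN spec[of _ y]] .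
  then obtain Ht Hx Hxx where
    cont: "continuous_on ({0<..} \<times> UNIV) (\<lambda>(t, x). H t x y)"
      "continuous_on ({0<..} \<times> UNIV) (\<lambda>(t, x). Ht t x)"
      "continuous_on ({0<..} \<times> UNIV) (\<lambda>(t, x). Hx t x)"
      "continuous_on ({0<..} \<times> UNIV) (\<lambda>(t, x). Hxx t x)"
    and deriv: "\<forall>t>0. \<forall>x. ((\<lambda>s. H s x y) has_vector_derivative Ht t x) (at t) \<and>
          ((\<lambda>z. H t z y) has_vector_derivative Hx t x) (at x) \<and>
          ((\<lambda>z. Hx t z) has_vector_derivative Hxx t x) (at x) \<and>
          Ht t x = Hxx t x + U x ** H t x y"
    by (elim exE conjE) (rule that)
  have shift_cont: "continuous_on ({0<..} \<times> UNIV) (\<lambda>(t, x). f t (x + y))"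
    if "continuous_on ({0<..} \<times> UNIV) (\<lambda>(t, x). f t x)" for f :: "real \<Rightarrow> real \<Rightarrow> complex^'a^'a"
  proof -
    have "continuous_on ({0<..} \<times> UNIV) (\<lambda>z. (\<lambda>(t, x). f t x) (fst z, snd z + y))"
      by (rule continuous_on_compose2[OF that]) (auto intro!: continuous_intros)
    then show ?thesis by (simp add: case_prod_unfold)
  qed
  have shift_deriv: "((\<lambda>x. f (x + y)) has_vector_derivative f') (at x)"
    if "(f has_vector_derivative f') (at (x + y))" for f :: "real \<Rightarrow> complex^'a^'a" and f' x
  proof -
    have "((\<lambda>x. x + y) has_vector_derivative 1) (at x)"
      by (auto intro!: derivative_eq_intros simp: has_real_derivative_iff_has_vector_derivative[symmetric])
    from vector_diff_chain_at[OF this that] show ?thesis by (simp add: o_def)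
  qed
  have "delta_solution (\<lambda>x. U (x + y)) (\<lambda>t x. H t (x + y) y) (\<lambda>t x. Ht t (x + y)) (\<lambda>t x. Hx t (x + y)) (\<lambda>t x. Hxx t (x + y))"
  proof
    show "continuous_on UNIV (\<lambda>x. U (x + y))"
      by (rule continuous_on_compose2[OF assms(2)]) (auto intro!: continuous_intros)
    show "continuous_on ({0<..} \<times> UNIV) (\<lambda>(t, x). H t (x + y) y)" by (rule shift_cont[OF cont(1)])
    show "continuous_on ({0<..} \<times> UNIV) (\<lambda>(t, x). Ht t (x + y))" by (rule shift_cont[OF cont(2)])
    show "continuous_on ({0<..} \<times> UNIV) (\<lambda>(t, x). Hxx t (x + y))" by (rule shift_cont[OF cont(4)])
    fix t x :: real assume t: "t > 0"
    show "((\<lambda>s. H s (x + y) y) has_vector_derivative Ht t (x + y)) (at t)" using deriv t by blast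
    show "((\<lambda>x. H t (x + y) y) has_vector_derivative Hx t (x + y)) (at x)"
      by (rule shift_deriv) (use deriv t in blast)
    show "((\<lambda>x. Hx t (x + y)) has_vector_derivative Hxx t (x + y)) (at x)"
      by (rule shift_deriv) (use deriv t in blast)
    show "Ht t (x + y) = Hxx t (x + y) + U (x + y) ** H t (x + y) y" using deriv t by blast
  next
    fix \<phi> :: "real \<Rightarrow> real" assume \<phi>: "continuous_on UNIV \<phi>" "bounded {x. \<phi> x \<noteq> 0}"
    obtain c where "\<forall>x\<in>{x. \<phi> x \<noteq> 0}. norm x \<le> c" using \<phi>(2) unfolding bounded_iff by blast
    then have c: "\<phi> x = 0" if "x \<notin> {-c..c}" for x using that by force
    define \<psi> where "\<psi> z = \<phi> (z - y)" for z
    have "continuous_on UNIV \<psi>"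
      unfolding \<psi>_def by (rule continuous_on_compose2[OF \<phi>(1)]) (auto intro!: continuous_intros)
    moreover have "bounded {z. \<psi> z \<noteq> 0}"
      by (rule bounded_subset[of "{y - c..y + c}"]) (use c in \<open>force simp: \<psi>_def\<close>)+
    ultimately have "((\<lambda>t. integral UNIV (\<lambda>z. \<psi> z *\<^sub>R H t z y)) \<longlongrightarrow> \<psi> y *\<^sub>R mat 1) (at_right 0)"
      by (intro assms(1)[unfolded heat_kernel_def, THEN conjunct2, rule_format] conjI)
    moreover have "integral UNIV (\<lambda>z. \<psi> z *\<^sub>R H t z y) = integral UNIV (\<lambda>x. \<phi> x *\<^sub>R H t (x + y) y)" for t
    proof -
      have "integral UNIV (\<lambda>z. \<psi> z *\<^sub>R H t z y) = integral {y - c..y + c} (\<lambda>z. \<psi> z *\<^sub>R H t z y)"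
        by (subst (2) integral_restrict_UNIV[symmetric]) (intro integral_cong, use c in \<open>force simp: \<psi>_def\<close>)
      also have "\<dots> = integral {y - c - y..y + c - y} (\<lambda>x. \<psi> (x + y) *\<^sub>R H t (x + y) y)"
        by (rule integral_shift_real_ivl[symmetric])
      also have "\<dots> = integral {-c..c} (\<lambda>x. \<phi> x *\<^sub>R H t (x + y) y)" by (simp add: \<psi>_def)
      also have "\<dots> = integral UNIV (\<lambda>x. \<phi> x *\<^sub>R H t (x + y) y)"
        by (subst integral_restrict_UNIV[symmetric]) (intro integral_cong, use c in force)
      finally show ?thesis .
    qed
    ultimately show "((\<lambda>t. integral UNIV (\<lambda>x. \<phi> x *\<^sub>R H t (x + y) y)) \<longlongrightarrow> \<phi> 0 *\<^sub>R mat 1) (at_right 0)"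
      by (simp add: \<psi>_def)
  qed
  then show ?thesis by blast
qed

lemma smooth_has_vector_derivative:
  assumes "smooth U"
  shows "(Dx k U has_vector_derivative Dx (Suc k) U x) (at x)"
  using assms by (simp add: smooth_def Dx_def vector_derivative_works)

lemma smooth_taylor_remainder:
  fixes U :: "real \<Rightarrow> complex^'r^'r"
  assumes "smooth U"
  shows "\<exists>B\<ge>0. \<forall>x\<in>{-1..1}. norm (U (x + y) - (\<Sum>l<L. x ^ l *\<^sub>R ((1 / fact l) *\<^sub>R Dx l U y))) \<le> B * \<bar>x\<bar> ^ L"
proof -
  have "((\<lambda>x. Dx k U (x + y)) has_vector_derivative Dx (Suc k) U (x + y)) (at x)" for k x
  proof -
    have "((\<lambda>x. x + y) has_vector_derivative 1) (at x)"
      by (auto intro!: derivative_eq_intros simp: has_real_derivative_iff_has_vector_derivative[symmetric])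
    from vector_diff_chain_at[OF this smooth_has_vector_derivative[OF assms]] show ?thesis by (simp add: o_def)
  qed
  from taylor_remainder_bound[of "\<lambda>k x. Dx k U (x + y)" 0 L, OF this] show ?thesis
    by (simp add: Dx_def)
qed

text \<open>
  Uniqueness of asymptotic expansions: by induction the lower coefficients agree, so the difference of the
  two expansions is \<open>t\<^sup>n (h\<^sub>n - a\<^sub>n) / sqrt (4\<pi>t)\<close> up to terms of smaller order.
\<close>

lemma heat_coefficients_eq:
  fixes H :: "real \<Rightarrow> real \<Rightarrow> real \<Rightarrow> complex^'r^'r" and a :: "nat \<Rightarrow> complex^'r^'r"
  assumes h: "heat_coefficients H h"
    and a: "\<And>N. \<exists>C. \<forall>T\<in>{0<..1}. norm (H T y y - (1 / sqrt (4 * pi * T)) *\<^sub>R (\<Sum>k\<le>Suc N. T ^ k *\<^sub>R a k)) \<le> C * T ^ Suc N"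
  shows "h n y = a n"
proof (induction n rule: less_induct)
  case (less n)
  define c where "c t = 1 / sqrt (4 * pi * t)" for t
  define r where "r t = norm (H t y y - c t *\<^sub>R (\<Sum>k\<le>n. t ^ k *\<^sub>R h k y)) / (t ^ n / sqrt t)" for t
  obtain C where C: "\<And>t. t \<in> {0<..1} \<Longrightarrow> norm (H t y y - c t *\<^sub>R (\<Sum>k\<le>Suc n. t ^ k *\<^sub>R a k)) \<le> C * t ^ Suc n"
    using a[of n] unfolding c_def by blast
  have r_lim: "(r \<longlongrightarrow> 0) (at_right 0)"
    using h unfolding heat_coefficients_def r_def c_def by (intro smalloD_tendsto) blast
  have bound: "norm (h n y - a n) \<le> sqrt (4 * pi) * (r t + C * (t * sqrt t)) + t * norm (a (Suc n))" if t: "t \<in> {0<..1}" for t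
  proof -
    have ct: "c t > 0" "c t * t ^ n > 0" using t by (auto simp: c_def)
    have "(\<Sum>k\<le>n. t ^ k *\<^sub>R h k y) - (\<Sum>k\<le>Suc n. t ^ k *\<^sub>R a k) = t ^ n *\<^sub>R (h n y - a n) - t ^ Suc n *\<^sub>R a (Suc n)"
    proof -
      have "(\<Sum>k\<le>n. t ^ k *\<^sub>R h k y) = (\<Sum>k<n. t ^ k *\<^sub>R h k y) + t ^ n *\<^sub>R h n y"
        by (simp only: lessThan_Suc_atMost[symmetric] sum.lessThan_Suc)
      moreover have "(\<Sum>k\<le>Suc n. t ^ k *\<^sub>R a k) = (\<Sum>k<n. t ^ k *\<^sub>R a k) + t ^ n *\<^sub>R a n + t ^ Suc n *\<^sub>R a (Suc n)"
        by (simp only: lessThan_Suc_atMost[symmetric] sum.lessThan_Suc)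
      moreover have "(\<Sum>k<n. t ^ k *\<^sub>R h k y) = (\<Sum>k<n. t ^ k *\<^sub>R a k)"
        using less.IH by (intro sum.cong) auto
      ultimately show ?thesis by (simp add: scaleR_diff_right)
    qed
    moreover have "b *\<^sub>R D = (X - b *\<^sub>R S') - (X - b *\<^sub>R S) + b *\<^sub>R D'" if "S - S' = D - D'"
      for b and S S' D D' X :: "complex^'r^'r"
    proof -
      have "D = S - S' + D'" using that by simp
      then show ?thesis by (simp add: scaleR_diff_right scaleR_right_distrib)
    qed
    ultimately have split: "c t *\<^sub>R (t ^ n *\<^sub>R (h n y - a n)) =
       (H t y y - c t *\<^sub>R (\<Sum>k\<le>Suc n. t ^ k *\<^sub>R a k)) - (H t y y - c t *\<^sub>R (\<Sum>k\<le>n. t ^ k *\<^sub>R h k y)) + c t *\<^sub>R (t ^ Suc n *\<^sub>R a (Suc n))"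
      by blast
    have "norm (A - B + D) \<le> norm A + norm B + norm D" for A B D :: "complex^'r^'r"
      by (rule order_trans[OF norm_triangle_ineq add_right_mono[OF norm_triangle_ineq4]])
    then have "norm (c t *\<^sub>R (t ^ n *\<^sub>R (h n y - a n))) \<le>
       norm (H t y y - c t *\<^sub>R (\<Sum>k\<le>Suc n. t ^ k *\<^sub>R a k)) + norm (H t y y - c t *\<^sub>R (\<Sum>k\<le>n. t ^ k *\<^sub>R h k y)) + norm (c t *\<^sub>R (t ^ Suc n *\<^sub>R a (Suc n)))"
      unfolding split .
    moreover have "norm (H t y y - c t *\<^sub>R (\<Sum>k\<le>n. t ^ k *\<^sub>R h k y)) = r t * (t ^ n / sqrt t)"
      using t by (simp add: r_def)
    moreover have "norm (c t *\<^sub>R (t ^ n *\<^sub>R (h n y - a n))) = c t * t ^ n * norm (h n y - a n)"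
      "norm (c t *\<^sub>R (t ^ Suc n *\<^sub>R a (Suc n))) = c t * t ^ Suc n * norm (a (Suc n))"
      using t ct(1) by simp_all
    ultimately have "c t * t ^ n * norm (h n y - a n) \<le> C * t ^ Suc n + r t * (t ^ n / sqrt t) + c t * t ^ Suc n * norm (a (Suc n))"
      using C[OF t] by linarith
    also have "\<dots> = c t * t ^ n * (sqrt (4 * pi) * (r t + C * (t * sqrt t)) + t * norm (a (Suc n)))"
    proof -
      have "c t * sqrt (4 * pi) = 1 / sqrt t" using t by (simp add: c_def real_sqrt_mult)
      moreover have "1 / sqrt t * (t * sqrt t) = t" using t by simp
      moreover have "c t * t ^ n * (sqrt (4 * pi) * (r t + C * (t * sqrt t)) + t * norm (a (Suc n))) =
         (c t * sqrt (4 * pi)) * (t ^ n * r t) + C * t ^ n * ((c t * sqrt (4 * pi)) * (t * sqrt t)) + c t * t ^ Suc n * norm (a (Suc n))"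
        by (simp add: algebra_simps)
      ultimately show ?thesis by (simp add: mult_ac)
    qed
    finally show ?thesis using ct(2) by (rule mult_left_le_imp_le)
  qed
  have "((\<lambda>t. sqrt (4 * pi) * (r t + C * (t * sqrt t)) + t * norm (a (Suc n))) \<longlongrightarrow>
      sqrt (4 * pi) * (0 + C * (0 * sqrt 0)) + 0 * norm (a (Suc n))) (at_right 0)"
    by (intro tendsto_intros r_lim)
  moreover have "\<forall>\<^sub>F t in at_right 0. norm (h n y - a n) \<le> sqrt (4 * pi) * (r t + C * (t * sqrt t)) + t * norm (a (Suc n))"
    unfolding eventually_at_right_field by (intro exI[of _ 1]) (auto intro!: bound)
  ultimately have "norm (h n y - a n) \<le> sqrt (4 * pi) * (0 + C * (0 * sqrt 0)) + 0 * norm (a (Suc n))"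
    by (intro tendsto_lowerbound[where F = "at_right (0 :: real)"]) auto
  then show ?case by simp
qed

theorem theorem3p2p2:
  fixes U :: "real \<Rightarrow> complex^'r^'r"
    and H :: "real \<Rightarrow> real \<Rightarrow> real \<Rightarrow> complex^'r^'r"
    and h :: "nat \<Rightarrow> real \<Rightarrow> complex^'r^'r"
    and n :: nat and x :: real
  assumes "smooth U"
    and "\<And>x. hermitian (U x)"
    and "heat_kernel U H"
    and "heat_coefficients H h"
    and "n \<ge> 1"
  shows "KdV_G h n x =
    (fact (2 * n) / (2 * fact n)) *\<^sub>R
      (\<Sum>j=0..n. (half_binomial n j * ((-1) ^ j * fact (2 * j) / (4 ^ j * fact j * fact (j + n)))) *\<^sub>R
        (\<Sum>p=1..j + n. \<Sum>ks\<in>k_indices n p. real (C_coeff n j ks) *\<^sub>R U_monomial U ks x))"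
proof -
  let ?u = "\<lambda>i. (1 / fact i) *\<^sub>R Dx i U x"
  have "continuous_on UNIV U"
    using smooth_has_vector_derivative[OF assms(1), of 0]
    by (auto simp: Dx_def intro!: continuous_at_imp_continuous_on has_vector_derivative_continuous)
  then obtain vt vx vxx where
    delta: "delta_solution (\<lambda>z. U (z + x)) (\<lambda>t z. H t (z + x) x) vt vx vxx"
    using heat_kernel_imp_delta_solution[OF assms(3)] by blast
  have "h n x = heat_coeff ?u n 0"
  proof (rule heat_coefficients_eq[OF assms(4)])
    fix N
    show "\<exists>C. \<forall>T\<in>{0<..1}. norm (H T x x - (1 / sqrt (4 * pi * T)) *\<^sub>R (\<Sum>k\<le>Suc N. T ^ k *\<^sub>R heat_coeff ?u k 0)) \<le> C * T ^ Suc N"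
      using delta_solution.diagonal_expansion[OF delta smooth_taylor_remainder[OF assms(1)], of N] by simp
  qed
  then show ?thesis
    unfolding KdV_G_def heat_coeff_diagonal_formula[OF assms(5)] by simp
qed

end
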